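(* Let $p$ be a prime. For all integers $d\ge3$ and reals $\delta>0$ there exists $c=c(d,\delta)$ such that the following holds. Let $f\colon\mathbb{F}_p^n\to\mathbb{F}_p$ be an affine disperser for dimension $k$ which has degree $d$ as a polynomial over $\mathbb{F}_p$. Then $f$ is also an affine extractor for dimension $k'=c\cdot k^{d-2}$ with bias $\delta$.
   Context: A function $f\colon\mathbb{F}_p^n\to\mathbb{F}_p$ is an affine disperser for dimension $k$ if it is non-constant on every affine subspace of $\mathbb{F}_p^n$ of dimension $k$. It is an affine extractor for dimension $k'$ with bias $\delta$ if for every affine subspace $u_0+U$ of dimension $k'$, $f(x)$ for $x$ uniform on $u_0+U$ is $\delta$-close in statistical distance to the uniform distribution on $\mathbb{F}_p$. *)

theory Defs
  imports
    "HOL-Probability.Probability_Mass_Function"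
    "HOL-Library.Poly_Mapping"
    "Jordan_Normal_Form.VS_Connect"
    "Berlekamp_Zassenhaus.Finite_Field"
begin

unbundle no vec_syntax

text \<open>
  The space \<open>F\<^sup>n\<close> is \<open>carrier_vec n :: 'a vec set\<close>. A function on it is a function on the
  whole type \<open>'a vec\<close>; every definition below only depends on its values on \<open>carrier_vec n\<close>.
\<close>

definition affine_subspaces :: "nat \<Rightarrow> nat \<Rightarrow> 'a::field vec set set" where
  "affine_subspaces n k =
     {{u0 + u | u. u \<in> U} | u0 U.
        u0 \<in> carrier_vec n \<and>
        VectorSpace.subspace class_ring U (module_vec TYPE('a) n) \<and>
        vectorspace.dim class_ring ((module_vec TYPE('a) n)\<lparr>carrier := U\<rparr>) = k}"

definition affine_disperser :: "nat \<Rightarrow> nat \<Rightarrow> ('a::field vec \<Rightarrow> 'a) \<Rightarrow> bool" where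
  "affine_disperser n k f \<longleftrightarrow> (\<forall>A\<in>affine_subspaces n k. \<not> f constant_on A)"

definition statistical_distance :: "'a::finite pmf \<Rightarrow> 'a pmf \<Rightarrow> real" where
  "statistical_distance P Q = (\<Sum>y\<in>UNIV. \<bar>pmf P y - pmf Q y\<bar>) / 2"

definition affine_extractor ::
    "nat \<Rightarrow> nat \<Rightarrow> real \<Rightarrow> ('a::{field,finite} vec \<Rightarrow> 'a) \<Rightarrow> bool" where
  "affine_extractor n k \<delta> f \<longleftrightarrow>
     (\<forall>A\<in>affine_subspaces n k.
        statistical_distance (map_pmf f (pmf_of_set A)) (pmf_of_set UNIV) \<le> \<delta>)"

text \<open>
  A multivariate polynomial is a finitely supported map from monomials to coefficients, a monomial
  being a finitely supported map from (indices of) variables to exponents.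
\<close>

type_synonym 'a mpoly = "(nat \<Rightarrow>\<^sub>0 nat) \<Rightarrow>\<^sub>0 'a"

definition mpoly_eval :: "'a::comm_semiring_1 mpoly \<Rightarrow> 'a vec \<Rightarrow> 'a" where
  "mpoly_eval P x =
     (\<Sum>m\<in>Poly_Mapping.keys P. Poly_Mapping.lookup P m *
        (\<Prod>i\<in>Poly_Mapping.keys m. (x $ i) ^ Poly_Mapping.lookup m i))"

definition monom_degree :: "(nat \<Rightarrow>\<^sub>0 nat) \<Rightarrow> nat" where
  "monom_degree m = (\<Sum>i\<in>Poly_Mapping.keys m. Poly_Mapping.lookup m i)"

definition total_degree :: "'a::zero mpoly \<Rightarrow> nat" where
  "total_degree P = Max (insert 0 (monom_degree ` Poly_Mapping.keys P))"

definition reduced_mpolys :: "nat \<Rightarrow> 'a::{field,finite} mpoly set" where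
  "reduced_mpolys n =
     {P. \<forall>m\<in>Poly_Mapping.keys P.
           Poly_Mapping.keys m \<subseteq> {..<n} \<and> (\<forall>i. Poly_Mapping.lookup m i < CARD('a))}"

text \<open>
  Every function on \<open>F\<^sup>n\<close> is given by exactly one polynomial whose individual degrees are all
  less than \<open>|F|\<close>; its degree is the total degree of that polynomial. Without this restriction
  the degree would not be well defined, as \<open>x\<^sub>i\<close> and \<open>x\<^sub>i\<close> raised to \<open>|F|\<close> agree
  everywhere.
\<close>

definition has_poly_degree :: "nat \<Rightarrow> ('a::{field,finite} vec \<Rightarrow> 'a) \<Rightarrow> nat \<Rightarrow> bool" where
  "has_poly_degree n f d \<longleftrightarrow>
     (\<exists>P\<in>reduced_mpolys n. (\<forall>x\<in>carrier_vec n. f x = mpoly_eval P x) \<and> total_degree P = d)"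

end

theory Submission
  imports Defs "HOL-Library.Function_Algebras"
begin

text \<open>
  Let \<open>g\<close> be a polynomial of degree \<open>d\<close> on \<open>V = F\<^sub>p\<^sup>N\<close> that is far from uniform. By repeated
  Cauchy--Schwarz, for a positive proportion of \<open>(h\<^sub>1, \<dots>, h\<^sub>d\<^sub>-\<^sub>1)\<close> the iterated difference of \<open>g\<close> along
  \<open>h\<^sub>1, \<dots>, h\<^sub>d\<^sub>-\<^sub>1\<close> is constant. These tuples form the zero set of a family of multiadditive forms. A
  dense zero set of this kind contains the common zero set of a bounded number of multiadditive
  forms \<open>Q\<close>, each in at most \<open>d - 1\<close> of the variables. This form of ``low analytic rank implies low
  partition rank'' has no restriction on the characteristic, and here it replaces the structure theorem
  for biased polynomials.

  A subspace \<open>U\<close> on which \<open>g\<close> is constant and the forms \<open>Q\<close> vanish is then built one vector at a time.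
  As the \<open>Q\<close> vanish on \<open>U\<close>, the function \<open>u \<mapsto> g (u + a v) - g u\<close> has degree only \<open>d - 2\<close> on \<open>U\<close>, hence
  it vanishes as soon as it does so at \<open>O(k\<^sup>d\<^sup>-\<^sup>2)\<close> interpolation points. So a new vector \<open>v\<close> has to satisfy
  \<open>O(k\<^sup>d\<^sup>-\<^sup>2)\<close> equations of degree at most \<open>d\<close>, and Chevalley--Warning provides one when \<open>N\<close> is large.
\<close>

section \<open>Averages over tuples of group elements\<close>

text \<open>The constant must not depend on the dimension \<open>N\<close>, although constancy of a
  \<open>(d - 1)\<close>-fold difference is one equation for each point of the space. Only after
  boundedly many forms \<open>Q\<close> have replaced these equations is the number of conditions on
  a new vector independent of \<open>N\<close>. The exponent comes out right because a form has at
  most \<open>d - 1\<close> slots: on the enlarged subspace it is tested on tuples of generators in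
  which one slot holds the new vector, and this leaves at most \<open>d - 2\<close> slots to fill.
  Interpolating a function of degree \<open>d - 2\<close> costs the same power of the dimension. The
  characteristic is harmless for two reasons. Degree is defined by iterated differences and the
  forms are such differences, so nothing is ever divided by a factorial. Density is handled by
  counting instead of Fourier analysis: sets whose slices in each coordinate are empty or subgroups
  are positively correlated, and an additive map takes the value 0 at least as often as any other
  value.\<close>

definition avg :: "'a set \<Rightarrow> ('a \<Rightarrow> real) \<Rightarrow> real" where
  "avg G F = (\<Sum>x\<in>G. F x) / card G"

definition prob :: "'a set \<Rightarrow> ('a \<Rightarrow> bool) \<Rightarrow> real" where
  "prob G P = avg G (\<lambda>x. of_bool (P x))"

definition add_subgroup :: "'v::ab_group_add set \<Rightarrow> bool" where
  "add_subgroup V \<longleftrightarrow> finite V \<and> 0 \<in> V \<and> (\<forall>x\<in>V. \<forall>y\<in>V. x - y \<in> V)"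

text \<open>Tuples are total functions that vanish outside \<open>K\<close>. So for all finite
  \<open>K\<close> they are subgroups of one function type, and a tuple on \<open>J\<close> is
  combined with one on \<open>K - J\<close> by plain addition.\<close>

definition tuples :: "'v::zero set \<Rightarrow> 'i set \<Rightarrow> ('i \<Rightarrow> 'v) set" where
  "tuples V K = {x. (\<forall>i\<in>K. x i \<in> V) \<and> (\<forall>i. i \<notin> K \<longrightarrow> x i = 0)}"

definition res :: "'i set \<Rightarrow> ('i \<Rightarrow> 'v::zero) \<Rightarrow> 'i \<Rightarrow> 'v" where
  "res J x = (\<lambda>i. if i \<in> J then x i else 0)"

lemma avg_cong: "(\<And>x. x \<in> G \<Longrightarrow> F x = F' x) \<Longrightarrow> avg G F = avg G F'"
  unfolding avg_def by simp

lemma prob_cong: "(\<And>x. x \<in> G \<Longrightarrow> P x = P' x) \<Longrightarrow> prob G P = prob G P'"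
  unfolding prob_def by (rule avg_cong) simp

lemma avg_mono: "(\<And>x. x \<in> G \<Longrightarrow> F x \<le> F' x) \<Longrightarrow> avg G F \<le> avg G F'"
  unfolding avg_def by (intro divide_right_mono sum_mono) auto

lemma prob_mono: "(\<And>x. x \<in> G \<Longrightarrow> P x \<Longrightarrow> P' x) \<Longrightarrow> prob G P \<le> prob G P'"
  unfolding prob_def by (rule avg_mono) auto

lemma avg_const: "finite G \<Longrightarrow> G \<noteq> {} \<Longrightarrow> avg G (\<lambda>_. c) = c"
  unfolding avg_def by simp

lemma avg_add: "avg G (\<lambda>x. F x + F' x) = avg G F + avg G F'"
  unfolding avg_def by (simp add: sum.distrib add_divide_distrib)

lemma avg_diff: "avg G (\<lambda>x. F x - F' x) = avg G F - avg G F'"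
  unfolding avg_def by (simp add: sum_subtractf diff_divide_distrib)

lemma avg_cmult: "avg G (\<lambda>x. c * F x) = c * avg G F"
  unfolding avg_def by (simp add: sum_distrib_left)

lemma avg_sum: "avg G (\<lambda>x. \<Sum>j\<in>J. F j x) = (\<Sum>j\<in>J. avg G (F j))"
  unfolding avg_def by (subst sum.swap) (simp add: sum_divide_distrib)

lemma avg_swap: "avg G (\<lambda>x. avg H (F x)) = avg H (\<lambda>y. avg G (\<lambda>x. F x y))"
proof -
  have "(\<Sum>x\<in>G. \<Sum>y\<in>H. F x y) = (\<Sum>y\<in>H. \<Sum>x\<in>G. F x y)" by (rule sum.swap)
  then show ?thesis unfolding avg_def by (simp add: sum_divide_distrib[symmetric] mult.commute)
qed

lemma avg_bij: "bij_betw h G H \<Longrightarrow> avg G (\<lambda>x. F (h x)) = avg H F"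
  unfolding avg_def using sum.reindex_bij_betw[of h G H F] bij_betw_same_card[of h G H] by simp

lemma prob_bij: "bij_betw h G H \<Longrightarrow> prob G (\<lambda>x. P (h x)) = prob H P"
  unfolding prob_def by (rule avg_bij)

lemma prob_card: "finite G \<Longrightarrow> prob G P = card {x\<in>G. P x} / card G"
  unfolding prob_def avg_def by (simp add: Int_def)

lemma prob_nonneg: "0 \<le> prob G P"
  unfolding prob_def avg_def by (simp add: sum_nonneg)

lemma prob_le_1: "prob G P \<le> 1"
proof (cases "finite G \<and> G \<noteq> {}")
  case True
  have "prob G P \<le> prob G (\<lambda>_. True)" by (rule prob_mono) simp
  also have "\<dots> = 1" using True by (simp add: prob_def avg_const)
  finally show ?thesis .
qed (auto simp: prob_def avg_def)

lemma prob_True: "finite G \<Longrightarrow> G \<noteq> {} \<Longrightarrow> (\<And>x. x \<in> G \<Longrightarrow> P x) \<Longrightarrow> prob G P = 1"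
  by (simp add: prob_def avg_const cong: avg_cong)

lemma prob_pos_ex: "0 < prob G P \<Longrightarrow> \<exists>x\<in>G. P x"
proof (rule ccontr)
  assume "0 < prob G P" "\<not> (\<exists>x\<in>G. P x)"
  then have "prob G P = avg G (\<lambda>_. 0)" unfolding prob_def by (intro avg_cong) auto
  then show False using \<open>0 < prob G P\<close> by (simp add: avg_def)
qed

lemma avg_ex_ge:
  assumes "finite G" "G \<noteq> {}" "c \<le> avg G F"
  shows "\<exists>x\<in>G. c \<le> F x"
proof (rule ccontr)
  assume "\<not> ?thesis"
  then have "(\<Sum>x\<in>G. F x) < (\<Sum>x\<in>G. c)" using assms by (intro sum_strict_mono) auto
  then have "avg G F < c" using assms by (simp add: avg_def field_simps card_gt_0_iff)
  then show False using assms by simp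
qed

lemma prob_union_bound:
  assumes "finite J"
  shows "prob G (\<lambda>x. \<exists>j\<in>J. P j x) \<le> (\<Sum>j\<in>J. prob G (P j))"
proof -
  have "prob G (\<lambda>x. \<exists>j\<in>J. P j x) \<le> avg G (\<lambda>x. \<Sum>j\<in>J. of_bool (P j x))"
    unfolding prob_def
  proof (rule avg_mono)
    fix x
    show "of_bool (\<exists>j\<in>J. P j x) \<le> (\<Sum>j\<in>J. of_bool (P j x) :: real)"
    proof (cases "\<exists>j\<in>J. P j x")
      case True
      then obtain j where "j \<in> J" "P j x" by auto
      then have "of_bool (P j x) \<le> (\<Sum>j\<in>J. of_bool (P j x) :: real)"
        using assms by (intro member_le_sum) auto
      then show ?thesis using True \<open>P j x\<close> by simp
    qed (simp add: sum_nonneg)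
  qed
  then show ?thesis by (simp add: avg_sum prob_def)
qed

lemma add_subgroupD:
  assumes "add_subgroup V"
  shows "finite V" "0 \<in> V" "V \<noteq> {}" "x \<in> V \<Longrightarrow> y \<in> V \<Longrightarrow> x - y \<in> V"
    "x \<in> V \<Longrightarrow> - x \<in> V" "x \<in> V \<Longrightarrow> y \<in> V \<Longrightarrow> x + y \<in> V"
proof -
  show *: "finite V" "0 \<in> V" "V \<noteq> {}" "x \<in> V \<Longrightarrow> y \<in> V \<Longrightarrow> x - y \<in> V" for x y
    using assms by (auto simp: add_subgroup_def)
  show **: "x \<in> V \<Longrightarrow> - x \<in> V" for x using *(4)[of 0 x] *(2) by simp
  show "x \<in> V \<Longrightarrow> y \<in> V \<Longrightarrow> x + y \<in> V" using *(4)[of x "- y"] **[of y] by simp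
qed

lemma add_subgroup_UNIV: "add_subgroup (UNIV :: 'f::{ab_group_add,finite} set)"
  by (simp add: add_subgroup_def)

lemma bij_betw_translation:
  assumes "add_subgroup V" "h \<in> V"
  shows "bij_betw (\<lambda>x. x + h) V V"
  using add_subgroupD[OF assms(1)] assms(2)
  by (intro bij_betwI[where g="\<lambda>x. x - h"]) auto

lemma avg_translation: "add_subgroup V \<Longrightarrow> h \<in> V \<Longrightarrow> avg V (\<lambda>x. F (x + h)) = avg V F"
  by (rule avg_bij[OF bij_betw_translation])

lemma prob_translation: "add_subgroup V \<Longrightarrow> h \<in> V \<Longrightarrow> prob V (\<lambda>x. P (x + h)) = prob V P"
  by (rule prob_bij[OF bij_betw_translation])

lemma tuplesD: "x \<in> tuples V K \<Longrightarrow> i \<in> K \<Longrightarrow> x i \<in> V" "x \<in> tuples V K \<Longrightarrow> i \<notin> K \<Longrightarrow> x i = 0"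
  by (auto simp: tuples_def)

lemma tuplesI: "(\<And>i. i \<in> K \<Longrightarrow> x i \<in> V) \<Longrightarrow> (\<And>i. i \<notin> K \<Longrightarrow> x i = 0) \<Longrightarrow> x \<in> tuples V K"
  by (auto simp: tuples_def)

lemma tuples_in: "0 \<in> V \<Longrightarrow> x \<in> tuples V K \<Longrightarrow> x i \<in> V"
  by (cases "i \<in> K") (auto simp: tuples_def)

lemma tuples_upd: "x \<in> tuples V K \<Longrightarrow> i \<in> K \<Longrightarrow> u \<in> V \<Longrightarrow> x(i := u) \<in> tuples V K"
  by (auto simp: tuples_def)

lemma tuples_empty: "tuples V {} = {0}"
  by (auto simp: tuples_def fun_eq_iff)

lemma tuples_mono: "0 \<in> V \<Longrightarrow> J \<subseteq> K \<Longrightarrow> tuples V J \<subseteq> tuples V K"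
  unfolding tuples_def by force

lemma res_in_tuples: "0 \<in> V \<Longrightarrow> x \<in> tuples V K \<Longrightarrow> res J x \<in> tuples V J"
  by (auto simp: res_def tuples_in intro!: tuplesI)

lemma res_in_tuples_supset: "0 \<in> V \<Longrightarrow> x \<in> tuples V K \<Longrightarrow> J \<subseteq> K \<Longrightarrow> res J x \<in> tuples V K"
  using res_in_tuples[of V x K J] tuples_mono[of V J K] by auto

lemma res_split: "(x :: 'i \<Rightarrow> 'v::monoid_add) \<in> tuples V K \<Longrightarrow> J \<subseteq> K \<Longrightarrow> res J x + res (K - J) x = x"
  by (auto simp: res_def fun_eq_iff tuples_def)

lemma res_id: "x \<in> tuples V K \<Longrightarrow> res K x = x"
  by (auto simp: res_def fun_eq_iff tuples_def)

lemma bij_betw_tuples_insert: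
  assumes "i \<notin> K"
  shows "bij_betw (\<lambda>(u, x). x(i := u)) (V \<times> tuples V K) (tuples V (insert i K))"
proof (rule bij_betwI[where g="\<lambda>x. (x i, x(i := 0))"])
  show "(\<lambda>(u, x). x(i := u)) \<in> V \<times> tuples V K \<rightarrow> tuples V (insert i K)"
    by (auto simp: tuples_def)
  show "(\<lambda>x. (x i, x(i := 0))) \<in> tuples V (insert i K) \<rightarrow> V \<times> tuples V K"
    using assms by (auto simp: tuples_def)
qed (use assms in \<open>auto simp: tuples_def fun_eq_iff\<close>)

lemma finite_tuples: "finite K \<Longrightarrow> finite V \<Longrightarrow> finite (tuples V K)"
proof (induction K rule: finite_induct)
  case (insert i K)
  then show ?case using bij_betw_finite[OF bij_betw_tuples_insert[OF insert(2), of V]] by simp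
qed (simp add: tuples_empty)

lemma card_tuples: "finite K \<Longrightarrow> finite V \<Longrightarrow> card (tuples V K) = card V ^ card K"
proof (induction K rule: finite_induct)
  case (insert i K)
  then show ?case
    using bij_betw_same_card[OF bij_betw_tuples_insert[OF insert(2), of V]] by (simp add: card_cartesian_product)
qed (simp add: tuples_empty)

lemma add_subgroup_tuples:
  assumes "add_subgroup V" "finite K"
  shows "add_subgroup (tuples V K)"
  using add_subgroupD[OF assms(1)] finite_tuples[of K V] assms(2)
  unfolding add_subgroup_def by (auto simp: tuples_def)

lemma avg_product: "avg (A \<times> B) F = avg A (\<lambda>x. avg B (\<lambda>y. F (x, y)))"
proof -
  have "sum F (A \<times> B) = (\<Sum>x\<in>A. \<Sum>y\<in>B. F (x, y))" by (simp add: sum.cartesian_product)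
  then show ?thesis
    unfolding avg_def by (simp add: card_cartesian_product sum_divide_distrib[symmetric] mult.commute)
qed

lemma avg_tuples_split:
  assumes V: "add_subgroup V" and "J \<subseteq> K"
  shows "avg (tuples V K) F = avg (tuples V J) (\<lambda>x. avg (tuples V (K - J)) (\<lambda>a. F (x + a)))"
proof -
  note V = add_subgroupD[OF V]
  have "bij_betw (\<lambda>(x, a). x + a) (tuples V J \<times> tuples V (K - J)) (tuples V K)"
  proof (rule bij_betwI[where g="\<lambda>x. (res J x, res (K - J) x)"])
    show "(\<lambda>(x, a). x + a) \<in> tuples V J \<times> tuples V (K - J) \<rightarrow> tuples V K"
    proof (clarsimp, rule tuplesI)
      fix x a i assume xa: "x \<in> tuples V J" "a \<in> tuples V (K - J)"
      show "(x + a) i \<in> V" using tuples_in[OF V(2) xa(1)] tuples_in[OF V(2) xa(2)] V(6) by simp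
      show "(x + a) i = 0" if "i \<notin> K" using xa \<open>J \<subseteq> K\<close> that by (auto simp: tuples_def)
    qed
    show "(\<lambda>x. (res J x, res (K - J) x)) \<in> tuples V K \<rightarrow> tuples V J \<times> tuples V (K - J)"
      using V by (auto intro!: res_in_tuples)
    show "y \<in> tuples V K \<Longrightarrow> (case (res J y, res (K - J) y) of (x, a) \<Rightarrow> x + a) = y" for y
      using assms by (simp add: res_split)
    show "(res J (case z of (x, a) \<Rightarrow> x + a), res (K - J) (case z of (x, a) \<Rightarrow> x + a)) = z"
      if "z \<in> tuples V J \<times> tuples V (K - J)" for z
      using that \<open>J \<subseteq> K\<close> by (auto simp: res_def fun_eq_iff tuples_def)
  qed
  from avg_bij[OF this, of F] show ?thesis by (simp add: avg_product case_prod_unfold)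
qed

section \<open>Positive correlation of sets that are subgroups slice by slice\<close>

text \<open>Each slice in one coordinate is empty or a subgroup: taking \<open>y = x\<close> puts 0
  into a nonempty slice. Empty slices have to be allowed because a form is constant in every
  coordinate outside its own slots, where a slice of its zero set is everything or nothing.\<close>

definition slice_subgroup :: "'v::ab_group_add set \<Rightarrow> 'i set \<Rightarrow> (('i \<Rightarrow> 'v) \<Rightarrow> bool) \<Rightarrow> bool" where
  "slice_subgroup V K P \<longleftrightarrow> (\<forall>i\<in>K. \<forall>x\<in>tuples V K. \<forall>y\<in>tuples V K.
     P x \<longrightarrow> P y \<longrightarrow> (\<forall>j. j \<noteq> i \<longrightarrow> x j = y j) \<longrightarrow> P (x(i := x i - y i)))"

lemma slice_subgroupD:
  "slice_subgroup V K P \<Longrightarrow> i \<in> K \<Longrightarrow> x \<in> tuples V K \<Longrightarrow> y \<in> tuples V K \<Longrightarrow> P x \<Longrightarrow> P y \<Longrightarrow>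
    (\<And>j. j \<noteq> i \<Longrightarrow> x j = y j) \<Longrightarrow> P (x(i := x i - y i))"
  unfolding slice_subgroup_def by blast

lemma slice_subgroup_Ball:
  "(\<And>j. j \<in> J \<Longrightarrow> slice_subgroup V K (P j)) \<Longrightarrow> slice_subgroup V K (\<lambda>x. \<forall>j\<in>J. P j x)"
  unfolding slice_subgroup_def by blast

lemma card_le_fibrewise:
  assumes "finite A" "finite B"
    and "\<And>r. card {a\<in>A. f a = r} \<le> card {b\<in>B. g b = r}"
  shows "card A \<le> card B"
proof -
  have R: "finite (f ` A \<union> g ` B)" using assms by simp
  have "card A = (\<Sum>r\<in>f ` A \<union> g ` B. card {a\<in>A. f a = r})"
    using sum.group[OF assms(1) R, of f "\<lambda>_. 1::nat"] by simp
  also have "\<dots> \<le> (\<Sum>r\<in>f ` A \<union> g ` B. card {b\<in>B. g b = r})"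
    by (rule sum_mono) (rule assms(3))
  also have "\<dots> = card B"
    using sum.group[OF assms(2) R, of g "\<lambda>_. 1::nat"] by simp
  finally show ?thesis .
qed

text \<open>Setting a coordinate of the translation vector to 0 replaces intersections of a subgroup
  with a coset by intersections of two subgroups, which can only be larger.\<close>

lemma card_translate_zero_coordinate:
  assumes V: "add_subgroup V" and K: "finite K"
    and P: "slice_subgroup V K P" and Q: "slice_subgroup V K Q"
    and z: "z \<in> tuples V K" and i: "i \<in> K"
  shows "card {a\<in>tuples V K. P a \<and> Q (a + z)} \<le> card {a\<in>tuples V K. P a \<and> Q (a + z(i := 0))}"
    (is "card ?A \<le> card ?B")
proof (rule card_le_fibrewise[where f="\<lambda>a. a(i := 0)" and g="\<lambda>a. a(i := 0)"])
  note VD = add_subgroupD[OF V] and GD = add_subgroupD[OF add_subgroup_tuples[OF V K]]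
  show "finite ?A" "finite ?B" using GD(1) by auto
  fix r
  show "card {a\<in>?A. a(i := 0) = r} \<le> card {a\<in>?B. a(i := 0) = r}"
  proof (cases "{a\<in>?A. a(i := 0) = r} = {}")
    case False
    then obtain b where b: "b \<in> tuples V K" "P b" "Q (b + z)" "b(i := 0) = r" by auto
    \<comment> \<open>The fibre is translated by its base point \<open>b\<close>. A difference of
      two points of the same coset lies in the subgroup, and the shift \<open>z i\<close> cancels
      from it.\<close>
    let ?h = "\<lambda>a. a(i := a i - b i)"
    have "?h a \<in> {a\<in>?B. a(i := 0) = r}" if a: "a \<in> {a\<in>?A. a(i := 0) = r}" for a
    proof -
      have a': "a \<in> tuples V K" "P a" "Q (a + z)" "a(i := 0) = r" using a by auto
      have eq: "a j = b j" if "j \<noteq> i" for j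
        using a'(4) b(4) that by (metis fun_upd_other)
      have 1: "?h a \<in> tuples V K"
        by (rule tuples_upd[OF a'(1) i VD(4)[OF tuplesD(1)[OF a'(1) i] tuplesD(1)[OF b(1) i]]])
      have 2: "P (?h a)" using slice_subgroupD[OF P i a'(1) b(1) a'(2) b(2) eq] .
      have az: "a + z \<in> tuples V K" "b + z \<in> tuples V K"
        by (rule GD(6)[OF a'(1) z], rule GD(6)[OF b(1) z])
      have e: "(a + z)(i := (a + z) i - (b + z) i) = ?h a + z(i := 0)"
        by (auto simp: fun_eq_iff)
      have eqz: "(a + z) j = (b + z) j" if "j \<noteq> i" for j
        unfolding plus_fun_apply eq[OF that] ..
      have "Q ((a + z)(i := (a + z) i - (b + z) i))"
        using slice_subgroupD[OF Q i az a'(3) b(3) eqz] .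
      then have 3: "Q (?h a + z(i := 0))" unfolding e .
      have 4: "(?h a)(i := 0) = r" using a'(4) by (simp add: fun_upd_twist)
      show ?thesis using 1 2 3 4 by auto
    qed
    moreover have "inj_on ?h {a\<in>?A. a(i := 0) = r}"
    proof (rule inj_onI)
      fix a c assume ac: "a \<in> {a\<in>?A. a(i := 0) = r}" "c \<in> {a\<in>?A. a(i := 0) = r}" "?h a = ?h c"
      have "a j = c j" for j using fun_cong[OF ac(3), of j] by (cases "j = i") auto
      then show "a = c" by (simp add: fun_eq_iff)
    qed
    moreover have "finite {a\<in>?B. a(i := 0) = r}" using GD(1) by auto
    ultimately show ?thesis by (intro card_inj_on_le[of ?h]) auto
  next
    case True
    then show ?thesis by (metis card.empty le0)
  qed
qed

lemma card_translate_zero: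
  assumes V: "add_subgroup V" and K: "finite K"
    and P: "slice_subgroup V K P" and Q: "slice_subgroup V K Q" and z: "z \<in> tuples V K"
  shows "card {a\<in>tuples V K. P a \<and> Q (a + z)} \<le> card {a\<in>tuples V K. P a \<and> Q a}"
proof -
  have "card {a\<in>tuples V K. P a \<and> Q (a + z)} \<le> card {a\<in>tuples V K. P a \<and> Q (a + res (K - L) z)}"
    if "finite L" "L \<subseteq> K" for L using that
  proof (induction L rule: finite_induct)
    case empty
    then show ?case using res_id[OF z] by simp
  next
    case (insert i L)
    have e: "(res (K - L) z)(i := 0) = res (K - insert i L) z"
      by (auto simp: res_def fun_eq_iff)
    have z': "res (K - L) z \<in> tuples V K"
      using res_in_tuples_supset[OF add_subgroupD(2)[OF V] z] by auto
    have "i \<in> K" "L \<subseteq> K" using insert.prems by auto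
    show ?case
      using order.trans[OF insert.IH[OF \<open>L \<subseteq> K\<close>] card_translate_zero_coordinate[OF V K P Q z' \<open>i \<in> K\<close>]]
      unfolding e .
  qed
  from this[OF K order_refl] show ?thesis by (simp add: res_def zero_fun_def[symmetric])
qed

text \<open>For a random shift \<open>z\<close> the events \<open>P a\<close> and
  \<open>Q (a + z)\<close> are independent, so the product is the average over \<open>z\<close> of
  the probability that both hold. By \<open>card_translate_zero\<close> no shift does better than
  \<open>z = 0\<close>.\<close>

lemma prob_conj_ge:
  assumes V: "add_subgroup V" and K: "finite K"
    and P: "slice_subgroup V K P" and Q: "slice_subgroup V K Q"
  shows "prob (tuples V K) P * prob (tuples V K) Q \<le> prob (tuples V K) (\<lambda>x. P x \<and> Q x)"
proof -
  let ?G = "tuples V K"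
  note G = add_subgroup_tuples[OF V K]
  note GD = add_subgroupD[OF G]
  have "prob ?G P * prob ?G Q = avg ?G (\<lambda>a. of_bool (P a) * prob ?G Q)"
    unfolding prob_def using avg_cmult[of ?G "avg ?G (\<lambda>x. of_bool (Q x))"] by (simp add: mult.commute)
  also have "\<dots> = avg ?G (\<lambda>a. of_bool (P a) * prob ?G (\<lambda>z. Q (a + z)))"
  proof (rule avg_cong)
    fix a assume "a \<in> ?G"
    then show "of_bool (P a) * prob ?G Q = of_bool (P a) * prob ?G (\<lambda>z. Q (a + z))"
      using prob_translation[OF G, of a Q] by (simp add: add.commute)
  qed
  also have "\<dots> = avg ?G (\<lambda>a. avg ?G (\<lambda>z. of_bool (P a \<and> Q (a + z))))"
    unfolding prob_def by (simp only: avg_cmult[symmetric] of_bool_conj)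
  also have "\<dots> = avg ?G (\<lambda>z. prob ?G (\<lambda>a. P a \<and> Q (a + z)))"
    unfolding prob_def by (subst avg_swap) simp
  also have "\<dots> \<le> avg ?G (\<lambda>z. prob ?G (\<lambda>a. P a \<and> Q a))"
    by (rule avg_mono) (use card_translate_zero[OF V K P Q] GD in
      \<open>auto simp: prob_card divide_right_mono\<close>)
  also have "\<dots> = prob ?G (\<lambda>x. P x \<and> Q x)" using GD by (simp add: avg_const)
  finally show ?thesis .
qed

lemma prob_Ball_ge:
  assumes V: "add_subgroup V" and K: "finite K" and J: "finite J" and \<eta>: "0 \<le> \<eta>"
    and P: "\<And>j. j \<in> J \<Longrightarrow> slice_subgroup V K (P j)"
    and "\<And>j. j \<in> J \<Longrightarrow> \<eta> \<le> prob (tuples V K) (P j)"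
  shows "\<eta> ^ card J \<le> prob (tuples V K) (\<lambda>x. \<forall>j\<in>J. P j x)"
  using J P assms(6)
proof (induction J rule: finite_induct)
  case empty
  then show ?case using add_subgroupD[OF add_subgroup_tuples[OF V K]] by (simp add: prob_True)
next
  case (insert j J)
  have "\<eta> ^ card (insert j J) \<le> prob (tuples V K) (P j) * prob (tuples V K) (\<lambda>x. \<forall>j\<in>J. P j x)"
    using insert \<eta> by (auto intro!: mult_mono prob_nonneg)
  also have "\<dots> \<le> prob (tuples V K) (\<lambda>x. P j x \<and> (\<forall>j\<in>J. P j x))"
    using insert by (intro prob_conj_ge[OF V K] slice_subgroup_Ball) auto
  finally show ?case by simp
qed

section \<open>Multiadditive forms\<close>

text \<open>A form takes functions on the whole index type but depends only on the slots in
  \<open>I\<close>. Thus forms with different sets of slots share one type, and fixing some slots of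
  a form does not change its type.\<close>

definition multadd :: "'v::ab_group_add set \<Rightarrow> 'i set \<Rightarrow> (('i \<Rightarrow> 'v) \<Rightarrow> 'f::ab_group_add) \<Rightarrow> bool" where
  "multadd V I Q \<longleftrightarrow> (\<forall>x y. (\<forall>i\<in>I. x i = y i) \<longrightarrow> Q x = Q y) \<and>
     (\<forall>x. (\<forall>i\<in>I. x i \<in> V) \<longrightarrow>
        (\<forall>i\<in>I. \<forall>u\<in>V. \<forall>w\<in>V. Q (x(i := u + w)) = Q (x(i := u)) + Q (x(i := w))))"

definition glue :: "'i set \<Rightarrow> ('i \<Rightarrow> 'v) \<Rightarrow> ('i \<Rightarrow> 'v) \<Rightarrow> 'i \<Rightarrow> 'v" where
  "glue J x a = (\<lambda>i. if i \<in> J then x i else a i)"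

lemma multadd_cong: "multadd V I Q \<Longrightarrow> (\<And>i. i \<in> I \<Longrightarrow> x i = y i) \<Longrightarrow> Q x = Q y"
  unfolding multadd_def by blast

lemma multadd_add:
  "multadd V I Q \<Longrightarrow> (\<And>i. i \<in> I \<Longrightarrow> x i \<in> V) \<Longrightarrow> i \<in> I \<Longrightarrow> u \<in> V \<Longrightarrow> w \<in> V \<Longrightarrow>
    Q (x(i := u + w)) = Q (x(i := u)) + Q (x(i := w))"
  unfolding multadd_def by blast

lemma multadd_zero:
  assumes "add_subgroup V" "multadd V I Q" "\<And>i. i \<in> I \<Longrightarrow> x i \<in> V" "i \<in> I" "x i = 0"
  shows "Q x = 0"
  using multadd_add[OF assms(2), of x i 0 0] assms add_subgroupD(2)[OF assms(1)]
  by (simp add: fun_upd_idem)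

lemma multadd_diff:
  assumes "add_subgroup V" "multadd V I Q" "\<And>i. i \<in> I \<Longrightarrow> x i \<in> V" "i \<in> I" "u \<in> V" "w \<in> V"
  shows "Q (x(i := u - w)) = Q (x(i := u)) - Q (x(i := w))"
  using multadd_add[OF assms(2-4) add_subgroupD(4)[OF assms(1,5,6)] assms(6)] by simp

lemma slice_subgroup_multadd:
  assumes V: "add_subgroup V" and Q: "multadd V I Q" "I \<subseteq> K"
  shows "slice_subgroup V K (\<lambda>x. Q x = 0)"
  unfolding slice_subgroup_def
proof (intro ballI impI)
  fix i x y assume h: "i \<in> K" "x \<in> tuples V K" "y \<in> tuples V K" "Q x = 0" "Q y = 0"
    "\<forall>j. j \<noteq> i \<longrightarrow> x j = y j"
  have xV: "x j \<in> V" "y j \<in> V" for j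
    using tuples_in[OF add_subgroupD(2)[OF V] h(2)] tuples_in[OF add_subgroupD(2)[OF V] h(3)] by auto
  show "Q (x(i := x i - y i)) = 0"
  proof (cases "i \<in> I")
    case True
    have "x(i := y i) = y" using h(6) by (auto simp: fun_eq_iff)
    then show ?thesis using multadd_diff[OF V Q(1), of x i "x i" "y i"] xV True h by simp
  next
    case False
    then have "Q (x(i := x i - y i)) = Q x" by (intro multadd_cong[OF Q(1)]) auto
    then show ?thesis using h by simp
  qed
qed

lemma multadd_freeze:
  assumes "multadd V I Q" "\<And>i. i \<in> I \<Longrightarrow> i \<notin> S \<Longrightarrow> a i \<in> V"
  shows "multadd V (I \<inter> S) (\<lambda>x. Q (glue S x a))"
  unfolding multadd_def
proof (intro conjI allI impI ballI)
  fix x y :: "'b \<Rightarrow> 'a" assume "\<forall>i\<in>I \<inter> S. x i = y i"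
  then show "Q (glue S x a) = Q (glue S y a)"
    by (intro multadd_cong[OF assms(1)]) (auto simp: glue_def)
next
  fix x i u w assume "\<forall>i\<in>I \<inter> S. x i \<in> V" "i \<in> I \<inter> S" "u \<in> V" "w \<in> V"
  moreover have "glue S (x(i := v)) a = (glue S x a)(i := v)" for v
    using \<open>i \<in> I \<inter> S\<close> by (auto simp: glue_def fun_eq_iff)
  ultimately show "Q (glue S (x(i := u + w)) a) = Q (glue S (x(i := u)) a) + Q (glue S (x(i := w)) a)"
    using multadd_add[OF assms(1), of "glue S x a" i u w] assms(2) by (auto simp: glue_def)
qed

section \<open>Level sets of additive maps\<close>

text \<open>Every level set is empty or a translate of the kernel, so the kernel is the most likely
  of the \<open>CARD('f)\<close> levels.\<close>

lemma prob_kernel_ge: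
  fixes \<phi> :: "'v::ab_group_add \<Rightarrow> 'f::{ab_group_add,finite}"
  assumes V: "add_subgroup V" and add: "\<And>x y. x \<in> V \<Longrightarrow> y \<in> V \<Longrightarrow> \<phi> (x + y) = \<phi> x + \<phi> y"
  shows "1 / real CARD('f) \<le> prob V (\<lambda>x. \<phi> x = 0)"
proof -
  note VD = add_subgroupD[OF V]
  have le: "prob V (\<lambda>x. \<phi> x = c) \<le> prob V (\<lambda>x. \<phi> x = 0)" for c
  proof (cases "\<exists>u\<in>V. \<phi> u = c")
    case True
    then obtain u where u: "u \<in> V" "\<phi> u = c" by auto
    have "prob V (\<lambda>x. \<phi> x = c) = prob V (\<lambda>x. \<phi> (x + u) = c)" using prob_translation[OF V u(1), of "\<lambda>x. \<phi> x = c"] by simp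
    also have "\<dots> = prob V (\<lambda>x. \<phi> x = 0)" using u add by (intro prob_cong) auto
    finally show ?thesis by simp
  next
    case False
    then have "prob V (\<lambda>x. \<phi> x = c) = prob V (\<lambda>_. False)" by (intro prob_cong) auto
    also have "\<dots> = 0" by (simp add: prob_def avg_def)
    finally show ?thesis using prob_nonneg by metis
  qed
  have "(\<Sum>c\<in>UNIV. of_bool (\<phi> x = c)) = (1::real)" for x
    using sum.delta'[of UNIV "\<phi> x" "\<lambda>_. 1::real"] by (simp only: of_bool_def) simp
  then have "1 = avg V (\<lambda>x. \<Sum>c\<in>UNIV. of_bool (\<phi> x = c))"
    by (simp only: avg_const[OF VD(1,3)])
  also have "\<dots> = (\<Sum>c\<in>UNIV. prob V (\<lambda>x. \<phi> x = c))" by (simp only: avg_sum prob_def)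
  also have "\<dots> \<le> real CARD('f) * prob V (\<lambda>x. \<phi> x = 0)"
    using sum_bounded_above[of "UNIV :: 'f set" "\<lambda>c. prob V (\<lambda>x. \<phi> x = c)"] le by simp
  finally show ?thesis by (simp add: field_simps)
qed

text \<open>The multiples of \<open>\<phi> w\<close> already exhaust the prime field, so every level
  set is a translate of the kernel.\<close>

lemma prob_level_eq:
  fixes \<phi> :: "'v::ab_group_add \<Rightarrow> 'p::prime_card mod_ring"
  assumes V: "add_subgroup V" and add: "\<And>x y. x \<in> V \<Longrightarrow> y \<in> V \<Longrightarrow> \<phi> (x + y) = \<phi> x + \<phi> y"
    and w: "w \<in> V" "\<phi> w \<noteq> 0"
  shows "prob V (\<lambda>x. \<phi> x = c) = 1 / real CARD('p)"
proof -
  note VD = add_subgroupD[OF V]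
  have zero: "\<phi> 0 = 0" using add[OF VD(2) VD(2)] by (metis add.right_neutral add_left_cancel)
  have mult: "\<exists>u\<in>V. \<phi> u = of_nat n * \<phi> w" for n
  proof (induction n)
    case 0
    then show ?case using VD zero by auto
  next
    case (Suc n)
    then obtain u where "u \<in> V" "\<phi> u = of_nat n * \<phi> w" by auto
    then show ?case using w VD add by (intro bexI[of _ "u + w"]) (auto simp: algebra_simps)
  qed
  have surj: "\<exists>u\<in>V. \<phi> u = c" for c
  proof -
    obtain n where "c / \<phi> w = of_nat n" using surj_of_nat_mod_ring[of "c / \<phi> w"] by auto
    then show ?thesis using mult[of n] w(2) by (metis nonzero_eq_divide_eq)
  qed
  have le: "prob V (\<lambda>x. \<phi> x = c) = prob V (\<lambda>x. \<phi> x = 0)" for c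
  proof -
    obtain u where u: "u \<in> V" "\<phi> u = c" using surj by auto
    have "prob V (\<lambda>x. \<phi> x = c) = prob V (\<lambda>x. \<phi> (x + u) = c)" using prob_translation[OF V u(1), of "\<lambda>x. \<phi> x = c"] by simp
    also have "\<dots> = prob V (\<lambda>x. \<phi> x = 0)" using u add by (intro prob_cong) auto
    finally show ?thesis by simp
  qed
  have "(\<Sum>c\<in>UNIV. of_bool (\<phi> x = c)) = (1::real)" for x
    using sum.delta'[of UNIV "\<phi> x" "\<lambda>_. 1::real"] by (simp only: of_bool_def) simp
  then have "1 = avg V (\<lambda>x. \<Sum>c\<in>UNIV. of_bool (\<phi> x = c))"
    by (simp only: avg_const[OF VD(1,3)])
  also have "\<dots> = (\<Sum>c\<in>UNIV. prob V (\<lambda>x. \<phi> x = c))" by (simp only: avg_sum prob_def)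
  also have "\<dots> = (\<Sum>c\<in>(UNIV :: 'p mod_ring set). prob V (\<lambda>x. \<phi> x = 0))"
    by (intro sum.cong refl le)
  finally show ?thesis using le[of c] by (simp add: field_simps)
qed

text \<open>With the other coordinates fixed, the form is additive in slot \<open>i\<close> and
  \<open>prob_kernel_ge\<close> applies. A form without slots would be an arbitrary constant, which
  is why some \<open>i \<in> I\<close> is demanded.\<close>

lemma prob_multadd_ge:
  fixes Q :: "('i \<Rightarrow> 'v::ab_group_add) \<Rightarrow> 'f::{ab_group_add,finite}"
  assumes V: "add_subgroup V" and K: "finite K" and Q: "multadd V I Q" and I: "I \<subseteq> K" "i \<in> I"
  shows "1 / real CARD('f) \<le> prob (tuples V K) (\<lambda>x. Q x = 0)"
proof -
  let ?G = "tuples V K" and ?F = "\<lambda>x. of_bool (Q x = 0) :: real"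
  note G = add_subgroup_tuples[OF V K] and VD = add_subgroupD[OF V]
  have single: "0(i := u) \<in> ?G" if "u \<in> V" for u
    using that I VD by (auto simp: tuples_def)
  \<comment> \<open>Resampling coordinate \<open>i\<close> of a uniform tuple leaves it uniform;
    this is translation invariance under the tuples supported at \<open>i\<close>.\<close>
  have "avg ?G (\<lambda>x. avg V (\<lambda>u. ?F (x(i := u)))) = avg ?G ?F"
  proof -
    have "avg ?G (\<lambda>x. avg V (\<lambda>u. ?F (x(i := u)))) = avg ?G (\<lambda>x. avg V (\<lambda>u. ?F (x + 0(i := u))))"
    proof (rule avg_cong)
      fix x assume x: "x \<in> ?G"
      have e: "x + 0(i := u) = x(i := u + x i)" for u by (auto simp: fun_eq_iff add.commute)
      have xi: "x i \<in> V" using tuplesD(1)[OF x, of i] I by blast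
      show "avg V (\<lambda>u. ?F (x(i := u))) = avg V (\<lambda>u. ?F (x + 0(i := u)))"
        unfolding e by (rule avg_translation[OF V xi, of "\<lambda>u. ?F (x(i := u))", symmetric])
    qed
    also have "\<dots> = avg V (\<lambda>u. avg ?G (\<lambda>x. ?F (x + 0(i := u))))" by (rule avg_swap)
    also have "\<dots> = avg V (\<lambda>u. avg ?G ?F)"
      by (intro avg_cong avg_translation[OF G] single)
    also have "\<dots> = avg ?G ?F" using VD by (simp add: avg_const)
    finally show ?thesis .
  qed
  moreover have "avg ?G (\<lambda>_. 1 / real CARD('f)) \<le> avg ?G (\<lambda>x. avg V (\<lambda>u. ?F (x(i := u))))"
  proof (rule avg_mono)
    fix x assume x: "x \<in> ?G"
    show "1 / real CARD('f) \<le> avg V (\<lambda>u. ?F (x(i := u)))"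
      using prob_kernel_ge[OF V, of "\<lambda>u. Q (x(i := u))"] multadd_add[OF Q, of x i] I tuples_in[OF VD(2) x]
      unfolding prob_def by auto
  qed
  ultimately show ?thesis using add_subgroupD[OF G] by (simp add: avg_const prob_def)
qed

section \<open>Replacing many forms by few combinations\<close>

text \<open>At a fixed \<open>x\<close> the combination is a nonzero additive function of the
  coefficients, so it vanishes for exactly a \<open>1 / p\<close> share of them. Some choice of
  \<open>c\<close> does at least as well as the average over all choices.\<close>

lemma ex_combination_detecting:
  fixes m :: "'x \<Rightarrow> 'w \<Rightarrow> 'p::prime_card mod_ring"
  assumes X: "finite X" and W: "finite W" and nz: "\<And>x. x \<in> X \<Longrightarrow> \<exists>w\<in>W. m x w \<noteq> 0"
  shows "\<exists>c. CARD('p) * card {x\<in>X. (\<Sum>w\<in>W. c w * m x w) = 0} \<le> card X"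
proof -
  let ?G = "tuples (UNIV :: 'p mod_ring set) W"
  have G: "add_subgroup ?G" by (rule add_subgroup_tuples[OF add_subgroup_UNIV W])
  note GD = add_subgroupD[OF G]
  let ?\<phi> = "\<lambda>x c. \<Sum>w\<in>W. c w * m x w"
  have pr: "prob ?G (\<lambda>c. ?\<phi> x c = 0) = 1 / real CARD('p)" if x: "x \<in> X" for x
  proof -
    obtain w where w: "w \<in> W" "m x w \<noteq> 0" using nz[OF x] by auto
    have "?\<phi> x (0(w := 1)) = m x w"
      using w W by (simp add: if_distrib[of "\<lambda>t. t * _"] sum.delta cong: if_cong)
    then show ?thesis
      using w by (intro prob_level_eq[OF G, where w="0(w := 1)"])
        (auto simp: sum.distrib algebra_simps tuples_def)
  qed
  have "avg ?G (\<lambda>c. real (card {x\<in>X. ?\<phi> x c = 0})) = avg ?G (\<lambda>c. \<Sum>x\<in>X. of_bool (?\<phi> x c = 0))"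
    using X by (intro avg_cong) (simp add: Int_def)
  also have "\<dots> = (\<Sum>x\<in>X. prob ?G (\<lambda>c. ?\<phi> x c = 0))" by (simp add: avg_sum prob_def)
  also have "\<dots> = card X / CARD('p)" by (simp add: pr)
  finally have "avg ?G (\<lambda>c. - real (card {x\<in>X. ?\<phi> x c = 0})) = - (card X / CARD('p))"
    using avg_cmult[of ?G "-1" "\<lambda>c. real (card {x\<in>X. ?\<phi> x c = 0})"] by simp
  then obtain c where "- (card X / CARD('p)) \<le> - real (card {x\<in>X. ?\<phi> x c = 0})"
    using avg_ex_ge[OF GD(1,3), of "- (card X / CARD('p))" "\<lambda>c. - real (card {x\<in>X. ?\<phi> x c = 0})"] by auto
  then have "real (CARD('p) * card {x\<in>X. ?\<phi> x c = 0}) \<le> real (card X)"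
    by (simp add: field_simps)
  then show ?thesis by (intro exI[of _ c]) (simp only: of_nat_le_iff)
qed

lemma multadd_combination:
  fixes M :: "'w \<Rightarrow> ('i \<Rightarrow> 'v::ab_group_add) \<Rightarrow> 'f::comm_ring"
  assumes "\<And>w. w \<in> W \<Longrightarrow> multadd V I (M w)"
  shows "multadd V I (\<lambda>x. \<Sum>w\<in>W. c w * M w x)"
  unfolding multadd_def
proof (intro conjI allI impI ballI)
  fix x y :: "'i \<Rightarrow> 'v" assume "\<forall>i\<in>I. x i = y i"
  then show "(\<Sum>w\<in>W. c w * M w x) = (\<Sum>w\<in>W. c w * M w y)"
    by (intro sum.cong refl arg_cong[where f="\<lambda>t. c _ * t"] multadd_cong[OF assms]) auto
next
  fix x i u w assume "\<forall>i\<in>I. x i \<in> V" "i \<in> I" "u \<in> V" "w \<in> V"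
  then show "(\<Sum>k\<in>W. c k * M k (x(i := u + w))) = (\<Sum>k\<in>W. c k * M k (x(i := u))) + (\<Sum>k\<in>W. c k * M k (x(i := w)))"
    unfolding sum.distrib[symmetric]
    by (intro sum.cong refl) (simp add: multadd_add[OF assms] distrib_left)
qed

text \<open>Every further combination cuts the set of false zeros by a factor \<open>p\<close>. The
  number \<open>t\<close> is dictated by the admissible error alone, not by the number of forms in
  \<open>\<M>\<close>.\<close>

lemma ex_few_forms_approximating:
  fixes \<M> :: "(('i \<Rightarrow> 'v::ab_group_add) \<Rightarrow> 'p::prime_card mod_ring) set"
  assumes G: "finite G" and M: "finite \<M>" "\<And>M. M \<in> \<M> \<Longrightarrow> multadd V K M"
  shows "\<exists>\<B> :: (('i \<Rightarrow> 'v) \<Rightarrow> 'p mod_ring) set. finite \<B> \<and> card \<B> \<le> t \<and> (\<forall>\<beta>\<in>\<B>. multadd V K \<beta>) \<and>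
    (\<forall>x. (\<forall>M\<in>\<M>. M x = 0) \<longrightarrow> (\<forall>\<beta>\<in>\<B>. \<beta> x = 0)) \<and>
    CARD('p) ^ t * card {x\<in>G. (\<forall>\<beta>\<in>\<B>. \<beta> x = 0) \<and> (\<exists>M\<in>\<M>. M x \<noteq> 0)} \<le> card G"
proof (induction t)
  case 0
  show ?case by (rule exI[of _ "{}"]) (auto intro!: card_mono G)
next
  case (Suc t)
  obtain \<B> :: "(('i \<Rightarrow> 'v) \<Rightarrow> 'p mod_ring) set" where B: "finite \<B>" "card \<B> \<le> t" "\<forall>\<beta>\<in>\<B>. multadd V K \<beta>"
    "\<forall>x. (\<forall>M\<in>\<M>. M x = 0) \<longrightarrow> (\<forall>\<beta>\<in>\<B>. \<beta> x = 0)"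
    "CARD('p) ^ t * card {x\<in>G. (\<forall>\<beta>\<in>\<B>. \<beta> x = 0) \<and> (\<exists>M\<in>\<M>. M x \<noteq> 0)} \<le> card G"
    using Suc.IH by (elim exE conjE) (rule that; assumption)
  let ?X = "{x\<in>G. (\<forall>\<beta>\<in>\<B>. \<beta> x = 0) \<and> (\<exists>M\<in>\<M>. M x \<noteq> 0)}"
  have "\<exists>c. CARD('p) * card {x\<in>?X. (\<Sum>M\<in>\<M>. c M * M x) = 0} \<le> card ?X"
    by (rule ex_combination_detecting) (use G M(1) in auto)
  then obtain c where c: "CARD('p) * card {x\<in>?X. (\<Sum>M\<in>\<M>. c M * M x) = 0} \<le> card ?X" ..
  let ?\<beta> = "\<lambda>x. \<Sum>M\<in>\<M>. c M * M x"
  have eq: "{x\<in>G. (\<forall>\<beta>\<in>insert ?\<beta> \<B>. \<beta> x = 0) \<and> (\<exists>M\<in>\<M>. M x \<noteq> 0)} = {x\<in>?X. ?\<beta> x = 0}" by auto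
  have "CARD('p) ^ Suc t * card {x\<in>?X. ?\<beta> x = 0} \<le> CARD('p) ^ t * card ?X"
    using mult_le_mono2[OF c, of "CARD('p) ^ t"] by (simp add: mult_ac)
  then have "CARD('p) ^ Suc t * card {x\<in>G. (\<forall>\<beta>\<in>insert ?\<beta> \<B>. \<beta> x = 0) \<and> (\<exists>M\<in>\<M>. M x \<noteq> 0)} \<le> card G"
    unfolding eq using B(5) by (rule order.trans)
  moreover have "multadd V K ?\<beta>" by (rule multadd_combination) (rule M(2))
  moreover have "?\<beta> x = 0" if "\<forall>M\<in>\<M>. M x = 0" for x using that by simp
  moreover have "card (insert ?\<beta> \<B>) \<le> Suc t"
    using le_trans[OF card_insert_le_m1[of "Suc t" \<B> ?\<beta>]] B(1,2) by simp
  ultimately show ?case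
    using B(1,3,4) by (intro exI[of _ "insert ?\<beta> \<B>"] conjI) (simp_all only: finite_insert ball_simps, blast+)
qed

text \<open>Both conditions say that all the \<open>2\<^sup>|\<^sup>K\<^sup>|\<close> choices of a summand in each coordinate of \<open>u + x\<close>
  give zero; one passes from one to the other one coordinate at a time.\<close>

lemma multadd_cube:
  assumes V: "add_subgroup V" and K: "finite K" and Q: "multadd V I Q" "I \<subseteq> K"
    and x: "x \<in> tuples V K" and u: "u \<in> tuples V K"
  shows "(\<forall>J. J \<subseteq> K \<longrightarrow> Q (u + res J x) = 0) \<longleftrightarrow> (\<forall>J. J \<subseteq> K \<longrightarrow> Q (glue J x u) = 0)"
proof -
  note VD = add_subgroupD[OF V]
  \<comment> \<open>\<open>pt R J\<close> interpolates between the two families: in the slots of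
    \<open>R\<close> that belong to \<open>J\<close>, the entry \<open>u i + x i\<close> has already
    been replaced by \<open>x i\<close>.\<close>
  define pt where "pt R J = (\<lambda>i. if i \<in> J then if i \<in> R then x i else u i + x i else u i)" for R J
  have xu: "x i \<in> V" "u i \<in> V" for i
    using tuples_in[OF VD(2) x] tuples_in[OF VD(2) u] by auto
  have pt_V: "pt R J i \<in> V" for R J i using xu VD(6) by (simp add: pt_def)
  \<comment> \<open>For \<open>i \<in> J\<close> the sets \<open>J\<close> and
    \<open>J - {i}\<close> see the entries \<open>u i + x i\<close> and \<open>u i\<close> in slot
    \<open>i\<close> before the change, and \<open>x i\<close> and \<open>u i\<close> after it. By
    additivity either pair of zeros yields the third zero.\<close>
  have key: "(Q (pt R J) = 0 \<and> Q (pt R (J - {i})) = 0) \<longleftrightarrow>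
    (Q (pt (insert i R) J) = 0 \<and> Q (pt (insert i R) (J - {i})) = 0)" if "i \<in> J" "i \<notin> R" for R J i
  proof -
    let ?y = "pt R J"
    have 1: "pt R J = ?y(i := u i + x i)" "pt R (J - {i}) = ?y(i := u i)"
      "pt (insert i R) J = ?y(i := x i)" "pt (insert i R) (J - {i}) = ?y(i := u i)"
      using that by (auto simp: pt_def fun_eq_iff)
    show ?thesis
    proof (cases "i \<in> I")
      case True
      then have "Q (?y(i := u i + x i)) = Q (?y(i := u i)) + Q (?y(i := x i))"
        using multadd_add[OF Q(1), of ?y i] pt_V xu by blast
      then show ?thesis using 1 by auto
    next
      case False
      then have "Q (?y(i := v)) = Q ?y" for v by (intro multadd_cong[OF Q(1)]) auto
      then show ?thesis using 1 by metis
    qed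
  qed
  have step: "(\<forall>J. J \<subseteq> K \<longrightarrow> Q (pt R J) = 0) \<longleftrightarrow> (\<forall>J. J \<subseteq> K \<longrightarrow> Q (pt (insert i R) J) = 0)"
    if "i \<notin> R" for R i
  proof -
    have same: "pt R J = pt (insert i R) J" if "i \<notin> J" for J
      using that by (auto simp: pt_def fun_eq_iff)
    have sub: "J - {i} \<subseteq> K" if "J \<subseteq> K" for J using that by auto
    show ?thesis
    proof (intro iffI allI impI)
      fix J assume h: "\<forall>J. J \<subseteq> K \<longrightarrow> Q (pt R J) = 0" "J \<subseteq> K"
      show "Q (pt (insert i R) J) = 0"
      proof (cases "i \<in> J")
        case True
        then show ?thesis using h(1)[rule_format, OF h(2)] h(1)[rule_format, OF sub[OF h(2)]] key[OF True that] by blast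
      next
        case False
        then show ?thesis using h(1)[rule_format, OF h(2)] by (simp only: same[OF False])
      qed
    next
      fix J assume h: "\<forall>J. J \<subseteq> K \<longrightarrow> Q (pt (insert i R) J) = 0" "J \<subseteq> K"
      show "Q (pt R J) = 0"
      proof (cases "i \<in> J")
        case True
        then show ?thesis using h(1)[rule_format, OF h(2)] h(1)[rule_format, OF sub[OF h(2)]] key[OF True that] by blast
      next
        case False
        then show ?thesis using h(1)[rule_format, OF h(2)] by (simp only: same[OF False])
      qed
    qed
  qed
  have "(\<forall>J. J \<subseteq> K \<longrightarrow> Q (pt {} J) = 0) \<longleftrightarrow> (\<forall>J. J \<subseteq> K \<longrightarrow> Q (pt R J) = 0)" if "finite R" for R
    using that
  proof (induction R rule: finite_induct)
    case (insert i R)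
    show ?case by (rule trans[OF insert.IH step[OF insert.hyps(2)]])
  qed (rule refl)
  from this[OF K] have "(\<forall>J. J \<subseteq> K \<longrightarrow> Q (pt {} J) = 0) \<longleftrightarrow> (\<forall>J. J \<subseteq> K \<longrightarrow> Q (pt K J) = 0)" .
  moreover have "pt {} J = u + res J x" for J by (auto simp: pt_def res_def fun_eq_iff)
  moreover have "pt K J = glue J x u" if "J \<subseteq> K" for J using that by (auto simp: pt_def glue_def fun_eq_iff)
  ultimately show ?thesis by metis
qed

section \<open>Dense zero sets of multiadditive maps\<close>

text \<open>Each form is paired with its set of slots. Since that set is nonempty, the form vanishes
  at the zero tuple, so the construction of the constant subspace can start from
  \<open>{0}\<close>.\<close>

definition forms_on ::
    "'v::ab_group_add set \<Rightarrow> 'i set \<Rightarrow> ('i set \<times> (('i \<Rightarrow> 'v) \<Rightarrow> 'f::ab_group_add)) set \<Rightarrow> bool" where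
  "forms_on V K \<Q> \<longleftrightarrow> finite \<Q> \<and>
     (\<forall>q\<in>\<Q>. fst q \<subseteq> K \<and> fst q \<noteq> {} \<and> multadd V (fst q) (snd q))"

lemma glue_eq_add: "x \<in> tuples V S \<Longrightarrow> a \<in> tuples V (K - S) \<Longrightarrow> glue S x a = x + (a :: 'i \<Rightarrow> 'v::ab_group_add)"
  by (auto simp: glue_def tuples_def fun_eq_iff)

lemma glue_eq_add': "x \<in> tuples V S \<Longrightarrow> a \<in> tuples V (K - S) \<Longrightarrow> glue (- S) a x = x + (a :: 'i \<Rightarrow> 'v::ab_group_add)"
  by (auto simp: glue_def tuples_def fun_eq_iff)

lemma glue_swap: "glue J x u = glue (- J) u x"
  by (auto simp: glue_def fun_eq_iff)

lemma slice_subgroup_cong: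
  assumes V: "add_subgroup V" and P: "slice_subgroup V K P"
    and eq: "\<And>x. x \<in> tuples V K \<Longrightarrow> P x = P' x"
  shows "slice_subgroup V K P'"
  unfolding slice_subgroup_def
proof (intro ballI impI)
  fix i x y assume h: "i \<in> K" "x \<in> tuples V K" "y \<in> tuples V K" "P' x" "P' y" "\<forall>j. j \<noteq> i \<longrightarrow> x j = y j"
  have m: "x(i := x i - y i) \<in> tuples V K"
    by (rule tuples_upd[OF h(2,1) add_subgroupD(4)[OF V tuplesD(1)[OF h(2,1)] tuplesD(1)[OF h(3,1)]]])
  have "P x" "P y" using h(4,5) eq[OF h(2)] eq[OF h(3)] by blast+
  from slice_subgroupD[OF P h(1-3) this] h(6) have "P (x(i := x i - y i))" by blast
  then show "P' (x(i := x i - y i))" using eq[OF m] by blast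
qed

text \<open>This carries information from a random cube to the fixed point \<open>x\<close>: by
  \<open>multadd_cube\<close> the tuples glued from \<open>x\<close> and \<open>u\<close> are zeros
  too, and the one with \<open>J = K\<close> agrees with \<open>x\<close> on all slots of
  \<open>Q\<close>.\<close>

lemma multadd_zero_of_cube:
  assumes V: "add_subgroup V" and K: "finite K" and Q: "multadd V I Q" "I \<subseteq> K"
    and x: "x \<in> tuples V K" and u: "u \<in> tuples V K"
    and z: "\<And>J. J \<subseteq> K \<Longrightarrow> Q (u + res J x) = 0"
  shows "Q x = 0"
proof -
  have "Q (glue K x u) = 0" using multadd_cube[OF V K Q x u] z by blast
  moreover have "Q (glue K x u) = Q x"
    by (rule multadd_cong[OF Q(1)]) (use Q(2) in \<open>auto simp: glue_def\<close>)
  ultimately show ?thesis by simp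
qed

text \<open>The bound on the number of forms does not depend on \<open>\<B>\<close>: fixing the coordinates outside
  \<open>S\<close> at random turns most points of \<open>V\<^sup>S\<close> with an unpopular fibre into non-zeros, and the few
  exceptions are avoided by a random cube.\<close>

lemma popular_fibres:
  fixes \<B> :: "(('i \<Rightarrow> 'v::ab_group_add) \<Rightarrow> 'p::prime_card mod_ring) set"
  assumes V: "add_subgroup V" and K: "finite K" and S: "S \<subseteq> K"
    and B: "\<And>\<beta>. \<beta> \<in> \<B> \<Longrightarrow> multadd V K \<beta>" "finite \<B>"
    and \<epsilon>: "0 < \<epsilon>" "\<epsilon> \<le> prob (tuples V K) (\<lambda>x. \<forall>\<beta>\<in>\<B>. \<beta> x = 0)"
    and IH: "\<And>\<M> :: (('i \<Rightarrow> 'v) \<Rightarrow> 'p mod_ring) set. finite \<M> \<Longrightarrow> \<forall>M\<in>\<M>. multadd V S M \<Longrightarrow>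
      \<epsilon> / 2 \<le> prob (tuples V S) (\<lambda>x. \<forall>M\<in>\<M>. M x = 0) \<Longrightarrow>
      \<exists>\<Q> :: ('i set \<times> (('i \<Rightarrow> 'v) \<Rightarrow> 'p mod_ring)) set. forms_on V S \<Q> \<and> card \<Q> \<le> c \<and>
        (\<forall>x\<in>tuples V S. (\<forall>q\<in>\<Q>. snd q x = 0) \<longrightarrow> (\<forall>M\<in>\<M>. M x = 0))"
    and \<eta>: "0 < \<eta>" "2 ^ card S * (2 * \<eta> / \<epsilon>) < (1 / CARD('p)) ^ (2 ^ card S * c)"
  shows "\<exists>\<Q> :: ('i set \<times> (('i \<Rightarrow> 'v) \<Rightarrow> 'p mod_ring)) set. forms_on V S \<Q> \<and> card \<Q> \<le> c \<and>
    (\<forall>x\<in>tuples V S. (\<forall>q\<in>\<Q>. snd q x = 0) \<longrightarrow>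
       \<eta> ^ (2 ^ card S) \<le> prob (tuples V (K - S)) (\<lambda>a. \<forall>\<beta>\<in>\<B>. \<beta> (x + a) = 0))"
proof -
  define GS where "GS = tuples V S"
  define GT where "GT = tuples V (K - S)"
  \<comment> \<open>\<open>b y\<close> is the density of the fibre over \<open>y\<close>,
    \<open>Y a\<close> is the slice of the zero set at \<open>a\<close>, and \<open>bad a\<close> is
    the unpopular part of that slice.\<close>
  define b where "b y = prob GT (\<lambda>a. \<forall>\<beta>\<in>\<B>. \<beta> (y + a) = 0)" for y
  define Y where "Y a y \<longleftrightarrow> (\<forall>\<beta>\<in>\<B>. \<beta> (y + a) = 0)" for a y
  define bad where "bad a y \<longleftrightarrow> Y a y \<and> b y < \<eta>" for a y
  have finS: "finite S" using S K finite_subset by blast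
  have finT: "finite (K - S)" using K by blast
  have GS: "add_subgroup GS" unfolding GS_def by (rule add_subgroup_tuples[OF V finS])
  have GT: "add_subgroup GT" unfolding GT_def by (rule add_subgroup_tuples[OF V finT])
  note VD = add_subgroupD[OF V] and GSD = add_subgroupD[OF GS] and GTD = add_subgroupD[OF GT]
  have eY: "\<epsilon> \<le> avg GT (\<lambda>a. prob GS (Y a))"
  proof -
    have "\<epsilon> \<le> avg GS (\<lambda>x. avg GT (\<lambda>a. of_bool (Y a x)))"
      using \<epsilon>(2) unfolding prob_def avg_tuples_split[OF V S] GS_def GT_def Y_def .
    then show ?thesis unfolding prob_def by (subst avg_swap)
  qed
  \<comment> \<open>An unpopular \<open>y\<close> belongs to \<open>Y a\<close> for only a share
    \<open>b y < \<eta>\<close> of all \<open>a\<close>.\<close>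
  have ebad: "avg GT (\<lambda>a. prob GS (bad a)) \<le> \<eta>"
  proof -
    have "avg GT (\<lambda>a. prob GS (bad a)) = avg GS (\<lambda>y. avg GT (\<lambda>a. of_bool (bad a y)))"
      unfolding prob_def by (rule avg_swap)
    also have "\<dots> \<le> avg GS (\<lambda>y. \<eta>)"
    proof (rule avg_mono)
      fix y
      have "avg GT (\<lambda>a. of_bool (bad a y)) = of_bool (b y < \<eta>) * b y"
        unfolding b_def prob_def avg_cmult[symmetric] bad_def Y_def
        by (rule avg_cong) (simp add: of_bool_conj)
      also have "\<dots> \<le> \<eta>" using \<eta>(1) by (cases "b y < \<eta>") auto
      finally show "avg GT (\<lambda>a. of_bool (bad a y)) \<le> \<eta>" .
    qed
    also have "\<dots> = \<eta>" by (rule avg_const[OF GSD(1,3)])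
    finally show ?thesis .
  qed
  \<comment> \<open>The weight \<open>\<epsilon> / (2 * \<eta>)\<close> lets a single
    \<open>a\<close> serve both purposes: its slice has density at least
    \<open>\<epsilon> / 2\<close>, and the bad part has density at most
    \<open>2 * \<eta> / \<epsilon>\<close>.\<close>
  have "\<epsilon> / 2 \<le> \<epsilon> - \<epsilon> / (2 * \<eta>) * \<eta>" using \<eta>(1) by simp
  also have "\<dots> \<le> avg GT (\<lambda>a. prob GS (Y a)) - \<epsilon> / (2 * \<eta>) * avg GT (\<lambda>a. prob GS (bad a))"
    using eY ebad \<eta>(1) \<epsilon>(1) by (intro diff_mono mult_left_mono) auto
  also have "\<dots> = avg GT (\<lambda>a. prob GS (Y a) - \<epsilon> / (2 * \<eta>) * prob GS (bad a))"
    by (simp only: avg_diff avg_cmult)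
  finally obtain a where a: "a \<in> GT" "\<epsilon> / 2 \<le> prob GS (Y a) - \<epsilon> / (2 * \<eta>) * prob GS (bad a)"
    using avg_ex_ge[OF GTD(1,3)] by blast
  have c0: "0 \<le> \<epsilon> / (2 * \<eta>) * prob GS (bad a)" using \<epsilon>(1) \<eta>(1) prob_nonneg[of GS "bad a"] by simp
  have a1: "\<epsilon> / 2 \<le> prob GS (Y a)" using a(2) c0 by linarith
  have "\<epsilon> / (2 * \<eta>) * prob GS (bad a) \<le> 1"
    using a(2) prob_le_1[of GS "Y a"] \<epsilon>(1) by linarith
  then have a2: "prob GS (bad a) \<le> 2 * \<eta> / \<epsilon>" using \<epsilon>(1) \<eta>(1) by (simp add: field_simps)
  have aV: "a i \<in> V" for i by (rule tuples_in[OF VD(2) a(1)[unfolded GT_def]])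
  define \<M> where "\<M> = (\<lambda>\<beta> x. \<beta> (glue S x a)) ` \<B>"
  have Mzero: "(\<forall>M\<in>\<M>. M x = 0) \<longleftrightarrow> Y a x" if "x \<in> GS" for x
  proof -
    have "glue S x a = x + a" using glue_eq_add that a(1) unfolding GS_def GT_def by blast
    then show ?thesis by (simp add: \<M>_def Y_def)
  qed
  have frz: "multadd V S (\<lambda>x. \<beta> (glue S x a'))" if "\<beta> \<in> \<B>" "\<And>i. a' i \<in> V" for \<beta> a'
    using multadd_freeze[OF B(1)[OF that(1)], of S a'] that(2) S by (simp add: Int_absorb1)
  have "\<forall>M\<in>\<M>. multadd V S M" unfolding \<M>_def using frz aV by blast
  moreover have "\<epsilon> / 2 \<le> prob (tuples V S) (\<lambda>x. \<forall>M\<in>\<M>. M x = 0)"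
  proof -
    have "prob GS (\<lambda>x. \<forall>M\<in>\<M>. M x = 0) = prob GS (Y a)" by (rule prob_cong) (rule Mzero)
    then show ?thesis using a1 unfolding GS_def by simp
  qed
  moreover have "finite \<M>" unfolding \<M>_def using B(2) by blast
  ultimately obtain \<Q> :: "('i set \<times> (('i \<Rightarrow> 'v) \<Rightarrow> 'p mod_ring)) set" where Q: "forms_on V S \<Q>" "card \<Q> \<le> c"
    "\<forall>x\<in>tuples V S. (\<forall>q\<in>\<Q>. snd q x = 0) \<longrightarrow> (\<forall>M\<in>\<M>. M x = 0)"
    using IH[of \<M>] by blast
  have QD: "fst q \<subseteq> S" "fst q \<noteq> {}" "multadd V (fst q) (snd q)" if "q \<in> \<Q>" for q
    using Q(1) that unfolding forms_on_def by blast+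
  have Qfin: "finite \<Q>" using Q(1) unfolding forms_on_def by blast
  have "\<eta> ^ (2 ^ card S) \<le> prob GT (\<lambda>a. \<forall>\<beta>\<in>\<B>. \<beta> (x + a) = 0)"
    if x: "x \<in> GS" and xQ: "\<forall>q\<in>\<Q>. snd q x = 0" for x
  proof -
    have xV: "x i \<in> V" for i by (rule tuples_in[OF VD(2) x[unfolded GS_def]])
    \<comment> \<open>By \<open>multadd_cube\<close> this event says that the whole cube
      \<open>u + res J x\<close> consists of zeros of \<open>\<Q>\<close>. It is an intersection of
      at most \<open>2 ^ card S * c\<close> positively correlated conditions of density at least
      \<open>1 / p\<close> each.\<close>
    let ?E = "\<lambda>u. \<forall>k\<in>Pow S \<times> \<Q>. snd (snd k) (glue (fst k) x u) = 0"
    have Ek: "slice_subgroup V S (\<lambda>u. snd (snd k) (glue (fst k) x u) = 0)"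
      "1 / CARD('p) \<le> prob GS (\<lambda>u. snd (snd k) (glue (fst k) x u) = 0)"
      if "k \<in> Pow S \<times> \<Q>" for k
    proof -
      obtain J q where k: "k = (J, q)" "J \<subseteq> S" "q \<in> \<Q>" using \<open>k \<in> Pow S \<times> \<Q>\<close> by auto
      have ma: "multadd V (fst q \<inter> - J) (\<lambda>u. snd q (glue J x u))"
        unfolding glue_swap[of J x] by (rule multadd_freeze[OF QD(3)[OF k(3)] xV])
      have sub: "fst q \<inter> - J \<subseteq> S" using QD(1)[OF k(3)] by blast
      show "slice_subgroup V S (\<lambda>u. snd (snd k) (glue (fst k) x u) = 0)"
        unfolding k fst_conv snd_conv by (rule slice_subgroup_multadd[OF V ma sub])
      show "1 / CARD('p) \<le> prob GS (\<lambda>u. snd (snd k) (glue (fst k) x u) = 0)"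
      proof (cases "fst q \<inter> - J = {}")
        \<comment> \<open>All slots of \<open>q\<close> are filled from \<open>x\<close>, so the
          condition does not involve \<open>u\<close> and holds because \<open>x\<close> is a zero
          of \<open>q\<close>.\<close>
        case True
        have "snd q (glue J x u) = snd q x" for u
          by (rule multadd_cong[OF QD(3)[OF k(3)]]) (use True in \<open>auto simp: glue_def\<close>)
        then have "prob GS (\<lambda>u. snd (snd k) (glue (fst k) x u) = 0) = 1"
          using xQ k(3) unfolding k fst_conv snd_conv by (intro prob_True[OF GSD(1,3)]) simp
        then show ?thesis by simp
      next
        case False
        then obtain i where "i \<in> fst q \<inter> - J" by blast
        from prob_multadd_ge[OF V finS ma sub this] show ?thesis
          unfolding k fst_conv snd_conv GS_def by simp
      qed
    qed
    have "2 ^ card S * (2 * \<eta> / \<epsilon>) < (1 / real CARD('p)) ^ (2 ^ card S * c)" by (rule \<eta>(2))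
    also have "\<dots> \<le> (1 / real CARD('p)) ^ card (Pow S \<times> \<Q>)"
      using Q(2) finS by (intro power_decreasing) (auto simp: card_cartesian_product card_Pow)
    also have "\<dots> \<le> prob GS ?E"
      unfolding GS_def
      using Ek Qfin finS unfolding GS_def by (intro prob_Ball_ge[OF V finS]) auto
    finally have Ebig: "2 ^ card S * (2 * \<eta> / \<epsilon>) < prob GS ?E" .
    have resGS: "res J x \<in> GS" if "J \<subseteq> S" for J
      unfolding GS_def by (rule res_in_tuples_supset[OF VD(2) x[unfolded GS_def] that])
    have "\<exists>u\<in>GS. ?E u \<and> (\<forall>J\<in>Pow S. \<not> bad a (u + res J x))"
    proof (rule ccontr)
      assume "\<not> ?thesis"
      then have "prob GS ?E \<le> prob GS (\<lambda>u. \<exists>J\<in>Pow S. bad a (u + res J x))"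
        by (intro prob_mono) blast
      also have "\<dots> \<le> (\<Sum>J\<in>Pow S. prob GS (\<lambda>u. bad a (u + res J x)))"
        by (rule prob_union_bound) (use finS in blast)
      also have "\<dots> \<le> (\<Sum>J\<in>Pow S. 2 * \<eta> / \<epsilon>)"
        using a2 resGS by (intro sum_mono) (simp add: prob_translation[OF GS])
      also have "\<dots> = 2 ^ card S * (2 * \<eta> / \<epsilon>)" using finS by (simp add: card_Pow)
      finally show False using Ebig by linarith
    qed
    then obtain u where u: "u \<in> GS" "?E u" "\<And>J. J \<subseteq> S \<Longrightarrow> \<not> bad a (u + res J x)" by blast
    have good: "\<eta> \<le> b (u + res J x)" if J: "J \<subseteq> S" for J
    proof -
      have "snd q (u + res J x) = 0" if q: "q \<in> \<Q>" for q
      proof -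
        have "\<forall>J. J \<subseteq> S \<longrightarrow> snd q (glue J x u) = 0" using u(2) q by fastforce
        then show ?thesis
          using multadd_cube[OF V finS QD(3,1)[OF q] x[unfolded GS_def] u(1)[unfolded GS_def]] J by blast
      qed
      moreover have uJ: "u + res J x \<in> GS" by (rule GSD(6)[OF u(1) resGS[OF J]])
      ultimately have "Y a (u + res J x)" using Q(3) Mzero unfolding GS_def by blast
      then show ?thesis using u(3)[OF J] unfolding bad_def by (simp add: not_less)
    qed
    \<comment> \<open>Every vertex of the cube now has a popular fibre. These fibres correlate
      positively, and a point common to all of them belongs to the fibre over \<open>x\<close> as
      well.\<close>
    let ?P = "\<lambda>J a. \<forall>\<beta>\<in>\<B>. \<beta> (u + res J x + a) = 0"
    have "\<eta> ^ card (Pow S) \<le> prob GT (\<lambda>a. \<forall>J\<in>Pow S. ?P J a)"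
      unfolding GT_def
    proof (rule prob_Ball_ge[OF V finT])
      fix J assume "J \<in> Pow S"
      then have J: "J \<subseteq> S" by blast
      show "\<eta> \<le> prob (tuples V (K - S)) (?P J)" using good[OF J] unfolding b_def GT_def .
      have yS: "u + res J x \<in> tuples V S"
        using GSD(6)[OF u(1) resGS[OF J]] unfolding GS_def .
      show "slice_subgroup V (K - S) (?P J)"
      proof (rule slice_subgroup_Ball)
        fix \<beta> assume \<beta>: "\<beta> \<in> \<B>"
        have "multadd V (K \<inter> - S) (\<lambda>a. \<beta> (glue (- S) a (u + res J x)))"
          by (rule multadd_freeze[OF B(1)[OF \<beta>]]) (rule tuples_in[OF VD(2) yS])
        then have "slice_subgroup V (K - S) (\<lambda>a. \<beta> (glue (- S) a (u + res J x)) = 0)"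
          by (rule slice_subgroup_multadd[OF V]) blast
        then show "slice_subgroup V (K - S) (\<lambda>a. \<beta> (u + res J x + a) = 0)"
          by (rule slice_subgroup_cong[OF V]) (simp only: glue_eq_add'[OF yS])
      qed
    qed (use finS \<eta>(1) in auto)
    also have "\<dots> \<le> prob GT (\<lambda>a. \<forall>\<beta>\<in>\<B>. \<beta> (x + a) = 0)"
    proof (rule prob_mono, rule ballI)
      fix a' \<beta> assume a': "a' \<in> GT" "\<forall>J\<in>Pow S. ?P J a'" and \<beta>: "\<beta> \<in> \<B>"
      have eq: "glue S y a' = y + a'" if "y \<in> GS" for y
        using glue_eq_add that a'(1) unfolding GS_def GT_def by blast
      have a'V: "a' i \<in> V" for i by (rule tuples_in[OF VD(2) a'(1)[unfolded GT_def]])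
      have "\<beta> (glue S x a') = 0"
      proof (rule multadd_zero_of_cube[OF V finS frz[OF \<beta> a'V] order_refl x[unfolded GS_def] u(1)[unfolded GS_def]])
        fix J assume J: "J \<subseteq> S"
        show "\<beta> (glue S (u + res J x) a') = 0"
          unfolding eq[OF GSD(6)[OF u(1) resGS[OF J]]] using a'(2) \<beta> J by blast
      qed
      then show "\<beta> (x + a') = 0" unfolding eq[OF x] .
    qed
    finally show ?thesis using finS by (simp add: card_Pow)
  qed
  then show ?thesis using Q(1,2) unfolding GS_def GT_def by (intro exI[of _ \<Q>]) blast
qed

text \<open>Induction on the number of slots. Few combinations \<open>\<B>\<close> approximate
  \<open>\<M>\<close>, and for each proper subset \<open>S\<close> of the slots
  \<open>popular_fibres\<close> gives forms whose zeros on \<open>S\<close> extend to many zeros of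
  \<open>\<B>\<close>. At a common zero \<open>x\<close> of all these forms, a fixed share of the
  cubes through \<open>a\<close> in the directions \<open>res J x\<close> then consists of zeros of
  \<open>\<B>\<close>. If some member of \<open>\<M>\<close> did not vanish at \<open>x\<close>,
  each such cube would have a vertex among the false zeros of \<open>\<B>\<close>, and these are too
  rare. It matters that \<open>C\<close> is chosen before \<open>V\<close> and
  \<open>\<M>\<close>.\<close>

theorem dense_zero_set_contains_variety:
  fixes \<epsilon> :: real
  assumes "0 < \<epsilon>"
  shows "\<exists>C. \<forall>(V :: 'v::ab_group_add set) (K :: 'i set) (\<M> :: (('i \<Rightarrow> 'v) \<Rightarrow> 'p::prime_card mod_ring) set).
    add_subgroup V \<longrightarrow> finite K \<longrightarrow> card K = k \<longrightarrow> finite \<M> \<longrightarrow> (\<forall>M\<in>\<M>. multadd V K M) \<longrightarrow>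
    \<epsilon> \<le> prob (tuples V K) (\<lambda>x. \<forall>M\<in>\<M>. M x = 0) \<longrightarrow>
    (\<exists>\<Q> :: ('i set \<times> (('i \<Rightarrow> 'v) \<Rightarrow> 'p mod_ring)) set. forms_on V K \<Q> \<and> card \<Q> \<le> C \<and>
      (\<forall>x\<in>tuples V K. (\<forall>q\<in>\<Q>. snd q x = 0) \<longrightarrow> (\<forall>M\<in>\<M>. M x = 0)))"
  using assms
proof (induction k arbitrary: \<epsilon> rule: less_induct)
  case (less k)
  note \<epsilon> = less.prems
  show ?case
  proof (cases "k = 0")
    case True
    show ?thesis
    proof (intro exI[of _ 0] allI impI)
      fix V :: "'v set" and K :: "'i set" and \<M> :: "(('i \<Rightarrow> 'v) \<Rightarrow> 'p mod_ring) set"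
      assume h: "finite K" "card K = k" "\<epsilon> \<le> prob (tuples V K) (\<lambda>x. \<forall>M\<in>\<M>. M x = 0)"
      have K: "tuples V K = {0}" using h(1,2) True by (simp add: tuples_empty)
      have "0 < prob (tuples V K) (\<lambda>x. \<forall>M\<in>\<M>. M x = 0)" using h(3) \<epsilon> by linarith
      then have "\<forall>M\<in>\<M>. M 0 = 0" using prob_pos_ex unfolding K by blast
      then show "\<exists>\<Q> :: ('i set \<times> (('i \<Rightarrow> 'v) \<Rightarrow> 'p mod_ring)) set. forms_on V K \<Q> \<and> card \<Q> \<le> 0 \<and>
          (\<forall>x\<in>tuples V K. (\<forall>q\<in>\<Q>. snd q x = 0) \<longrightarrow> (\<forall>M\<in>\<M>. M x = 0))"
        unfolding K by (intro exI[of _ "{}"]) (simp add: forms_on_def)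
    qed
  next
    case False
    have \<epsilon>2: "0 < \<epsilon> / 2" using \<epsilon> by simp
    define R where "R s C \<longleftrightarrow> (\<forall>(V :: 'v set) (K :: 'i set) (\<M> :: (('i \<Rightarrow> 'v) \<Rightarrow> 'p mod_ring) set).
      add_subgroup V \<longrightarrow> finite K \<longrightarrow> card K = s \<longrightarrow> finite \<M> \<longrightarrow> (\<forall>M\<in>\<M>. multadd V K M) \<longrightarrow>
      \<epsilon> / 2 \<le> prob (tuples V K) (\<lambda>x. \<forall>M\<in>\<M>. M x = 0) \<longrightarrow>
      (\<exists>\<Q> :: ('i set \<times> (('i \<Rightarrow> 'v) \<Rightarrow> 'p mod_ring)) set. forms_on V K \<Q> \<and> card \<Q> \<le> C \<and>
        (\<forall>x\<in>tuples V K. (\<forall>q\<in>\<Q>. snd q x = 0) \<longrightarrow> (\<forall>M\<in>\<M>. M x = 0))))" for s and C :: nat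
    have "\<exists>C. R s C" if "s < k" for s
      unfolding R_def by (rule less.IH[OF that \<epsilon>2])
    then obtain C where C: "\<And>s. s < k \<Longrightarrow> R s (C s)" by metis
    let ?p = "real CARD('p)"
    have p1: "1 < ?p" using prime_gt_1_nat[OF prime_card[where 'a='p]] by simp
    define c where "c = (\<Sum>s<k. C s)"
    have c: "C s \<le> c" if "s < k" for s unfolding c_def using that by (intro member_le_sum) auto
    \<comment> \<open>Chosen to satisfy the last hypothesis of \<open>popular_fibres\<close> with
      \<open>k\<close> in place of \<open>card S\<close>. The minimum with 1 makes powers of
      \<open>\<eta>\<close> decreasing, so one value serves every \<open>S\<close>.\<close>
    define \<eta> where "\<eta> = min 1 (\<epsilon> * (1 / ?p) ^ (2 ^ k * c) / (4 * 2 ^ k))"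
    have \<eta>: "0 < \<eta>" "\<eta> \<le> 1" using \<epsilon> p1 unfolding \<eta>_def by auto
    have \<eta>b: "2 ^ k * (2 * \<eta> / \<epsilon>) < (1 / ?p) ^ (2 ^ k * c)"
    proof -
      have "2 ^ k * (2 * \<eta> / \<epsilon>) \<le> 2 ^ k * (2 * (\<epsilon> * (1 / ?p) ^ (2 ^ k * c) / (4 * 2 ^ k)) / \<epsilon>)"
        using \<epsilon> unfolding \<eta>_def by (intro mult_left_mono divide_right_mono) auto
      also have "\<dots> = (1 / ?p) ^ (2 ^ k * c) / 2" using \<epsilon> by (simp add: field_simps)
      also have "\<dots> < (1 / ?p) ^ (2 ^ k * c)" using p1 by simp
      finally show ?thesis .
    qed
    define \<sigma> where "\<sigma> = min (\<eta> ^ (2 ^ k)) \<epsilon>"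
    have \<sigma>: "0 < \<sigma>" "\<sigma> \<le> \<eta> ^ (2 ^ k)" "\<sigma> \<le> \<epsilon>" "\<sigma> \<le> 1"
      using \<eta> \<epsilon> power_le_one[of \<eta> "2 ^ k"] unfolding \<sigma>_def by auto
    \<comment> \<open>With this \<open>t\<close> the false zeros are so rare that fewer than a
      \<open>\<sigma> ^ (2 ^ k)\<close> share of the cubes, with \<open>2 ^ k\<close> vertices each,
      can meet them.\<close>
    obtain t where t: "(1 / ?p) ^ t < \<sigma> ^ (2 ^ k) / 2 ^ k"
      using real_arch_pow_inv[of "\<sigma> ^ (2 ^ k) / 2 ^ k" "1 / ?p"] \<sigma>(1) p1 by auto
    show ?thesis
    proof (intro exI[of _ "2 ^ k * c + t"] allI impI)
      fix V :: "'v set" and K :: "'i set" and \<M> :: "(('i \<Rightarrow> 'v) \<Rightarrow> 'p mod_ring) set"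
      assume V: "add_subgroup V" and K: "finite K" "card K = k" and M: "finite \<M>" "\<forall>M\<in>\<M>. multadd V K M"
        and dense: "\<epsilon> \<le> prob (tuples V K) (\<lambda>x. \<forall>M\<in>\<M>. M x = 0)"
      define G where "G = tuples V K"
      have G: "add_subgroup G" unfolding G_def by (rule add_subgroup_tuples[OF V K(1)])
      note VD = add_subgroupD[OF V] and GD = add_subgroupD[OF G]
      have Kne: "K \<noteq> {}" using K False by auto
      obtain \<B> :: "(('i \<Rightarrow> 'v) \<Rightarrow> 'p mod_ring) set" where B: "finite \<B>" "card \<B> \<le> t" "\<forall>\<beta>\<in>\<B>. multadd V K \<beta>"
        "\<forall>x. (\<forall>M\<in>\<M>. M x = 0) \<longrightarrow> (\<forall>\<beta>\<in>\<B>. \<beta> x = 0)"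
        "CARD('p) ^ t * card {x\<in>G. (\<forall>\<beta>\<in>\<B>. \<beta> x = 0) \<and> (\<exists>M\<in>\<M>. M x \<noteq> 0)} \<le> card G"
        using ex_few_forms_approximating[OF GD(1) M(1), of V K t] M(2) by blast
      define bad where "bad x \<longleftrightarrow> (\<forall>\<beta>\<in>\<B>. \<beta> x = 0) \<and> (\<exists>M\<in>\<M>. M x \<noteq> 0)" for x
      have bad: "prob G bad \<le> (1 / ?p) ^ t"
      proof -
        have "real (CARD('p) ^ t * card {x\<in>G. bad x}) \<le> real (card G)"
          using B(5) unfolding bad_def of_nat_le_iff .
        moreover have "0 < card G" using GD(1,3) by (simp add: card_gt_0_iff)
        ultimately show ?thesis using p1 by (simp add: prob_card[OF GD(1)] field_simps)
      qed
      have Bdense: "\<epsilon> \<le> prob G (\<lambda>x. \<forall>\<beta>\<in>\<B>. \<beta> x = 0)"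
      proof -
        have "prob G (\<lambda>x. \<forall>M\<in>\<M>. M x = 0) \<le> prob G (\<lambda>x. \<forall>\<beta>\<in>\<B>. \<beta> x = 0)"
          by (rule prob_mono) (use B(4) in blast)
        then show ?thesis using dense unfolding G_def by linarith
      qed
      have "\<exists>\<Q> :: ('i set \<times> (('i \<Rightarrow> 'v) \<Rightarrow> 'p mod_ring)) set. forms_on V S \<Q> \<and> card \<Q> \<le> c \<and>
        (\<forall>x\<in>tuples V S. (\<forall>q\<in>\<Q>. snd q x = 0) \<longrightarrow>
          \<sigma> \<le> prob (tuples V (K - S)) (\<lambda>a. \<forall>\<beta>\<in>\<B>. \<beta> (x + a) = 0))" if S: "S \<in> Pow K - {K}" for S
      proof -
        have sub: "S \<subseteq> K" and fin: "finite S" and cS: "card S < k"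
          using S K psubset_card_mono[of K S] finite_subset[of S K] by auto
        have "2 ^ card S * (2 * \<eta> / \<epsilon>) \<le> 2 ^ k * (2 * \<eta> / \<epsilon>)"
          using cS \<eta>(1) \<epsilon> by (intro mult_right_mono power_increasing) auto
        also have "\<dots> < (1 / ?p) ^ (2 ^ k * c)" by (rule \<eta>b)
        also have "\<dots> \<le> (1 / ?p) ^ (2 ^ card S * c)"
          using cS p1 by (intro power_decreasing mult_right_mono power_increasing) auto
        finally have \<eta>S: "2 ^ card S * (2 * \<eta> / \<epsilon>) < (1 / ?p) ^ (2 ^ card S * c)" .
        have "\<sigma> \<le> \<eta> ^ (2 ^ k)" by (rule \<sigma>(2))
        also have "\<dots> \<le> \<eta> ^ (2 ^ card S)"
          using cS \<eta> by (intro power_decreasing power_increasing) auto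
        finally have \<sigma>S: "\<sigma> \<le> \<eta> ^ (2 ^ card S)" .
        obtain \<Q> :: "('i set \<times> (('i \<Rightarrow> 'v) \<Rightarrow> 'p mod_ring)) set" where Q: "forms_on V S \<Q>" "card \<Q> \<le> c"
          "\<forall>x\<in>tuples V S. (\<forall>q\<in>\<Q>. snd q x = 0) \<longrightarrow>
            \<eta> ^ (2 ^ card S) \<le> prob (tuples V (K - S)) (\<lambda>a. \<forall>\<beta>\<in>\<B>. \<beta> (x + a) = 0)"
        proof (rule exE[OF popular_fibres[OF V K(1) sub _ B(1) \<epsilon> Bdense[unfolded G_def] _ \<eta>(1) \<eta>S]])
          show "\<beta> \<in> \<B> \<Longrightarrow> multadd V K \<beta>" for \<beta> using B(3) by blast
          fix \<N> :: "(('i \<Rightarrow> 'v) \<Rightarrow> 'p mod_ring) set"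
          assume N: "finite \<N>" "\<forall>M\<in>\<N>. multadd V S M" "\<epsilon> / 2 \<le> prob (tuples V S) (\<lambda>x. \<forall>M\<in>\<N>. M x = 0)"
          show "\<exists>\<Q> :: ('i set \<times> (('i \<Rightarrow> 'v) \<Rightarrow> 'p mod_ring)) set. forms_on V S \<Q> \<and> card \<Q> \<le> c \<and>
            (\<forall>x\<in>tuples V S. (\<forall>q\<in>\<Q>. snd q x = 0) \<longrightarrow> (\<forall>M\<in>\<N>. M x = 0))"
            using C[OF cS, unfolded R_def, rule_format, OF V fin refl N(1) N(2)[rule_format] N(3)]
              order.trans[OF _ c[OF cS]] by blast
        qed blast
        then show ?thesis using order.trans[OF \<sigma>S] by blast
      qed
      then have "\<forall>S\<in>Pow K - {K}. \<exists>\<Q> :: ('i set \<times> (('i \<Rightarrow> 'v) \<Rightarrow> 'p mod_ring)) set. forms_on V S \<Q> \<and> card \<Q> \<le> c \<and>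
        (\<forall>x\<in>tuples V S. (\<forall>q\<in>\<Q>. snd q x = 0) \<longrightarrow>
          \<sigma> \<le> prob (tuples V (K - S)) (\<lambda>a. \<forall>\<beta>\<in>\<B>. \<beta> (x + a) = 0))" ..
      from bchoice[OF this] obtain \<Q>S :: "'i set \<Rightarrow> ('i set \<times> (('i \<Rightarrow> 'v) \<Rightarrow> 'p mod_ring)) set" where
        QS': "\<forall>S\<in>Pow K - {K}. forms_on V S (\<Q>S S) \<and> card (\<Q>S S) \<le> c \<and>
          (\<forall>x\<in>tuples V S. (\<forall>q\<in>\<Q>S S. snd q x = 0) \<longrightarrow>
            \<sigma> \<le> prob (tuples V (K - S)) (\<lambda>a. \<forall>\<beta>\<in>\<B>. \<beta> (x + a) = 0))" ..
      have QS: "forms_on V S (\<Q>S S)" "card (\<Q>S S) \<le> c" "\<And>x. x \<in> tuples V S \<Longrightarrow> (\<forall>q\<in>\<Q>S S. snd q x = 0) \<Longrightarrow>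
            \<sigma> \<le> prob (tuples V (K - S)) (\<lambda>a. \<forall>\<beta>\<in>\<B>. \<beta> (x + a) = 0)"
        if "S \<in> Pow K - {K}" for S using QS' that by blast+
      \<comment> \<open>For \<open>S = K\<close> no free slot is left and the notion of a popular
        fibre is void; there the forms \<open>\<B>\<close> themselves are imposed.\<close>
      define \<Q> where "\<Q> = (\<Union>S\<in>Pow K - {K}. \<Q>S S) \<union> Pair K ` \<B>"
      have "forms_on V K \<Q>"
        unfolding forms_on_def
      proof (intro conjI ballI)
        show "finite \<Q>" unfolding \<Q>_def using QS(1) K(1) B(1) unfolding forms_on_def by (intro finite_UnI finite_UN_I finite_imageI) blast+
        fix q assume "q \<in> \<Q>"
        then consider S where "S \<in> Pow K - {K}" "q \<in> \<Q>S S" | \<beta> where "\<beta> \<in> \<B>" "q = (K, \<beta>)"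
          unfolding \<Q>_def by blast
        then have "fst q \<subseteq> K \<and> fst q \<noteq> {} \<and> multadd V (fst q) (snd q)"
        proof cases
          case 1
          then show ?thesis using QS(1)[OF 1(1)] 1 unfolding forms_on_def by blast
        next
          case 2
          then show ?thesis using B(3) Kne by auto
        qed
        then show "fst q \<subseteq> K" "fst q \<noteq> {}" "multadd V (fst q) (snd q)" by blast+
      qed
      moreover have "card \<Q> \<le> 2 ^ k * c + t"
      proof -
        have "card \<Q> \<le> card (\<Union>S\<in>Pow K - {K}. \<Q>S S) + card (Pair K ` \<B>)"
          unfolding \<Q>_def by (rule card_Un_le)
        also have "card (\<Union>S\<in>Pow K - {K}. \<Q>S S) \<le> (\<Sum>S\<in>Pow K - {K}. card (\<Q>S S))"
          by (rule card_UN_le) (use K in blast)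
        also have "\<dots> \<le> (\<Sum>S\<in>Pow K - {K}. c)" by (rule sum_mono) (rule QS(2))
        also have "\<dots> \<le> 2 ^ k * c"
          using K by (simp add: card_Diff_singleton card_Pow)
        also have "card (Pair K ` \<B>) \<le> t" using card_image_le[OF B(1), of "Pair K"] B(2) by linarith
        finally show ?thesis by simp
      qed
      moreover have "\<forall>M\<in>\<M>. M x = 0" if x: "x \<in> tuples V K" and xQ: "\<forall>q\<in>\<Q>. snd q x = 0" for x
      proof (rule ccontr)
        assume "\<not> ?thesis"
        then obtain M0 where M0: "M0 \<in> \<M>" "M0 x \<noteq> 0" by blast
        have xV: "x i \<in> V" for i by (rule tuples_in[OF VD(2) x])
        have xB: "\<beta> x = 0" if "\<beta> \<in> \<B>" for \<beta> using xQ that unfolding \<Q>_def by force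
        have resG: "res J x \<in> G" if "J \<subseteq> K" for J
          unfolding G_def by (rule res_in_tuples_supset[OF VD(2) x that])
        let ?E = "\<lambda>J a. \<forall>\<beta>\<in>\<B>. \<beta> (glue J x a) = 0"
        \<comment> \<open>For proper \<open>J\<close> the forms in \<open>\<Q>S J\<close> see only
          slots in \<open>J\<close>, so they vanish at \<open>res J x\<close> and its fibre is
          popular. The entries of \<open>a\<close> in \<open>J\<close> are overwritten by
          \<open>x\<close>, so averaging over them changes nothing.\<close>
        have E: "\<sigma> \<le> prob G (?E J)" if J: "J \<in> Pow K" for J
        proof (cases "J = K")
          case True
          have "\<beta> (glue J x a) = 0" if \<beta>: "\<beta> \<in> \<B>" for \<beta> a
          proof -
            have "\<beta> (glue J x a) = \<beta> x"
              by (rule multadd_cong[OF B(3)[rule_format, OF \<beta>]]) (simp add: glue_def True)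
            then show ?thesis using xB[OF \<beta>] by simp
          qed
          then have "prob G (?E J) = 1" by (intro prob_True[OF GD(1,3)]) blast
          then show ?thesis using \<sigma>(4) by simp
        next
          case False
          then have J': "J \<in> Pow K - {K}" "J \<subseteq> K" using J by auto
          have rJ: "res J x \<in> tuples V J" by (rule res_in_tuples[OF VD(2) x])
          have "snd q (res J x) = 0" if q: "q \<in> \<Q>S J" for q
          proof -
            have qf: "fst q \<subseteq> J" "multadd V (fst q) (snd q)"
              using QS(1)[OF J'(1)] q unfolding forms_on_def by blast+
            have "snd q (res J x) = snd q x"
              by (rule multadd_cong[OF qf(2)]) (use qf(1) in \<open>auto simp: res_def\<close>)
            also have "\<dots> = 0" using xQ q J'(1) unfolding \<Q>_def by blast
            finally show ?thesis .
          qed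
          then have pr: "\<sigma> \<le> prob (tuples V (K - J)) (\<lambda>a. \<forall>\<beta>\<in>\<B>. \<beta> (res J x + a) = 0)"
            using QS(3)[OF J'(1)] rJ by blast
          have finJ: "finite J" using J' K(1) finite_subset by blast
          note TJ = add_subgroupD[OF add_subgroup_tuples[OF V finJ]]
          have "prob G (?E J) = avg (tuples V J) (\<lambda>a1. prob (tuples V (K - J)) (\<lambda>a2. ?E J (a1 + a2)))"
            unfolding prob_def G_def avg_tuples_split[OF V J'(2)] ..
          also have "\<dots> = avg (tuples V J) (\<lambda>a1. prob (tuples V (K - J)) (\<lambda>a. \<forall>\<beta>\<in>\<B>. \<beta> (res J x + a) = 0))"
          proof (intro avg_cong prob_cong)
            fix a1 a2 assume a: "a1 \<in> tuples V J" "a2 \<in> tuples V (K - J)"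
            have "glue J x (a1 + a2) = res J x + a2"
              using a by (auto simp: glue_def res_def fun_eq_iff tuples_def)
            then show "?E J (a1 + a2) = (\<forall>\<beta>\<in>\<B>. \<beta> (res J x + a2) = 0)" by simp
          qed
          also have "\<dots> = prob (tuples V (K - J)) (\<lambda>a. \<forall>\<beta>\<in>\<B>. \<beta> (res J x + a) = 0)"
            by (rule avg_const[OF TJ(1,3)])
          finally show ?thesis using pr by simp
        qed
        have "\<sigma> ^ card (Pow K) \<le> prob G (\<lambda>a. \<forall>J\<in>Pow K. ?E J a)"
          unfolding G_def
        proof (rule prob_Ball_ge[OF V K(1)])
          fix J assume J: "J \<in> Pow K"
          show "\<sigma> \<le> prob (tuples V K) (?E J)" using E[OF J] unfolding G_def .
          show "slice_subgroup V K (?E J)"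
          proof (rule slice_subgroup_Ball)
            fix \<beta> assume \<beta>: "\<beta> \<in> \<B>"
            have "multadd V (K \<inter> - J) (\<lambda>a. \<beta> (glue J x a))"
              unfolding glue_swap[of J x] by (rule multadd_freeze[OF B(3)[rule_format, OF \<beta>] xV])
            then show "slice_subgroup V K (\<lambda>a. \<beta> (glue J x a) = 0)"
              by (rule slice_subgroup_multadd[OF V]) blast
          qed
        qed (use K(1) \<sigma>(1) in auto)
        \<comment> \<open>On this event all vertices \<open>a + res J x\<close> are zeros of
          \<open>\<B>\<close>. They cannot all be zeros of \<open>M0\<close>, since then
          \<open>M0 x\<close> would be 0; so some vertex is a false zero.\<close>
        also have "\<dots> \<le> prob G (\<lambda>a. \<exists>J\<in>Pow K. bad (a + res J x))"
        proof (rule prob_mono)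
          fix a assume a: "a \<in> G" "\<forall>J\<in>Pow K. ?E J a"
          have zero: "\<beta> (a + res J x) = 0" if "J \<subseteq> K" "\<beta> \<in> \<B>" for J \<beta>
            using multadd_cube[OF V K(1) B(3)[rule_format, OF that(2)] order_refl x a(1)[unfolded G_def]] a(2) that
            by blast
          have "\<exists>J. J \<subseteq> K \<and> M0 (a + res J x) \<noteq> 0"
            using multadd_zero_of_cube[OF V K(1) M(2)[rule_format, OF M0(1)] order_refl x a(1)[unfolded G_def]] M0(2)
            by blast
          then show "\<exists>J\<in>Pow K. bad (a + res J x)" unfolding bad_def using zero M0(1) by blast
        qed
        also have "\<dots> \<le> (\<Sum>J\<in>Pow K. prob G (\<lambda>a. bad (a + res J x)))"
          by (rule prob_union_bound) (use K in blast)
        also have "\<dots> = (\<Sum>J\<in>Pow K. prob G bad)"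
          by (intro sum.cong refl prob_translation[OF G]) (use resG in blast)
        also have "\<dots> = 2 ^ k * prob G bad" using K by (simp add: card_Pow)
        also have "\<dots> \<le> 2 ^ k * (1 / ?p) ^ t" using bad by (intro mult_left_mono) auto
        also have "\<dots> < \<sigma> ^ (2 ^ k)" using t by (simp add: field_simps)
        finally show False using K by (simp add: card_Pow)
      qed
      ultimately show "\<exists>\<Q> :: ('i set \<times> (('i \<Rightarrow> 'v) \<Rightarrow> 'p mod_ring)) set. forms_on V K \<Q> \<and> card \<Q> \<le> 2 ^ k * c + t \<and>
          (\<forall>x\<in>tuples V K. (\<forall>q\<in>\<Q>. snd q x = 0) \<longrightarrow> (\<forall>M\<in>\<M>. M x = 0))"
        by (intro exI[of _ \<Q>] conjI ballI impI) blast+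
    qed
  qed
qed

section \<open>Degree and bias via finite differences\<close>

definition diffop :: "'v::ab_group_add \<Rightarrow> ('v \<Rightarrow> 'f::comm_ring_1) \<Rightarrow> 'v \<Rightarrow> 'f" where
  "diffop h g = (\<lambda>x. g (x + h) - g x)"

text \<open>Degree by differences rather than coefficients: it makes sense on any subgroup, passes
  to smaller subgroups and is preserved by affine substitutions.\<close>

primrec degle :: "'v::ab_group_add set \<Rightarrow> nat \<Rightarrow> ('v \<Rightarrow> 'f::comm_ring_1) \<Rightarrow> bool" where
  "degle V 0 g \<longleftrightarrow> (\<forall>x\<in>V. g x = g 0)"
| "degle V (Suc m) g \<longleftrightarrow> (\<forall>h\<in>V. degle V m (diffop h g))"

lemma degle_0D: "degle V 0 g \<Longrightarrow> x \<in> V \<Longrightarrow> g x = g 0"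
  unfolding degle.simps by blast

lemma degle_0I: "(\<And>x. x \<in> V \<Longrightarrow> g x = c) \<Longrightarrow> 0 \<in> V \<Longrightarrow> degle V 0 g"
  by simp

lemma degle_cong:
  assumes "add_subgroup V" "degle V m g" "\<And>x. x \<in> V \<Longrightarrow> g x = g' x"
  shows "degle V m g'"
  using assms(2,3)
proof (induction m arbitrary: g g')
  case 0
  show ?case
  proof (rule degle_0I[where c="g 0"])
    show "g' x = g 0" if "x \<in> V" for x
      unfolding 0(2)[OF that, symmetric] by (rule degle_0D[OF 0(1) that])
  qed (rule add_subgroupD(2)[OF assms(1)])
next
  case (Suc m)
  show ?case unfolding degle.simps
  proof
    fix h assume h: "h \<in> V"
    show "degle V m (diffop h g')"
    proof (rule Suc.IH)
      show "degle V m (diffop h g)" using Suc.prems(1) h by simp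
      show "diffop h g x = diffop h g' x" if "x \<in> V" for x
        using Suc.prems(2) that add_subgroupD(6)[OF assms(1) that h] by (simp add: diffop_def)
    qed
  qed
qed

lemma diffop_commute: "diffop h (diffop k g) = diffop k (diffop h g)"
  by (simp add: diffop_def fun_eq_iff ac_simps)

lemma diffop_shift: "diffop h (\<lambda>x. g (x + a)) = (\<lambda>x. diffop h g (x + a))"
  by (simp add: diffop_def ac_simps)

lemma degle_const: "degle V m (\<lambda>_. c)"
proof (induction m arbitrary: c)
  case (Suc m)
  have "diffop h (\<lambda>_. c) = (\<lambda>_. 0)" for h :: 'a by (simp add: diffop_def)
  then show ?case using Suc.IH by simp
qed simp

lemma degle_Suc: "add_subgroup V \<Longrightarrow> degle V m g \<Longrightarrow> degle V (Suc m) g"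
proof (induction m arbitrary: g)
  case 0
  have "degle V 0 (diffop h g)" if "h \<in> V" for h
  proof (rule degle_0I[where c=0])
    fix x assume x: "x \<in> V"
    show "diffop h g x = 0"
      unfolding diffop_def degle_0D[OF 0(2) add_subgroupD(6)[OF 0(1) x that]] degle_0D[OF 0(2) x] by simp
  qed (rule add_subgroupD(2)[OF 0(1)])
  then show ?case by simp
next
  case (Suc m)
  then show ?case by (metis degle.simps(2))
qed

lemma degle_mono:
  assumes V: "add_subgroup V" and "m \<le> m'" "degle V m g"
  shows "degle V m' g"
  using assms(2,3) by (induction m' rule: dec_induct) (auto intro: degle_Suc[OF V] simp del: degle.simps)

lemma degle_shift:
  assumes "add_subgroup V" "degle V m g" "a \<in> V"
  shows "degle V m (\<lambda>x. g (x + a))"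
  using assms(2)
proof (induction m arbitrary: g)
  case 0
  show ?case
    by (rule degle_0I[where c="g 0"])
      (use degle_0D[OF 0 add_subgroupD(6)[OF assms(1) _ assms(3)]] add_subgroupD(2)[OF assms(1)] in blast)+
next
  case (Suc m)
  then show ?case by (simp add: diffop_shift)
qed

lemma degle_add: "degle V m f \<Longrightarrow> degle V m g \<Longrightarrow> degle V m (\<lambda>x. f x + g x)"
proof (induction m arbitrary: f g)
  case 0
  show ?case
    unfolding degle.simps
  proof
    fix x assume x: "x \<in> V"
    show "f x + g x = f 0 + g 0" unfolding degle_0D[OF 0(1) x] degle_0D[OF 0(2) x] ..
  qed
next
  case (Suc m)
  have "diffop h (\<lambda>x. f x + g x) = (\<lambda>x. diffop h f x + diffop h g x)" for h
    by (simp add: diffop_def fun_eq_iff)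
  then show ?case using Suc by simp
qed

lemma degle_sum: "(\<And>j. j \<in> J \<Longrightarrow> degle V m (f j)) \<Longrightarrow> degle V m (\<lambda>x. \<Sum>j\<in>J. f j x)"
  by (induction J rule: infinite_finite_induct) (auto intro!: degle_add degle_const simp del: degle.simps)

text \<open>Leibniz rule \<open>diffop h f x * g (x + h) + f x * diffop h g x\<close>, where the
  shift is harmless by \<open>degle_shift\<close>. A factor of degree 0 is treated apart: its
  difference vanishes on \<open>V\<close>, but there is no smaller degree to record this.\<close>

lemma degle_mult:
  assumes V: "add_subgroup V"
  shows "degle V a f \<Longrightarrow> degle V b g \<Longrightarrow> degle V (a + b) (\<lambda>x. f x * g x)"
proof (induction "a + b" arbitrary: a b f g)
  case 0
  then have ab: "a = 0" "b = 0" by auto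
  have f: "degle V 0 f" and g: "degle V 0 g" using "0.prems" unfolding ab .
  show ?case
    unfolding ab add_0 degle.simps
  proof
    fix x assume x: "x \<in> V"
    show "f x * g x = f 0 * g 0" unfolding degle_0D[OF f x] degle_0D[OF g x] ..
  qed
next
  case (Suc n)
  have "degle V n (diffop h (\<lambda>x. f x * g x))" if h: "h \<in> V" for h
  proof -
    have eq: "diffop h (\<lambda>x. f x * g x) = (\<lambda>x. diffop h f x * g (x + h) + f x * diffop h g x)"
      by (simp add: diffop_def fun_eq_iff algebra_simps)
    have 1: "degle V n (\<lambda>x. diffop h f x * g (x + h))"
    proof (cases a)
      case 0
      have f: "degle V 0 f" using Suc.prems(1) unfolding 0 .
      have "diffop h f x = 0" if "x \<in> V" for x
        unfolding diffop_def degle_0D[OF f add_subgroupD(6)[OF V that h]] degle_0D[OF f that] by simp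
      then show ?thesis by (intro degle_cong[OF V degle_const[of V n 0]]) simp
    next
      case (Suc a')
      have "degle V (a' + b) (\<lambda>x. diffop h f x * g (x + h))"
        using Suc.hyps(1)[of a' b "diffop h f" "\<lambda>x. g (x + h)"] Suc.hyps(2) Suc.prems h degle_shift[OF V Suc.prems(2) h]
        unfolding Suc by simp
      then show ?thesis using Suc.hyps(2) unfolding Suc by simp
    qed
    have 2: "degle V n (\<lambda>x. f x * diffop h g x)"
    proof (cases b)
      case 0
      have g: "degle V 0 g" using Suc.prems(2) unfolding 0 .
      have "diffop h g x = 0" if "x \<in> V" for x
        unfolding diffop_def degle_0D[OF g add_subgroupD(6)[OF V that h]] degle_0D[OF g that] by simp
      then show ?thesis by (intro degle_cong[OF V degle_const[of V n 0]]) simp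
    next
      case (Suc b')
      have "degle V (a + b') (\<lambda>x. f x * diffop h g x)"
        using Suc.hyps(1)[of a b' f "diffop h g"] Suc.hyps(2) Suc.prems h unfolding Suc by simp
      then show ?thesis using Suc.hyps(2) unfolding Suc by simp
    qed
    show ?thesis unfolding eq by (rule degle_add[OF 1 2])
  qed
  then show ?case unfolding Suc.hyps(2)[symmetric] by simp
qed

lemma degle_prod:
  assumes V: "add_subgroup V"
  shows "finite J \<Longrightarrow> (\<And>j. j \<in> J \<Longrightarrow> degle V (m j) (f j)) \<Longrightarrow> degle V (\<Sum>j\<in>J. m j) (\<lambda>x. \<Prod>j\<in>J. f j x)"
proof (induction J rule: finite_induct)
  case (insert j J)
  then show ?case using degle_mult[OF V, of "m j" "f j" "\<Sum>j\<in>J. m j" "\<lambda>x. \<Prod>j\<in>J. f j x"] by simp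
qed simp

lemma degle_power:
  assumes V: "add_subgroup V" "degle V m f"
  shows "degle V (e * m) (\<lambda>x. f x ^ e)"
  using degle_prod[OF V(1), of "{..<e}" "\<lambda>_. m" "\<lambda>_. f"] V(2) by simp

lemma degle_additive:
  assumes V: "add_subgroup V" and add: "\<And>x y. x \<in> V \<Longrightarrow> y \<in> V \<Longrightarrow> f (x + y) = f x + f y"
  shows "degle V 1 f"
proof -
  have "degle V 0 (diffop h f)" if h: "h \<in> V" for h
  proof (rule degle_0I[where c="f h"])
    show "diffop h f x = f h" if "x \<in> V" for x unfolding diffop_def add[OF that h] by simp
  qed (rule add_subgroupD(2)[OF V])
  then show ?thesis by (simp add: One_nat_def)
qed

lemma degle_affine:
  assumes V: "add_subgroup V" and W: "add_subgroup W"
    and \<phi>: "\<And>x. x \<in> W \<Longrightarrow> \<phi> x \<in> V" "\<And>x y. x \<in> W \<Longrightarrow> y \<in> W \<Longrightarrow> \<phi> (x + y) = \<phi> x + \<phi> y" and u: "u \<in> V"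
  shows "degle V m g \<Longrightarrow> degle W m (\<lambda>x. g (u + \<phi> x))"
proof (induction m arbitrary: g)
  case 0
  show ?case
    by (rule degle_0I[where c="g 0"])
      (rule degle_0D[OF 0 add_subgroupD(6)[OF V u \<phi>(1)]], assumption, rule add_subgroupD(2)[OF W])
next
  case (Suc m)
  have "degle W m (diffop h (\<lambda>x. g (u + \<phi> x)))" if h: "h \<in> W" for h
  proof (rule degle_cong[OF W])
    show "degle W m (\<lambda>x. diffop (\<phi> h) g (u + \<phi> x))"
      using Suc.prems \<phi>(1)[OF h] by (intro Suc.IH) simp
    show "diffop (\<phi> h) g (u + \<phi> x) = diffop h (\<lambda>x. g (u + \<phi> x)) x" if "x \<in> W" for x
      by (simp add: diffop_def \<phi>(2)[OF that h] add.assoc)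
  qed
  then show ?case by simp
qed

lemma degle_fold:
  "set hs \<subseteq> V \<Longrightarrow> degle V (length hs + m) g \<Longrightarrow> degle V m (fold diffop hs g)"
  by (induction hs arbitrary: g) auto

lemma degle_iff_fold:
  "degle V m g \<longleftrightarrow> (\<forall>hs. set hs \<subseteq> V \<longrightarrow> length hs = m \<longrightarrow> (\<forall>x\<in>V. fold diffop hs g x = fold diffop hs g 0))"
proof (induction m arbitrary: g)
  case (Suc m)
  show ?case
  proof
    assume l: "degle V (Suc m) g"
    show "\<forall>hs. set hs \<subseteq> V \<longrightarrow> length hs = Suc m \<longrightarrow> (\<forall>x\<in>V. fold diffop hs g x = fold diffop hs g 0)"
    proof (intro allI impI ballI)
      fix hs x assume hs: "set hs \<subseteq> V" "length hs = Suc m" "x \<in> V"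
      show "fold diffop hs g x = fold diffop hs g 0"
        using degle_fold[of hs V 0 g] hs l by simp
    qed
  next
    assume r: "\<forall>hs. set hs \<subseteq> V \<longrightarrow> length hs = Suc m \<longrightarrow> (\<forall>x\<in>V. fold diffop hs g x = fold diffop hs g 0)"
    have "fold diffop hs (diffop h g) x = fold diffop hs (diffop h g) 0"
      if "h \<in> V" "set hs \<subseteq> V" "length hs = m" "x \<in> V" for h hs x
      using r[rule_format, of "h # hs" x] that by simp
    then show "degle V (Suc m) g" unfolding degle.simps Suc.IH by blast
  qed
qed simp

lemma fold_diffop_commute: "fold diffop hs (diffop h g) = diffop h (fold diffop hs g)"
  by (induction hs arbitrary: g) (simp_all add: diffop_commute[of _ h])

section \<open>Polarisation\<close>

text \<open>The polarisation of \<open>g\<close>, obtained as an \<open>m\<close>-fold difference.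
  If \<open>g\<close> has degree at most \<open>m\<close> on \<open>V\<close>, every base point in
  \<open>V\<close> gives the same value as 0.\<close>

definition poly_form :: "nat \<Rightarrow> ('v::ab_group_add \<Rightarrow> 'f::comm_ring_1) \<Rightarrow> (nat \<Rightarrow> 'v) \<Rightarrow> 'f" where
  "poly_form m g x = fold diffop (map x [0..<m]) g 0"

text \<open>Differences commute, so the one in slot \<open>i\<close> may be taken last. The
  differences in the other \<open>m - 1\<close> directions leave a function \<open>G\<close> of
  degree at most 1, and \<open>G v - G 0\<close> is additive in \<open>v\<close>.\<close>

lemma multadd_poly_form:
  assumes V: "add_subgroup V" and g: "degle V m g"
  shows "multadd V {..<m} (poly_form m g)"
  unfolding multadd_def
proof (intro conjI allI impI ballI)
  fix x y :: "nat \<Rightarrow> 'a" assume "\<forall>i\<in>{..<m}. x i = y i"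
  then have "map x [0..<m] = map y [0..<m]" by auto
  then show "poly_form m g x = poly_form m g y" by (simp only: poly_form_def)
next
  fix x :: "nat \<Rightarrow> 'a" and i u w
  assume h: "\<forall>i\<in>{..<m}. x i \<in> V" "i \<in> {..<m}" and u: "u \<in> V" and w: "w \<in> V"
  let ?as = "map x [0..<i]" and ?bs = "map x [Suc i..<m]"
  define G where "G = fold diffop (?as @ ?bs) g"
  have m: "[0..<m] = [0..<i] @ i # [Suc i..<m]"
    using h(2) upt_add_eq_append[of 0 i "m - i"] upt_conv_Cons[of i m] by simp
  have pf: "poly_form m g (x(i := v)) = G v - G 0" for v
  proof -
    have "map (x(i := v)) [0..<m] = ?as @ v # ?bs" unfolding m by simp
    then have "poly_form m g (x(i := v)) = fold diffop ?bs (diffop v (fold diffop ?as g)) 0"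
      by (simp only: poly_form_def fold_append fold_Cons o_apply)
    also have "\<dots> = diffop v G 0" unfolding fold_diffop_commute G_def by simp
    finally show ?thesis by (simp add: diffop_def)
  qed
  have "degle V 1 G" unfolding G_def
  proof (rule degle_fold)
    show "set (?as @ ?bs) \<subseteq> V" using h by auto
    have "length (?as @ ?bs) + 1 = m" using h(2) by simp
    then show "degle V (length (?as @ ?bs) + 1) g" using g by (simp only:)
  qed
  then have "degle V 0 (diffop u G)" using u by (simp add: One_nat_def)
  then have "diffop u G w = diffop u G 0" using w by simp
  then have "G (u + w) - G w = G u - G 0" by (simp add: diffop_def add.commute)
  then show "poly_form m g (x(i := u + w)) = poly_form m g (x(i := u)) + poly_form m g (x(i := w))"
    unfolding pf by (simp add: algebra_simps)
qed

section \<open>Bias and repeated Cauchy--Schwarz\<close>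

lemma avg_square_le: "(avg G F)\<^sup>2 \<le> avg G (\<lambda>x. (F x)\<^sup>2)"
proof (cases "finite G \<and> G \<noteq> {}")
  case True
  let ?m = "avg G F"
  have "0 \<le> avg G (\<lambda>x. (F x - ?m)\<^sup>2)" unfolding avg_def by (simp add: sum_nonneg)
  also have "\<dots> = avg G (\<lambda>x. (F x)\<^sup>2 - 2 * ?m * F x + ?m\<^sup>2)"
    by (intro avg_cong) (simp add: power2_eq_square algebra_simps)
  also have "\<dots> = avg G (\<lambda>x. (F x)\<^sup>2) - 2 * ?m * ?m + ?m\<^sup>2"
    using True by (simp add: avg_add avg_diff avg_cmult avg_const)
  finally show ?thesis by (simp add: power2_eq_square)
qed (auto simp: avg_def)

lemma avg_power_le: "(avg G F) ^ (2 ^ m) \<le> avg G (\<lambda>x. F x ^ (2 ^ m))" if "\<And>x. x \<in> G \<Longrightarrow> 0 \<le> F x"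
  using that
proof (induction m arbitrary: F)
  case (Suc m)
  have "0 \<le> avg G F" using Suc.prems unfolding avg_def by (simp add: sum_nonneg)
  then have "avg G F ^ 2 ^ Suc m \<le> avg G (\<lambda>x. (F x)\<^sup>2) ^ 2 ^ m"
    unfolding power_Suc power_mult by (intro power_mono avg_square_le) simp
  also have "\<dots> \<le> avg G (\<lambda>x. ((F x)\<^sup>2) ^ 2 ^ m)" by (rule Suc.IH) simp
  finally show ?case by (simp add: power_mult[symmetric])
qed simp

text \<open>Squared Euclidean distance of the distribution of \<open>g\<close> from the uniform one.
  For values in a finite abelian group, Parseval turns it, up to the factor \<open>CARD('f)\<close>,
  into the sum of the squared absolute values of the averages of \<open>g\<close> against nontrivial
  characters.\<close>

definition bias :: "'v set \<Rightarrow> ('v \<Rightarrow> 'f::finite) \<Rightarrow> real" where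
  "bias V g = (\<Sum>c\<in>UNIV. (prob V (\<lambda>x. g x = c) - 1 / CARD('f))\<^sup>2)"

lemma bias_nonneg: "0 \<le> bias V g"
  unfolding bias_def by (rule sum_nonneg) simp

lemma sum_prob_levels:
  fixes g :: "'v \<Rightarrow> 'f::finite"
  assumes "finite V" "V \<noteq> {}"
  shows "(\<Sum>c\<in>UNIV. prob V (\<lambda>x. g x = c)) = 1"
proof -
  have "(\<Sum>c\<in>UNIV. of_bool (g x = c)) = (1::real)" for x
    using sum.delta'[of UNIV "g x" "\<lambda>_. 1::real"] by (simp only: of_bool_def) simp
  then show ?thesis unfolding prob_def avg_sum[symmetric] by (simp only: avg_const[OF assms])
qed

text \<open>The squared level probabilities add up to the probability that \<open>g\<close> agrees
  at two independent points, and for random \<open>h\<close> the points \<open>x\<close> and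
  \<open>x + h\<close> are independent.\<close>

lemma bias_eq_avg_derivatives:
  fixes g :: "'v::ab_group_add \<Rightarrow> 'f::{comm_ring_1,finite}"
  assumes V: "add_subgroup V"
  shows "bias V g = avg V (\<lambda>h. prob V (\<lambda>x. diffop h g x = 0) - 1 / CARD('f))"
proof -
  note VD = add_subgroupD[OF V]
  let ?P = "\<lambda>c. prob V (\<lambda>x. g x = c)" and ?q = "1 / real CARD('f)"
  have "bias V g = (\<Sum>c\<in>UNIV. (?P c)\<^sup>2 - 2 * ?q * ?P c + ?q\<^sup>2)"
    unfolding bias_def by (intro sum.cong refl) (simp add: power2_eq_square algebra_simps)
  also have "\<dots> = (\<Sum>c\<in>UNIV. (?P c)\<^sup>2) - 2 * ?q * (\<Sum>c\<in>UNIV. ?P c) + real CARD('f) * ?q\<^sup>2"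
    by (simp only: sum.distrib sum_subtractf sum_distrib_left sum_constant)
  also have "\<dots> = (\<Sum>c\<in>UNIV. (?P c)\<^sup>2) - ?q"
    unfolding sum_prob_levels[OF VD(1,3)] by (simp add: power2_eq_square)
  also have "(\<Sum>c\<in>UNIV. (?P c)\<^sup>2) = avg V (\<lambda>h. prob V (\<lambda>x. diffop h g x = 0))"
  proof -
    have one: "(\<Sum>c\<in>UNIV. of_bool (g x = c) * of_bool (g y = c)) = (of_bool (g y = g x) :: real)" for x y
      using sum.delta'[of UNIV "g x" "\<lambda>c. of_bool (g y = c) :: real"]
      by (simp only: of_bool_def if_distrib[of "\<lambda>t. t * _"] mult_1 mult_zero_left) simp
    have "(\<Sum>c\<in>UNIV. (?P c)\<^sup>2) = (\<Sum>c\<in>UNIV. avg V (\<lambda>x. avg V (\<lambda>y. of_bool (g x = c) * of_bool (g y = c))))"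
    proof (rule sum.cong[OF refl])
      fix c
      have "(?P c)\<^sup>2 = ?P c * avg V (\<lambda>x. of_bool (g x = c))" by (simp add: power2_eq_square prob_def)
      also have "\<dots> = avg V (\<lambda>x. ?P c * of_bool (g x = c))" by (rule avg_cmult[symmetric])
      also have "\<dots> = avg V (\<lambda>x. of_bool (g x = c) * avg V (\<lambda>y. of_bool (g y = c)))"
        by (simp only: prob_def mult.commute)
      finally show "(?P c)\<^sup>2 = avg V (\<lambda>x. avg V (\<lambda>y. of_bool (g x = c) * of_bool (g y = c)))"
        by (simp only: avg_cmult)
    qed
    also have "\<dots> = avg V (\<lambda>x. avg V (\<lambda>y. of_bool (g y = g x)))"
      by (simp only: avg_sum[symmetric] one)
    also have "\<dots> = avg V (\<lambda>x. avg V (\<lambda>h. of_bool (diffop h g x = 0)))"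
    proof (rule avg_cong)
      fix x assume x: "x \<in> V"
      show "avg V (\<lambda>y. of_bool (g y = g x)) = avg V (\<lambda>h. of_bool (diffop h g x = 0))"
        using avg_translation[OF V x, of "\<lambda>y. of_bool (g y = g x)"] by (simp add: diffop_def add.commute)
    qed
    also have "\<dots> = avg V (\<lambda>h. prob V (\<lambda>x. diffop h g x = 0))" unfolding prob_def by (rule avg_swap)
    finally show ?thesis .
  qed
  finally show ?thesis by (simp add: avg_diff avg_const[OF VD(1,3)])
qed

text \<open>Cauchy--Schwarz over \<open>h\<close>; the deviation at level 0 that results is a single
  term of the bias of the derivative.\<close>

lemma bias_square_le:
  fixes g :: "'v::ab_group_add \<Rightarrow> 'f::{comm_ring_1,finite}"
  assumes V: "add_subgroup V"
  shows "(bias V g)\<^sup>2 \<le> avg V (\<lambda>h. bias V (diffop h g))"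
proof -
  have "(bias V g)\<^sup>2 \<le> avg V (\<lambda>h. (prob V (\<lambda>x. diffop h g x = 0) - 1 / CARD('f))\<^sup>2)"
    unfolding bias_eq_avg_derivatives[OF V] by (rule avg_square_le)
  also have "\<dots> \<le> avg V (\<lambda>h. bias V (diffop h g))"
  proof (rule avg_mono)
    fix h
    show "(prob V (\<lambda>x. diffop h g x = 0) - 1 / CARD('f))\<^sup>2 \<le> bias V (diffop h g)"
      unfolding bias_def
      using member_le_sum[of 0 "UNIV :: 'f set" "\<lambda>c. (prob V (\<lambda>x. diffop h g x = c) - 1 / CARD('f))\<^sup>2"] by simp
  qed
  finally show ?thesis .
qed

text \<open>Up to an additive constant, a non-constant \<open>g\<close> of degree 1 is a nonzero
  additive map, hence exactly equidistributed.\<close>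

lemma bias_degle_1:
  fixes g :: "'v::ab_group_add \<Rightarrow> 'p::prime_card mod_ring"
  assumes V: "add_subgroup V" and g: "degle V 1 g"
  shows "bias V g \<le> of_bool (\<forall>x\<in>V. g x = g 0)"
proof (cases "\<forall>x\<in>V. g x = g 0")
  case True
  note VD = add_subgroupD[OF V]
  have "bias V g \<le> avg V (\<lambda>h. 1)"
    unfolding bias_eq_avg_derivatives[OF V]
  proof (rule avg_mono)
    fix h
    have "0 \<le> 1 / real CARD('p mod_ring)" by simp
    then show "prob V (\<lambda>x. diffop h g x = 0) - 1 / CARD('p mod_ring) \<le> 1"
      using prob_le_1[of V "\<lambda>x. diffop h g x = 0"] by linarith
  qed
  then show ?thesis using True by (simp add: avg_const[OF VD(1,3)])
next
  case False
  then obtain w where w: "w \<in> V" "g w - g 0 \<noteq> 0" by auto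
  have add: "g (x + y) - g 0 = (g x - g 0) + (g y - g 0)" if "x \<in> V" "y \<in> V" for x y
  proof -
    have "degle V 0 (diffop y g)" using g that(2) by (simp add: One_nat_def)
    then have "diffop y g x = diffop y g 0" using that(1) by simp
    then show ?thesis by (simp add: diffop_def algebra_simps)
  qed
  have "prob V (\<lambda>x. g x = c) = 1 / CARD('p)" for c
    using prob_level_eq[OF V add w, of "c - g 0"] by simp
  then have "bias V g = 0" by (simp add: bias_def)
  then show ?thesis by simp
qed

text \<open>Each difference costs one squaring and lowers the degree by one; after \<open>m\<close>
  of them the degree is 1 and \<open>bias_degle_1\<close> decides.\<close>

lemma bias_le_prob_constant_derivative:
  fixes g :: "'v::ab_group_add \<Rightarrow> 'p::prime_card mod_ring"
  assumes V: "add_subgroup V"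
  shows "degle V (Suc m) g \<Longrightarrow> bias V g ^ (2 ^ m) \<le>
    prob {hs. set hs \<subseteq> V \<and> length hs = m} (\<lambda>hs. \<forall>x\<in>V. fold diffop hs g x = fold diffop hs g 0)"
proof (induction m arbitrary: g)
  case 0
  have "{hs. set hs \<subseteq> V \<and> length hs = 0} = {[]}" by auto
  then show ?case using bias_degle_1[OF V, of g] 0 by (simp add: prob_def avg_def One_nat_def)
next
  case (Suc m)
  let ?L = "\<lambda>m. {hs. set hs \<subseteq> V \<and> length hs = m}"
  let ?c = "\<lambda>g. of_bool (\<forall>x\<in>V. g x = g 0) :: real"
  have bij: "bij_betw (\<lambda>(h, hs). h # hs) (V \<times> ?L m) (?L (Suc m))"
    by (rule bij_betwI[where g="\<lambda>hs. (hd hs, tl hs)"]) (auto simp: length_Suc_conv)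
  have "bias V g ^ 2 ^ Suc m = ((bias V g)\<^sup>2) ^ 2 ^ m" by (simp add: power_mult)
  also have "\<dots> \<le> avg V (\<lambda>h. bias V (diffop h g)) ^ 2 ^ m"
    by (intro power_mono bias_square_le[OF V]) simp
  also have "\<dots> \<le> avg V (\<lambda>h. bias V (diffop h g) ^ 2 ^ m)"
    by (rule avg_power_le) (rule bias_nonneg)
  also have "\<dots> \<le> avg V (\<lambda>h. avg (?L m) (\<lambda>hs. ?c (fold diffop hs (diffop h g))))"
    unfolding prob_def[symmetric] using Suc.prems by (intro avg_mono Suc.IH) simp
  also have "\<dots> = avg (V \<times> ?L m) (\<lambda>z. ?c (fold diffop (case z of (h, hs) \<Rightarrow> h # hs) g))"
    unfolding avg_product by simp
  also have "\<dots> = prob (?L (Suc m)) (\<lambda>hs. \<forall>x\<in>V. fold diffop hs g x = fold diffop hs g 0)"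
    unfolding prob_def by (rule avg_bij[OF bij])
  finally show ?case .
qed

lemma bij_betw_tuples_lists:
  "bij_betw (\<lambda>x. map x [0..<m]) (tuples V {..<m}) {hs. set hs \<subseteq> V \<and> length hs = m}"
proof (rule bij_betwI[where g="\<lambda>hs i. if i < m then hs ! i else 0"])
  show "(\<lambda>hs i. if i < m then hs ! i else 0) \<in> {hs. set hs \<subseteq> V \<and> length hs = m} \<rightarrow> tuples V {..<m}"
    by (auto simp: tuples_def subset_iff)
qed (auto simp: tuples_def fun_eq_iff intro!: nth_equalityI)

text \<open>Constancy of the \<open>m\<close>-fold difference is one equation for each
  \<open>y\<close>, namely equality of its values at \<open>y\<close> and 0. As differences commute,
  this says that the polarisation of \<open>diffop y g\<close> vanishes.\<close>

lemma bias_le_prob_forms_vanish: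
  fixes g :: "'v::ab_group_add \<Rightarrow> 'p::prime_card mod_ring"
  assumes V: "add_subgroup V" and g: "degle V (Suc m) g"
  shows "bias V g ^ (2 ^ m) \<le>
    prob (tuples V {..<m}) (\<lambda>x. \<forall>M\<in>(\<lambda>y. poly_form m (diffop y g)) ` V. M x = 0)"
proof -
  have "bias V g ^ (2 ^ m) \<le>
    prob {hs. set hs \<subseteq> V \<and> length hs = m} (\<lambda>hs. \<forall>x\<in>V. fold diffop hs g x = fold diffop hs g 0)"
    by (rule bias_le_prob_constant_derivative[OF V g])
  also have "\<dots> = prob (tuples V {..<m})
      (\<lambda>x. \<forall>y\<in>V. fold diffop (map x [0..<m]) g y = fold diffop (map x [0..<m]) g 0)"
    by (rule prob_bij[OF bij_betw_tuples_lists, symmetric])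
  also have "\<dots> = prob (tuples V {..<m}) (\<lambda>x. \<forall>M\<in>(\<lambda>y. poly_form m (diffop y g)) ` V. M x = 0)"
  proof -
    have d0: "diffop y G 0 = 0 \<longleftrightarrow> G y = G 0" for y :: 'v and G :: "'v \<Rightarrow> 'p mod_ring"
      by (simp add: diffop_def)
    show ?thesis by (simp add: poly_form_def fold_diffop_commute d0)
  qed
  finally show ?thesis .
qed

section \<open>Chevalley--Warning and interpolation\<close>

lemma diffop_apply: "diffop h g x = g (x + h) - g x"
  by (simp add: diffop_def)

lemma degle_subset: "W \<subseteq> V \<Longrightarrow> degle V m g \<Longrightarrow> degle W m g"
  by (induction m arbitrary: g) auto

lemma degle_cmult:
  assumes V: "add_subgroup V" "degle V m g"
  shows "degle V m (\<lambda>x. c * g x)"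
  using degle_mult[OF V(1) degle_const[of V 0 c] V(2)] by simp

lemma fold_diffop_eq_0:
  assumes hs: "set hs \<subseteq> V" "m < length hs" and V: "add_subgroup V" and g: "degle V m g" and x: "x \<in> V"
  shows "fold diffop hs g x = 0"
proof -
  obtain h hs' where h: "hs = h # hs'" using hs(2) by (cases hs) auto
  have "degle V (length hs') g" by (rule degle_mono[OF V _ g]) (use hs(2) h in simp)
  then have 0: "degle V 0 (fold diffop hs' g)" using degle_fold[of hs' V 0 g] hs(1) h by simp
  have "h \<in> V" using hs(1) h by simp
  then show ?thesis
    unfolding h fold_Cons o_apply fold_diffop_commute diffop_apply
      degle_0D[OF 0 add_subgroupD(6)[OF V x \<open>h \<in> V\<close>]] degle_0D[OF 0 x] by simp
qed

lemma degleI_fold_eq_0: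
  assumes "0 \<in> V"
    and "\<And>hs x. set hs \<subseteq> V \<Longrightarrow> length hs = Suc m \<Longrightarrow> x \<in> V \<Longrightarrow> fold diffop hs g x = 0"
  shows "degle V m g"
  unfolding degle_iff_fold
proof (intro allI impI ballI)
  fix hs x assume h: "set hs \<subseteq> V" "length hs = m" "x \<in> V"
  have "fold diffop (x # hs) g 0 = 0" using h assms by (intro assms(2)) auto
  then show "fold diffop hs g x = fold diffop hs g 0"
    by (simp only: fold_Cons o_apply fold_diffop_commute) (simp add: diffop_def)
qed

text \<open>The difference of the diagonal is
  \<open>\<Phi> h (v + h) + diffop h (\<Phi> v) v\<close>. The first term has the degree of
  \<open>\<Phi> h\<close>, and the second is again a diagonal, of a family of degree one
  less.\<close>

lemma degle_diagonal:
  assumes V: "add_subgroup V"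
    and "\<And>w. w \<in> V \<Longrightarrow> degle V n (\<Phi> w)"
    and "\<And>w w' v. w \<in> V \<Longrightarrow> w' \<in> V \<Longrightarrow> v \<in> V \<Longrightarrow> \<Phi> (w + w') v = \<Phi> w v + \<Phi> w' v"
  shows "degle V (Suc n) (\<lambda>v. \<Phi> v v)"
  using assms(2,3)
proof (induction n arbitrary: \<Phi>)
  case 0
  show ?case
    unfolding degle.simps(2)
  proof
    fix h assume h: "h \<in> V"
    note VD = add_subgroupD[OF V]
    show "degle V 0 (diffop h (\<lambda>v. \<Phi> v v))"
    proof (rule degle_0I[where c="\<Phi> h 0"])
      fix v assume v: "v \<in> V"
      have "\<Phi> (v + h) (v + h) = \<Phi> v (v + h) + \<Phi> h (v + h)"
        by (rule 0(2)[OF v h VD(6)[OF v h]])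
      moreover have "\<Phi> v (v + h) = \<Phi> v v"
        unfolding degle_0D[OF 0(1)[OF v] VD(6)[OF v h]] degle_0D[OF 0(1)[OF v] v] ..
      moreover have "\<Phi> h (v + h) = \<Phi> h 0" by (rule degle_0D[OF 0(1)[OF h] VD(6)[OF v h]])
      ultimately show "diffop h (\<lambda>v. \<Phi> v v) v = \<Phi> h 0" by (simp add: diffop_def)
    qed (rule VD(2))
  qed
next
  case (Suc n)
  note VD = add_subgroupD[OF V]
  have "degle V (Suc n) (diffop h (\<lambda>v. \<Phi> v v))" if h: "h \<in> V" for h
  proof -
    have 1: "degle V (Suc n) (\<lambda>v. \<Phi> h (v + h))" by (rule degle_shift[OF V Suc.prems(1)[OF h] h])
    have 2: "degle V (Suc n) (\<lambda>v. diffop h (\<Phi> v) v)"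
    proof (rule Suc.IH[of "\<lambda>w. diffop h (\<Phi> w)"])
      show "degle V n (diffop h (\<Phi> w))" if "w \<in> V" for w using Suc.prems(1)[OF that] h by simp
      show "diffop h (\<Phi> (w + w')) v = diffop h (\<Phi> w) v + diffop h (\<Phi> w') v"
        if "w \<in> V" "w' \<in> V" "v \<in> V" for w w' v
        unfolding diffop_def Suc.prems(2)[OF that] Suc.prems(2)[OF that(1,2) VD(6)[OF that(3) h]] by simp
    qed
    have "\<Phi> h (v + h) + diffop h (\<Phi> v) v = diffop h (\<lambda>v. \<Phi> v v) v" if v: "v \<in> V" for v
      unfolding diffop_def Suc.prems(2)[OF v h VD(6)[OF v h]] by simp
    from degle_cong[OF V degle_add[OF 1 2] this] show ?thesis .
  qed
  then show ?case unfolding degle.simps(2)[of V "Suc n"] by blast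
qed

text \<open>The slots in \<open>S\<close> are filled with \<open>v\<close> one at a time; each is a
  passage to a diagonal and costs one degree.\<close>

lemma degle_multadd:
  assumes V: "add_subgroup V" and Q: "multadd V I Q"
  shows "finite S \<Longrightarrow> S \<subseteq> I \<Longrightarrow> (\<And>i. i \<in> I \<Longrightarrow> y i \<in> V) \<Longrightarrow>
    degle V (card S) (\<lambda>v. Q (\<lambda>i. if i \<in> S then v else y i))"
proof (induction S arbitrary: y rule: finite_induct)
  case empty
  show ?case by (simp add: degle_const)
next
  case (insert i S)
  let ?\<Phi> = "\<lambda>w v. Q (\<lambda>j. if j \<in> S then v else (y(i := w)) j)"
  have eq: "?\<Phi> w v = Q ((\<lambda>j. if j \<in> S then v else y j)(i := w))" for w v
    using insert.hyps(2) by (intro arg_cong[of _ _ Q]) (auto simp: fun_eq_iff)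
  have "degle V (Suc (card S)) (\<lambda>v. ?\<Phi> v v)"
  proof (rule degle_diagonal[OF V, of "card S" ?\<Phi>])
    fix w assume w: "w \<in> V"
    show "degle V (card S) (?\<Phi> w)"
      by (rule insert.IH) (use insert.prems w in auto)
  next
    fix w w' v assume w: "w \<in> V" "w' \<in> V" "v \<in> V"
    show "?\<Phi> (w + w') v = ?\<Phi> w v + ?\<Phi> w' v"
      unfolding eq by (rule multadd_add[OF Q]) (use insert.prems w in auto)
  qed
  moreover have "(\<lambda>j. if j \<in> S then v else (y(i := v)) j) = (\<lambda>j. if j \<in> insert i S then v else y j)" for v
    using insert.hyps(2) by (auto simp: fun_eq_iff)
  ultimately show ?case using insert.hyps by simp
qed

section \<open>Chevalley--Warning by differences\<close>

text \<open>Binomial expansion of an iterated difference. \<open>s n\<close> is the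
  \<open>n\<close>-fold multiple of \<open>e\<close>, left to the caller so that it can be given in
  closed form.\<close>

lemma fold_diffop_replicate:
  fixes s :: "nat \<Rightarrow> 'v::ab_group_add"
  assumes "s 0 = 0" "\<And>n. s (Suc n) = s n + e"
  shows "fold diffop (replicate m e) F x = (\<Sum>n\<le>m. (-1) ^ (m - n) * of_nat (m choose n) * F (x + s n))"
proof (induction m arbitrary: x)
  case 0
  then show ?case using assms(1) by simp
next
  case (Suc m)
  let ?t = "\<lambda>m n x. (-1) ^ (m - n) * of_nat (m choose n) * F (x + s n)"
  have "fold diffop (replicate (Suc m) e) F x = (\<Sum>n\<le>m. ?t m n (x + e)) - (\<Sum>n\<le>m. ?t m n x)"
    by (simp only: replicate_Suc fold_Cons o_apply fold_diffop_commute diffop_apply Suc.IH)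
  also have "(\<Sum>n\<le>m. ?t m n (x + e)) = (\<Sum>n\<le>m. (-1) ^ (m - n) * of_nat (m choose n) * F (x + s (Suc n)))"
    by (intro sum.cong refl) (simp add: assms(2) ac_simps)
  also have "(\<Sum>n\<le>m. ?t m n x) = (\<Sum>n\<le>Suc m. ?t m n x)" by (simp add: binomial_eq_0)
  also have "\<dots> = ?t m 0 x + (\<Sum>n\<le>m. ?t m (Suc n) x)"
    by (rule sum.atMost_Suc_shift)
  also have "(\<Sum>n\<le>m. (-1) ^ (m - n) * of_nat (m choose n) * F (x + s (Suc n))) - (?t m 0 x + (\<Sum>n\<le>m. ?t m (Suc n) x))
    = - ?t m 0 x + (\<Sum>n\<le>m. (-1) ^ (m - n) * of_nat (m choose n) * F (x + s (Suc n)) - ?t m (Suc n) x)"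
    by (simp only: sum_subtractf) simp
  also have "\<dots> = ?t (Suc m) 0 x + (\<Sum>n\<le>m. ?t (Suc m) (Suc n) x)"
  proof -
    have "(-1) ^ (m - n) * of_nat (m choose n) * F (x + s (Suc n)) - ?t m (Suc n) x = ?t (Suc m) (Suc n) x"
      if "n \<le> m" for n
    proof (cases "n = m")
      case False
      then have "m - n = Suc (m - Suc n)" using that by simp
      then show ?thesis by (simp add: algebra_simps)
    qed (simp add: binomial_eq_0)
    then have "(\<Sum>n\<le>m. (-1) ^ (m - n) * of_nat (m choose n) * F (x + s (Suc n)) - ?t m (Suc n) x) =
      (\<Sum>n\<le>m. ?t (Suc m) (Suc n) x)" by (intro sum.cong refl) auto
    moreover have "- ?t m 0 x = ?t (Suc m) 0 x" by simp
    ultimately show ?thesis by (simp only:)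
  qed
  also have "\<dots> = (\<Sum>n\<le>Suc m. ?t (Suc m) n x)" by (rule sum.atMost_Suc_shift[symmetric])
  finally show ?case .
qed

text \<open>By Pascal's rule two neighbours add up to \<open>p choose Suc n\<close>, a multiple of
  \<open>p\<close>, so the values alternate from 1 onwards.\<close>

lemma of_nat_choose_pred_prime:
  "n < CARD('p) \<Longrightarrow> (of_nat (CARD('p) - 1 choose n) :: 'p::prime_card mod_ring) = (-1) ^ n"
proof (induction n)
  case (Suc n)
  let ?p = "CARD('p)"
  have p: "prime ?p" by (rule prime_card)
  have "?p choose Suc n = (?p - 1 choose n) + (?p - 1 choose Suc n)"
    using Suc.prems by (cases ?p) auto
  moreover have "(of_nat (?p choose Suc n) :: 'p mod_ring) = 0"
  proof -
    have "?p dvd (?p choose Suc n)" using dvd_choose_prime[of "Suc n" ?p] p Suc.prems by simp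
    then show ?thesis by (auto elim!: dvdE)
  qed
  ultimately have "(of_nat (?p - 1 choose n) :: 'p mod_ring) + of_nat (?p - 1 choose Suc n) = 0"
    by (metis of_nat_add)
  then show ?case using Suc by (simp add: add_eq_0_iff)
qed simp

lemma bij_betw_of_nat_mod_ring: "bij_betw of_nat {..<CARD('p)} (UNIV :: 'p::prime_card mod_ring set)"
proof -
  have surj: "of_nat ` {..<CARD('p)} = (UNIV :: 'p mod_ring set)"
    using surj_of_nat_mod_ring[where 'a='p] by (auto simp: image_iff)
  then show ?thesis
    unfolding bij_betw_def by (intro conjI eq_card_imp_inj_on) auto
qed

text \<open>All coefficients of the \<open>(p - 1)\<close>-fold difference equal
  \<open>(-1) ^ (p - 1)\<close> modulo \<open>p\<close>, so up to sign this difference is the sum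
  over the line.\<close>

lemma sum_line:
  fixes F :: "('i \<Rightarrow> 'p::prime_card mod_ring) \<Rightarrow> 'p mod_ring"
  assumes "x i = 0"
  shows "(\<Sum>u\<in>UNIV. F (x(i := u))) = (-1) ^ (CARD('p) - 1) * fold diffop (replicate (CARD('p) - 1) (0(i := 1))) F x"
proof -
  let ?m = "CARD('p) - 1"
  have p: "1 < CARD('p)" using prime_gt_1_nat[OF prime_card[where 'a='p]] .
  define s :: "nat \<Rightarrow> 'i \<Rightarrow> 'p mod_ring" where "s n = 0(i := of_nat n)" for n
  have s: "s 0 = 0" "s (Suc n) = s n + 0(i := 1)" for n
    by (auto simp: s_def fun_eq_iff)
  have "(\<Sum>u\<in>UNIV. F (x(i := u))) = (\<Sum>n<CARD('p). F (x(i := of_nat n)))"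
    by (rule sum.reindex_bij_betw[OF bij_betw_of_nat_mod_ring, symmetric])
  also have "\<dots> = (\<Sum>n\<le>?m. F (x + s n))"
  proof (rule sum.cong)
    show "{..<CARD('p)} = {..?m}" using p by auto
    show "F (x(i := of_nat n)) = F (x + s n)" for n
      using assms by (intro arg_cong[of _ _ F]) (auto simp: s_def fun_eq_iff)
  qed
  finally have l: "(\<Sum>u\<in>UNIV. F (x(i := u))) = (\<Sum>n\<le>?m. F (x + s n))" .
  have "fold diffop (replicate ?m (0(i := 1))) F x = (\<Sum>n\<le>?m. (-1) ^ (?m - n) * of_nat (?m choose n) * F (x + s n))"
    by (rule fold_diffop_replicate[of s, OF s])
  also have "\<dots> = (\<Sum>n\<le>?m. (-1) ^ ?m * F (x + s n))"
  proof (rule sum.cong[OF refl])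
    fix n assume "n \<in> {..?m}"
    then have n: "n \<le> ?m" "n < CARD('p)" using p by auto
    have "(-1) ^ (?m - n) * (of_nat (?m choose n) :: 'p mod_ring) = (-1) ^ ?m"
      unfolding of_nat_choose_pred_prime[OF n(2)] power_add[symmetric] le_add_diff_inverse2[OF n(1)] ..
    then show "(-1) ^ (?m - n) * of_nat (?m choose n) * F (x + s n) = (-1) ^ ?m * F (x + s n)" by simp
  qed
  also have "\<dots> = (-1) ^ ?m * (\<Sum>n\<le>?m. F (x + s n))" by (simp only: sum_distrib_left)
  finally have "(-1) ^ ?m * fold diffop (replicate ?m (0(i := 1))) F x = ((-1) ^ ?m * (-1) ^ ?m) * (\<Sum>n\<le>?m. F (x + s n))"
    by (simp only: mult.assoc)
  also have "((-1) ^ ?m * (-1) ^ ?m :: 'p mod_ring) = 1" by (simp add: power_mult_distrib[symmetric])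
  finally show ?thesis unfolding l by (simp only: mult_1)
qed

text \<open>By \<open>sum_line\<close>, summing over one coordinate is a \<open>(p - 1)\<close>-fold
  difference and lowers the degree by \<open>p - 1\<close>; this can be afforded fewer than
  \<open>card P\<close> times in full.\<close>

lemma sum_low_degree_eq_0:
  fixes F :: "('i \<Rightarrow> 'p::prime_card mod_ring) \<Rightarrow> 'p mod_ring"
  assumes "finite P"
  shows "degle (tuples UNIV P) m F \<Longrightarrow> m < (CARD('p) - 1) * card P \<Longrightarrow> (\<Sum>x\<in>tuples UNIV P. F x) = 0"
  using assms
proof (induction P arbitrary: m F rule: finite_induct)
  case (insert i P)
  let ?q = "CARD('p) - 1" and ?T = "tuples (UNIV :: 'p mod_ring set) P"
    and ?T' = "tuples (UNIV :: 'p mod_ring set) (insert i P)"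
  let ?G = "fold diffop (replicate ?q (0(i := 1))) F"
  have T: "add_subgroup ?T" and T': "add_subgroup ?T'"
    using add_subgroup_tuples[OF add_subgroup_UNIV] insert.hyps(1) by blast+
  have sub: "?T \<subseteq> ?T'" by (rule tuples_mono) auto
  have e: "(0 :: 'i \<Rightarrow> 'p mod_ring)(i := 1) \<in> ?T'" by (auto simp: tuples_def)
  have "(\<Sum>x\<in>?T'. F x) = (\<Sum>z\<in>UNIV \<times> ?T. F (case z of (u, x) \<Rightarrow> x(i := u)))"
    by (rule sum.reindex_bij_betw[OF bij_betw_tuples_insert[OF insert.hyps(2)], symmetric])
  also have "\<dots> = (\<Sum>u\<in>UNIV. \<Sum>x\<in>?T. F (x(i := u)))"
    by (simp only: sum.cartesian_product[symmetric] case_prod_conv prod.case_eq_if fst_conv snd_conv split_def)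
      (simp add: sum.cartesian_product split_def)
  also have "\<dots> = (\<Sum>x\<in>?T. \<Sum>u\<in>UNIV. F (x(i := u)))" by (rule sum.swap)
  also have "\<dots> = (\<Sum>x\<in>?T. (-1) ^ ?q * ?G x)"
    by (intro sum.cong refl sum_line) (rule tuplesD(2)[OF _ insert.hyps(2)])
  also have "\<dots> = (-1) ^ ?q * (\<Sum>x\<in>?T. ?G x)" by (simp only: sum_distrib_left)
  also have "(\<Sum>x\<in>?T. ?G x) = 0"
  proof (cases "?q \<le> m")
    case True
    have "degle ?T' (m - ?q) ?G"
      by (rule degle_fold) (use e True insert.prems(1) in auto)
    then have "degle ?T (m - ?q) ?G" by (rule degle_subset[OF sub])
    moreover have "m - ?q < ?q * card P" using insert.prems(2) insert.hyps True by auto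
    ultimately show ?thesis by (rule insert.IH)
  next
    case False
    have "?G x = 0" if "x \<in> ?T" for x
      by (rule fold_diffop_eq_0[OF _ _ T' insert.prems(1)]) (use e False that sub in auto)
    then show ?thesis by simp
  qed
  finally show ?case by simp
qed simp

lemma power_card_minus_1_mod_ring:
  fixes a :: "'p::prime_card mod_ring"
  assumes "a \<noteq> 0"
  shows "a ^ (CARD('p) - 1) = 1"
proof -
  let ?A = "UNIV - {0 :: 'p mod_ring}"
  have bij: "bij_betw (\<lambda>x. a * x) ?A ?A"
    by (rule bij_betwI[where g="\<lambda>x. x / a"]) (use assms in auto)
  have "(\<Prod>x\<in>?A. x) = (\<Prod>x\<in>?A. a * x)" using prod.reindex_bij_betw[OF bij, of "\<lambda>x. x"] by simp
  also have "\<dots> = a ^ card ?A * (\<Prod>x\<in>?A. x)" by (simp add: prod.distrib)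
  finally have "a ^ card ?A = 1" by simp
  then show ?thesis by (simp add: card_Diff_singleton)
qed

text \<open>By Fermat's theorem \<open>H\<close> is the indicator of the common zeros, and its
  degree is too low for a nonzero sum. If 0 were the only zero, the sum would be 1.\<close>

lemma chevalley_warning:
  fixes F :: "'j \<Rightarrow> ('i \<Rightarrow> 'p::prime_card mod_ring) \<Rightarrow> 'p mod_ring"
  assumes P: "finite P" and J: "finite J"
    and F: "\<And>j. j \<in> J \<Longrightarrow> degle (tuples UNIV P) e (F j)" "\<And>j. j \<in> J \<Longrightarrow> F j 0 = 0"
    and small: "card J * e < card P"
  shows "\<exists>x\<in>tuples UNIV P. x \<noteq> 0 \<and> (\<forall>j\<in>J. F j x = 0)"
proof (rule ccontr)
  assume neg: "\<not> ?thesis"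
  let ?q = "CARD('p) - 1" and ?T = "tuples (UNIV :: 'p mod_ring set) P"
  have q: "0 < ?q" using prime_gt_1_nat[OF prime_card[where 'a='p]] by simp
  have T: "add_subgroup ?T" by (rule add_subgroup_tuples[OF add_subgroup_UNIV P])
  define H where "H x = (\<Prod>j\<in>J. 1 + (-1) * F j x ^ ?q)" for x
  have "degle ?T (\<Sum>j\<in>J. ?q * e) H"
    unfolding H_def
    by (intro degle_prod[OF T J] degle_add degle_const degle_cmult[OF T] degle_power[OF T] F(1))
  moreover have "(\<Sum>j\<in>J. ?q * e) < ?q * card P" using small q by simp
  ultimately have "(\<Sum>x\<in>?T. H x) = 0" by (rule sum_low_degree_eq_0[OF P])
  moreover have "H x = (if x = 0 then 1 else 0)" if x: "x \<in> ?T" for x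
  proof (cases "x = 0")
    case True
    have z: "F j x ^ ?q = 0" if "j \<in> J" for j
      unfolding True F(2)[OF that] by (rule zero_power[OF q])
    have "H x = (\<Prod>j\<in>J. 1)" unfolding H_def by (intro prod.cong refl) (simp only: z, simp)
    then show ?thesis using True by simp
  next
    case False
    then obtain j where "j \<in> J" "F j x \<noteq> 0" using neg x by blast
    then have "H x = 0" unfolding H_def
      using J power_card_minus_1_mod_ring by (intro prod_zero) (auto intro!: bexI[of _ j])
    then show ?thesis using False by simp
  qed
  ultimately have "(\<Sum>x\<in>?T. if x = 0 then 1 else 0) = (0 :: 'p mod_ring)"
    using sum.cong[of ?T ?T H "\<lambda>x. if x = 0 then 1 else 0"] by simp
  then show False using add_subgroupD(1,2)[OF T] by simp
qed

section \<open>Interpolation at sums of generators\<close>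

text \<open>For a generator \<open>b\<close>, the function \<open>diffop b h\<close> has degree one
  less and vanishes at sums with one term fewer; thus \<open>h\<close> is invariant under adding
  \<open>b\<close>, hence constant. Allowing 0 as a term makes both ends of the difference test
  points.\<close>

lemma vanishes_of_interpolation:
  assumes U: "add_subgroup U" and B: "B \<subseteq> U" and gen: "\<And>u. u \<in> U \<Longrightarrow> \<exists>xs. set xs \<subseteq> B \<and> u = sum_list xs"
  shows "degle U m h \<Longrightarrow> (\<And>xs. set xs \<subseteq> insert 0 B \<Longrightarrow> length xs = m \<Longrightarrow> h (sum_list xs) = 0) \<Longrightarrow>
    u \<in> U \<Longrightarrow> h u = 0"
proof (induction m arbitrary: h u)
  case 0
  then show ?case using degle_0D[OF 0(1,3)] 0(2)[of "[]"] by simp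
next
  case (Suc m)
  note UD = add_subgroupD[OF U]
  have step: "h (v + b) = h v" if b: "b \<in> B" and v: "v \<in> U" for b v
  proof -
    have "diffop b h v = 0"
    proof (rule Suc.IH[OF _ _ v])
      show "degle U m (diffop b h)" using Suc.prems(1) b B by auto
      fix xs assume xs: "set xs \<subseteq> insert 0 B" "length xs = m"
      show "diffop b h (sum_list xs) = 0"
        using Suc.prems(2)[of "b # xs"] Suc.prems(2)[of "0 # xs"] xs b by (simp add: diffop_def add.commute)
    qed
    then show ?thesis by (simp add: diffop_def)
  qed
  have "sum_list xs \<in> U \<and> h (sum_list xs) = h 0" if "set xs \<subseteq> B" for xs
    using that
  proof (induction xs)
    case (Cons b xs)
    then have b: "b \<in> B" "b \<in> U" "sum_list xs \<in> U" "h (sum_list xs) = h 0" using B by auto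
    then show ?case using step[OF b(1,3)] UD(6)[OF b(3,2)] by (simp add: add.commute)
  qed (simp add: UD(2))
  then have "h u = h 0" using gen[OF Suc.prems(3)] by blast
  also have "0 = sum_list (replicate (Suc m) (0::'a))" by (induction m) simp_all
  also have "h (sum_list (replicate (Suc m) 0)) = 0" by (rule Suc.prems(2)) auto
  finally show ?case .
qed

text \<open>Slots are freed from \<open>B\<close> to \<open>U\<close> one at a time by additivity;
  \<open>R\<close> is the set of slots already freed.\<close>

lemma multadd_vanishes_of_generators:
  assumes V: "add_subgroup V" and Q: "multadd V I Q" and U: "U \<subseteq> V" and B: "B \<subseteq> U"
    and gen: "\<And>u. u \<in> U \<Longrightarrow> \<exists>xs. set xs \<subseteq> B \<and> u = sum_list xs"
    and zero: "\<And>x. (\<And>i. i \<in> I \<Longrightarrow> x i \<in> B) \<Longrightarrow> Q x = 0"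
    and R: "finite R"
  shows "(\<And>i. i \<in> I \<Longrightarrow> x i \<in> U) \<Longrightarrow> (\<And>i. i \<in> I \<Longrightarrow> i \<notin> R \<Longrightarrow> x i \<in> B) \<Longrightarrow> Q x = 0"
  using R
proof (induction R arbitrary: x rule: finite_induct)
  case empty
  then show ?case using zero by blast
next
  case (insert i R)
  show ?case
  proof (cases "i \<in> I")
    case False
    then show ?thesis using insert by (metis insertE)
  next
    case True
    obtain xs where xs: "set xs \<subseteq> B" "x i = sum_list xs" using gen[OF insert.prems(1)[OF True]] by blast
    have "sum_list ys \<in> V \<and> Q (x(i := sum_list ys)) = 0" if "set ys \<subseteq> B" for ys
      using that
    proof (induction ys)
      case Nil
      have "Q (x(i := 0)) = 0"
        by (rule multadd_zero[OF V Q _ True]) (use insert.prems(1) U add_subgroupD(2)[OF V] in auto)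
      then show ?case using add_subgroupD(2)[OF V] by (simp only: sum_list.Nil)
    next
      case (Cons b ys)
      have b: "b \<in> B" "b \<in> V" using Cons.prems B U by auto
      have "set ys \<subseteq> B" using Cons.prems by simp
      from Cons.IH[OF this] have ys: "sum_list ys \<in> V" "Q (x(i := sum_list ys)) = 0" by blast+
      have "Q (x(i := b)) = 0"
        by (rule insert.IH) (use insert.prems b B in auto)
      moreover have "Q (x(i := b + sum_list ys)) = Q (x(i := b)) + Q (x(i := sum_list ys))"
        by (rule multadd_add[OF Q _ True b(2) ys(1)]) (use insert.prems(1) U in auto)
      ultimately show ?case using ys add_subgroupD(6)[OF V b(2) ys(1)] by (simp only: sum_list.Cons) simp
    qed
    from this[OF xs(1)] show ?thesis by (simp add: xs(2)[symmetric])
  qed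
qed

section \<open>Constant subspaces\<close>

definition smul :: "'f::times \<Rightarrow> ('i \<Rightarrow> 'f) \<Rightarrow> 'i \<Rightarrow> 'f" where
  "smul a v = (\<lambda>i. a * v i)"

lemma smul_simps:
  fixes a b :: "'f::comm_ring_1"
  shows "smul a (x + y) = smul a x + smul a y" "smul (a + b) x = smul a x + smul b x"
    "smul (a - b) x = smul a x - smul b x"
    "smul a (smul b x) = smul (a * b) x" "smul 0 x = 0" "smul 1 x = x" "smul a 0 = 0"
  by (auto simp: smul_def fun_eq_iff algebra_simps)

lemma smul_of_nat: "smul (of_nat n :: 'f::comm_ring_1) v = sum_list (replicate n v)"
proof (induction n)
  case (Suc n)
  have "smul (of_nat (Suc n)) v = v + smul (of_nat n) v" by (simp add: smul_simps)
  then show ?case by (simp only: Suc.IH replicate_Suc sum_list.Cons)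
qed (simp add: smul_simps)

lemma smul_in_tuples: "v \<in> tuples UNIV P \<Longrightarrow> smul (a :: 'f::comm_ring_1) v \<in> tuples UNIV P"
  by (auto simp: smul_def tuples_def)

text \<open>\<open>U\<close> is a subspace of dimension \<open>j\<close> generated by \<open>B\<close>; the coordinate subspace given by \<open>P\<close> is a
  complement of it.\<close>

definition constant_flag ::
    "nat \<Rightarrow> ((nat \<Rightarrow> 'p::prime_card mod_ring) \<Rightarrow> 'p mod_ring) \<Rightarrow>
     (nat set \<times> ((nat \<Rightarrow> nat \<Rightarrow> 'p mod_ring) \<Rightarrow> 'p mod_ring)) set \<Rightarrow> nat \<Rightarrow>
     (nat \<Rightarrow> 'p mod_ring) set \<Rightarrow> (nat \<Rightarrow> 'p mod_ring) set \<Rightarrow> nat set \<Rightarrow> bool" where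
  "constant_flag N g \<Q> j B U P \<longleftrightarrow>
     finite B \<and> card B \<le> j \<and> B \<subseteq> U \<and> U \<subseteq> tuples UNIV {..<N} \<and> add_subgroup U \<and>
     (\<forall>a. \<forall>u\<in>U. smul a u \<in> U) \<and> (\<forall>u\<in>U. \<exists>xs. set xs \<subseteq> B \<and> u = sum_list xs) \<and>
     card U = CARD('p) ^ j \<and> P \<subseteq> {..<N} \<and> card P + j = N \<and> U \<inter> tuples UNIV P \<subseteq> {0} \<and>
     (\<forall>q\<in>\<Q>. \<forall>x. (\<forall>i\<in>fst q. x i \<in> U) \<longrightarrow> snd q x = 0) \<and> (\<forall>u\<in>U. g u = g 0)"

text \<open>The new vector \<open>v\<close> is sought in the complement given by \<open>P\<close>,
  which makes it independent of \<open>U\<close>. It has to solve two kinds of equations: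
  \<open>F1\<close> makes the forms vanish on generators of which one is \<open>v\<close>, and
  \<open>F2\<close> fixes the value of \<open>g\<close> at the interpolation points. The hypothesis
  \<open>small\<close> is what \<open>chevalley_warning\<close> needs, with
  \<open>Suc (Suc r)\<close> bounding all degrees.\<close>

lemma extend_constant_flag:
  fixes g :: "(nat \<Rightarrow> 'p::prime_card mod_ring) \<Rightarrow> 'p mod_ring" and N :: nat
  defines "V \<equiv> tuples (UNIV :: 'p mod_ring set) {..<N}"
  assumes g: "degle V (Suc (Suc r)) g"
    and Q: "forms_on V {..<Suc r} \<Q>" "card \<Q> \<le> C"
    and van: "\<And>x y. x \<in> tuples V {..<Suc r} \<Longrightarrow> \<forall>q\<in>\<Q>. snd q x = 0 \<Longrightarrow> y \<in> V \<Longrightarrow>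
      poly_form (Suc r) (diffop y g) x = 0"
    and flag: "constant_flag N g \<Q> j B U P"
    and small: "(CARD('p) + C * Suc r) * Suc j ^ r * Suc (Suc r) < card P"
  shows "\<exists>B' U' P'. constant_flag N g \<Q> (Suc j) B' U' P'"
proof -
  let ?T = "tuples (UNIV :: 'p mod_ring set) P"
  have fB: "finite B" and cB: "card B \<le> j" and BU: "B \<subseteq> U" and UV: "U \<subseteq> V" and U: "add_subgroup U"
    and Us': "\<forall>a. \<forall>u\<in>U. smul a u \<in> U"
    and gen': "\<forall>u\<in>U. \<exists>xs. set xs \<subseteq> B \<and> u = sum_list xs"
    and cU: "card U = CARD('p) ^ j" and PN: "P \<subseteq> {..<N}" and cP: "card P + j = N"
    and UP': "U \<inter> ?T \<subseteq> {0}"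
    and QU': "\<forall>q\<in>\<Q>. \<forall>x. (\<forall>i\<in>fst q. x i \<in> U) \<longrightarrow> snd q x = 0"
    and gU': "\<forall>u\<in>U. g u = g 0"
    using flag[unfolded constant_flag_def, folded V_def] by - (elim conjE, assumption)+
  have Us: "smul a u \<in> U" if "u \<in> U" for a u using Us' that by blast
  have gen: "\<exists>xs. set xs \<subseteq> B \<and> u = sum_list xs" if "u \<in> U" for u using gen' that by blast
  have UP: "v = 0" if "v \<in> U" "v \<in> ?T" for v using UP' that by blast
  have QU: "snd q x = 0" if "q \<in> \<Q>" "\<And>i. i \<in> fst q \<Longrightarrow> x i \<in> U" for q x using QU' that by blast
  have gU: "g u = g 0" if "u \<in> U" for u using gU' that by blast
  have V: "add_subgroup V" unfolding V_def by (rule add_subgroup_tuples[OF add_subgroup_UNIV]) simp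
  have fP: "finite P" using PN finite_subset by blast
  have T: "add_subgroup ?T" by (rule add_subgroup_tuples[OF add_subgroup_UNIV fP])
  have TV: "?T \<subseteq> V" unfolding V_def by (rule tuples_mono[OF UNIV_I PN])
  have BV: "B \<subseteq> V" using BU UV by blast
  note VD = add_subgroupD[OF V] and UD = add_subgroupD[OF U] and TD = add_subgroupD[OF T]
  have fQ: "finite \<Q>" using Q(1) unfolding forms_on_def by blast
  have QD: "fst q \<subseteq> {..<Suc r}" "multadd V (fst q) (snd q)" if "q \<in> \<Q>" for q
    using Q(1) that unfolding forms_on_def by blast+
  have fq: "finite (fst q)" "card (fst q) \<le> Suc r" if "q \<in> \<Q>" for q
    using finite_subset[OF QD(1)[OF that]] card_mono[OF _ QD(1)[OF that]] by simp_all

  \<comment> \<open>\<open>None\<close> stands for the new vector and \<open>Some b\<close> for an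
    old generator. One slot \<open>i0\<close> is reserved for the new vector; \<open>?S\<close>
    assigns all \<open>r\<close> remaining slots, even those that \<open>q\<close> does not have, to
    get the uniform bound \<open>Suc j ^ r\<close>.\<close>
  let ?O = "insert None (Some ` B)"
  let ?S = "\<lambda>i0. ({..<Suc r} - {i0}) \<rightarrow>\<^sub>E ?O"
  let ?J1 = "SIGMA q:\<Q>. SIGMA i0:fst q. ?S i0"
  \<comment> \<open>Every scalar needs equations of its own, as \<open>g\<close> is not linear along
    \<open>v\<close>; this is the source of \<open>CARD('p)\<close> in the bound.\<close>
  let ?J2 = "{xs. set xs \<subseteq> insert 0 B \<and> length xs = r} \<times> (UNIV :: 'p mod_ring set)"
  define w :: "nat \<Rightarrow> (nat \<Rightarrow> (nat \<Rightarrow> 'p mod_ring) option) \<Rightarrow> (nat \<Rightarrow> 'p mod_ring) \<Rightarrow> nat \<Rightarrow> nat \<Rightarrow> 'p mod_ring"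
    where "w i0 s v = (\<lambda>i. if i = i0 then v else case s i of None \<Rightarrow> v | Some b \<Rightarrow> b)" for i0 s v
  define F1 where "F1 k v = snd (fst k) (w (fst (snd k)) (snd (snd k)) v)"
    for k :: "(nat set \<times> ((nat \<Rightarrow> nat \<Rightarrow> 'p mod_ring) \<Rightarrow> 'p mod_ring)) \<times> nat \<times> (nat \<Rightarrow> (nat \<Rightarrow> 'p mod_ring) option)" and v
  define F2 where "F2 k v = g (sum_list (fst k) + smul (snd k) v) + (- 1) * g 0"
    for k :: "(nat \<Rightarrow> 'p mod_ring) list \<times> 'p mod_ring" and v
  have cO: "card ?O \<le> Suc j"
    using card_image_le[OF fB, of Some] cB card_insert_le_m1[of "Suc j" "Some ` B" None] by simp
  have cS: "card (?S i0) \<le> Suc j ^ r" "finite (?S i0)" if "i0 < Suc r" for i0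
  proof -
    have "card (?S i0) = card ?O ^ r" using that by (subst card_PiE) simp_all
    also have "\<dots> \<le> Suc j ^ r" by (rule power_mono[OF cO]) simp
    finally show "card (?S i0) \<le> Suc j ^ r" .
    show "finite (?S i0)" using fB by (intro finite_PiE) auto
  qed
  have J1: "finite ?J1" "card ?J1 \<le> C * Suc r * Suc j ^ r"
  proof -
    have fin: "finite (SIGMA i0:fst q. ?S i0)" if "q \<in> \<Q>" for q
      by (rule finite_SigmaI[OF fq(1)[OF that]]) (use cS(2) QD(1)[OF that] in blast)
    then show "finite ?J1" by (rule finite_SigmaI[OF fQ])
    have "card ?J1 = (\<Sum>q\<in>\<Q>. card (SIGMA i0:fst q. ?S i0))"
      by (rule card_SigmaI[OF fQ]) (use fin in blast)
    also have "\<dots> \<le> (\<Sum>q\<in>\<Q>. Suc r * Suc j ^ r)"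
    proof (rule sum_mono)
      fix q assume q: "q \<in> \<Q>"
      have "card (SIGMA i0:fst q. ?S i0) = (\<Sum>i0\<in>fst q. card (?S i0))"
        by (rule card_SigmaI[OF fq(1)[OF q]]) (use cS(2) QD(1)[OF q] in blast)
      also have "\<dots> \<le> (\<Sum>i0\<in>fst q. Suc j ^ r)"
        by (rule sum_mono) (use cS(1) QD(1)[OF q] in blast)
      also have "\<dots> = card (fst q) * Suc j ^ r" by simp
      also have "\<dots> \<le> Suc r * Suc j ^ r" by (rule mult_le_mono1[OF fq(2)[OF q]])
      finally show "card (SIGMA i0:fst q. ?S i0) \<le> Suc r * Suc j ^ r" .
    qed
    also have "\<dots> = card \<Q> * (Suc r * Suc j ^ r)" by simp
    also have "\<dots> \<le> C * (Suc r * Suc j ^ r)" by (rule mult_le_mono1[OF Q(2)])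
    finally show "card ?J1 \<le> C * Suc r * Suc j ^ r" by (simp only: mult.assoc)
  qed
  have J2: "finite ?J2" "card ?J2 \<le> CARD('p) * Suc j ^ r"
  proof -
    have fin: "finite (insert 0 B)" using fB by simp
    show "finite ?J2" by (intro finite_cartesian_product finite_lists_length_eq[OF fin] finite)
    have "card (insert 0 B) \<le> Suc j" using cB by (intro card_insert_le_m1) auto
    then have "card (insert 0 B) ^ r \<le> Suc j ^ r" by (rule power_mono) simp
    then show "card ?J2 \<le> CARD('p) * Suc j ^ r"
      unfolding card_cartesian_product card_lists_length_eq[OF fin] CARD_mod_ring
      by (simp add: mult.commute)
  qed
  have wV: "w i0 s v i \<in> V" if "i0 < Suc r" "s \<in> ?S i0" "v \<in> V" "i < Suc r" for i0 s v i
  proof (cases "i = i0")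
    case False
    then have "s i \<in> ?O" using that(2,4) by (intro PiE_mem[of s]) auto
    then show ?thesis using False BV that(3) by (auto simp: w_def)
  qed (simp add: w_def that(3))
  have F1: "degle ?T (Suc (Suc r)) (F1 k)" "F1 k 0 = 0" if kJ: "k \<in> ?J1" for k
  proof -
    obtain q i0 s where k: "k = (q, i0, s)" "q \<in> \<Q>" "i0 \<in> fst q" "s \<in> ?S i0" using kJ by (elim SigmaE) blast
    have i0: "i0 < Suc r" using QD(1)[OF k(2)] k(3) by blast
    have QV: "w i0 s v i \<in> V" if "v \<in> V" "i \<in> fst q" for v i
      using wV[OF i0 k(4) that(1)] QD(1)[OF k(2)] that(2) by blast
    \<comment> \<open>The slots of \<open>q\<close> that hold \<open>v\<close>. There are at most
      \<open>Suc r\<close> of them, which is within the degree bound that \<open>F2\<close>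
      imposes.\<close>
    let ?R = "{i\<in>fst q. i = i0 \<or> s i = None}"
    have eq: "F1 k v = snd q (\<lambda>i. if i \<in> ?R then v else w i0 s 0 i)" for v
      unfolding F1_def k(1) fst_conv snd_conv
      by (rule multadd_cong[OF QD(2)[OF k(2)]]) (auto simp: w_def split: option.splits)
    have "degle V (card ?R) (\<lambda>v. snd q (\<lambda>i. if i \<in> ?R then v else w i0 s 0 i))"
      by (rule degle_multadd[OF V QD(2)[OF k(2)]]) (use fq(1)[OF k(2)] QV[OF VD(2)] in auto)
    then have d: "degle V (card ?R) (F1 k)" unfolding eq .
    have "card ?R \<le> Suc (Suc r)" using card_mono[of "fst q" ?R] fq[OF k(2)] by auto
    then show "degle ?T (Suc (Suc r)) (F1 k)" by (rule degle_subset[OF TV degle_mono[OF V _ d]])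
    show "F1 k 0 = 0" unfolding F1_def k(1) fst_conv snd_conv
      by (rule multadd_zero[OF V QD(2)[OF k(2)] QV[OF VD(2)] k(3)]) (simp_all add: w_def)
  qed
  have L: "sum_list xs \<in> U" if "set xs \<subseteq> insert 0 B" for xs
    using that
  proof (induction xs)
    case (Cons b xs)
    have "b \<in> insert 0 B" "set xs \<subseteq> insert 0 B" using Cons.prems unfolding list.set by blast+
    then have "b \<in> U" "sum_list xs \<in> U" using BU UD(2) Cons.IH by blast+
    then show ?case unfolding sum_list.Cons by (rule UD(6))
  qed (simp add: UD(2))
  have F2: "degle ?T (Suc (Suc r)) (F2 k)" "F2 k 0 = 0" if kJ: "k \<in> ?J2" for k
  proof -
    obtain xs a where k: "k = (xs, a)" "set xs \<subseteq> insert 0 B" using kJ by (elim SigmaE) blast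
    have u: "sum_list xs \<in> U" by (rule L[OF k(2)])
    show "degle ?T (Suc (Suc r)) (F2 k)"
      unfolding F2_def k(1) fst_conv snd_conv
    proof (intro degle_add degle_const)
      show "degle ?T (Suc (Suc r)) (\<lambda>v. g (sum_list xs + smul a v))"
        by (rule degle_affine[OF V T _ _ _ g]) (use smul_in_tuples TV u UV in \<open>auto simp: smul_simps\<close>)
    qed
    show "F2 k 0 = 0" unfolding F2_def k(1) fst_conv snd_conv smul_simps using gU[OF u] by simp
  qed

  have "\<exists>v\<in>?T. v \<noteq> 0 \<and> (\<forall>k\<in>?J1 <+> ?J2. case_sum F1 F2 k v = 0)"
  proof (rule chevalley_warning[OF fP])
    show "finite (?J1 <+> ?J2)" using J1(1) J2(1) by (rule finite_Plus)
    show "degle ?T (Suc (Suc r)) (case_sum F1 F2 k)" if "k \<in> ?J1 <+> ?J2" for k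
      using that F1(1) F2(1) by (elim PlusE) simp_all
    show "case_sum F1 F2 k 0 = 0" if "k \<in> ?J1 <+> ?J2" for k
      using that F1(2) F2(2) by (elim PlusE) simp_all
    have "card (?J1 <+> ?J2) \<le> C * Suc r * Suc j ^ r + CARD('p) * Suc j ^ r"
      unfolding card_Plus[OF J1(1) J2(1)] by (rule add_mono[OF J1(2) J2(2)])
    also have "\<dots> = (CARD('p) + C * Suc r) * Suc j ^ r" by (simp only: distrib_right add.commute)
    finally have "card (?J1 <+> ?J2) * Suc (Suc r) \<le> (CARD('p) + C * Suc r) * Suc j ^ r * Suc (Suc r)"
      by (rule mult_le_mono1)
    then show "card (?J1 <+> ?J2) * Suc (Suc r) < card P" using small by (rule le_less_trans)
  qed
  then obtain v where vT: "v \<in> ?T" and v0: "v \<noteq> 0" and vk: "\<And>k. k \<in> ?J1 <+> ?J2 \<Longrightarrow> case_sum F1 F2 k v = 0"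
    by blast
  have vF1: "F1 k v = 0" if "k \<in> ?J1" for k using vk[OF InlI[OF that]] by simp
  have vF2: "F2 k v = 0" if "k \<in> ?J2" for k using vk[OF InrI[OF that]] by simp
  have vV: "v \<in> V" using vT TV by blast
  \<comment> \<open>Dropping from \<open>P\<close> a coordinate at which \<open>v\<close> is nonzero
    keeps the coordinate subspace complementary to the enlarged \<open>U'\<close>.\<close>
  obtain i where iP: "v i \<noteq> 0" using v0 by (auto simp: fun_eq_iff)
  have i: "i \<in> P" using iP tuplesD(2)[OF vT, of i] by blast
  define U' where "U' = (\<lambda>(u, a). u + smul a v) ` (U \<times> (UNIV :: 'p mod_ring set))"
  have U'I: "u + smul a v \<in> U'" if "u \<in> U" for u a unfolding U'_def using that by force
  have U'E: "\<exists>u a. u \<in> U \<and> z = u + smul a v" if zU: "z \<in> U'" for z using zU unfolding U'_def by auto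
  have UU': "u \<in> U'" if "u \<in> U" for u using U'I[OF that, of 0] by (simp add: smul_simps)
  have vU': "v \<in> U'" using U'I[OF UD(2), of 1] by (simp add: smul_simps)

  have inj: "inj_on (\<lambda>(u, a). u + smul a v) (U \<times> (UNIV :: 'p mod_ring set))"
  proof (rule inj_onI, clarify)
    fix u a u' a' assume h: "u \<in> U" "u' \<in> U" "u + smul a v = u' + smul a' v"
    have e: "smul (a - a') v = u' - u" using h(3) by (simp add: smul_simps algebra_simps)
    have "smul (a - a') v \<in> U" unfolding e by (rule UD(4)[OF h(2,1)])
    then have "smul (a - a') v = 0" by (rule UP) (rule smul_in_tuples[OF vT])
    then have "(a - a') * v i = 0" unfolding smul_def by (metis zero_fun_apply)
    then have "a = a'" using iP by simp
    then show "u = u' \<and> a = a'" using h(3) by simp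
  qed
  have cU': "card U' = CARD('p) ^ Suc j"
    unfolding U'_def card_image[OF inj] card_cartesian_product cU CARD_mod_ring by simp
  have U': "add_subgroup U'"
    unfolding add_subgroup_def
  proof (intro conjI ballI)
    show "finite U'" unfolding U'_def by (intro finite_imageI finite_cartesian_product UD(1) finite)
    show "0 \<in> U'" by (rule UU'[OF UD(2)])
    fix x y assume "x \<in> U'" "y \<in> U'"
    then obtain u a u' a' where h: "u \<in> U" "x = u + smul a v" "u' \<in> U" "y = u' + smul a' v"
      using U'E by meson
    have "x - y = (u - u') + smul (a - a') v" unfolding h(2,4) by (simp add: smul_simps algebra_simps)
    then show "x - y \<in> U'" using U'I[OF UD(4)[OF h(1,3)]] by (simp only:)
  qed
  have U'V: "U' \<subseteq> V"
  proof
    fix z assume "z \<in> U'"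
    then obtain u a where "u \<in> U" "z = u + smul a v" using U'E by blast
    then show "z \<in> V" using VD(6) UV smul_in_tuples[OF vT] TV by blast
  qed
  let ?B' = "insert v B"
  have gen': "\<exists>xs. set xs \<subseteq> ?B' \<and> z = sum_list xs" if zU: "z \<in> U'" for z
  proof -
    obtain u a where z: "u \<in> U" "z = u + smul a v" using U'E[OF zU] by blast
    obtain xs where xs: "set xs \<subseteq> B" "u = sum_list xs" using gen[OF z(1)] by blast
    obtain n where n: "a = of_nat n" using surj_of_nat_mod_ring[of a] by blast
    show ?thesis
    proof (intro exI conjI)
      show "set (xs @ replicate n v) \<subseteq> ?B'" using xs(1) by auto
      show "z = sum_list (xs @ replicate n v)" unfolding z(2) n smul_of_nat xs(2) sum_list_append ..
    qed
  qed

  have QB': "snd q x = 0" if q: "q \<in> \<Q>" and x: "\<And>i. i \<in> fst q \<Longrightarrow> x i \<in> ?B'" for q x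
  proof (cases "\<exists>i0\<in>fst q. x i0 = v")
    case False
    then have "x i \<in> U" if "i \<in> fst q" for i using x[OF that] that BU by blast
    then show ?thesis by (rule QU[OF q])
  next
    case True
    then obtain i0 where i0: "i0 \<in> fst q" "x i0 = v" by blast
    define s where "s = (\<lambda>i\<in>{..<Suc r} - {i0}. if x i \<in> B then Some (x i) else None)"
    have s: "s \<in> ?S i0" unfolding s_def by auto
    have "snd q x = snd q (w i0 s v)"
    proof (rule multadd_cong[OF QD(2)[OF q]])
      fix i assume iq: "i \<in> fst q"
      then have "i < Suc r" using QD(1)[OF q] by blast
      then show "x i = w i0 s v i" using x[OF iq] i0(2) by (auto simp: w_def s_def)
    qed
    also have "\<dots> = F1 (q, i0, s) v" by (simp only: F1_def fst_conv snd_conv)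
    also have "\<dots> = 0" by (rule vF1) (use q i0(1) s in blast)
    finally show ?thesis .
  qed
  have B'U': "?B' \<subseteq> U'" using vU' UU' BU by blast
  have QU': "snd q x = 0" if q: "q \<in> \<Q>" and x: "\<And>i. i \<in> fst q \<Longrightarrow> x i \<in> U'" for q x
    by (rule multadd_vanishes_of_generators[OF V QD(2)[OF q] U'V B'U' gen' QB'[OF q] fq(1)[OF q] x]) auto

  \<comment> \<open>As the forms vanish on \<open>U\<close>, \<open>van\<close> makes each
    \<open>(r + 1)\<close>-fold difference of \<open>g\<close> along \<open>U\<close> constant on
    all of \<open>V\<close>, not only on \<open>U\<close>. So it agrees at \<open>x\<close> and at
    \<open>x + smul a v\<close>, and the difference of \<open>g\<close> along
    \<open>smul a v\<close> has degree only \<open>r\<close> on \<open>U\<close>.\<close>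
  have const: "fold diffop hs g y = fold diffop hs g 0" if hs: "set hs \<subseteq> U" "length hs = Suc r" and y: "y \<in> V" for hs y
  proof -
    let ?x = "\<lambda>i. if i < Suc r then hs ! i else 0"
    have xU: "?x i \<in> U" if "i < Suc r" for i using that hs nth_mem[of i hs] by auto
    have xt: "?x \<in> tuples V {..<Suc r}" by (rule tuplesI) (use xU UV in auto)
    have "\<forall>q\<in>\<Q>. snd q ?x = 0"
    proof
      fix q assume q: "q \<in> \<Q>"
      show "snd q ?x = 0" by (rule QU[OF q]) (use xU QD(1)[OF q] in blast)
    qed
    then have "poly_form (Suc r) (diffop y g) ?x = 0" by (rule van[OF xt _ y])
    moreover have "map ?x [0..<Suc r] = hs" using hs(2) by (intro nth_equalityI) (simp_all del: upt_Suc)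
    ultimately have "diffop y (fold diffop hs g) 0 = 0"
      unfolding poly_form_def fold_diffop_commute by (simp only:)
    then show ?thesis by (simp add: diffop_apply)
  qed
  have gU': "g z = g 0" if zU: "z \<in> U'" for z
  proof -
    obtain u a where z: "u \<in> U" "z = u + smul a v" using U'E[OF zU] by blast
    have avV: "smul a v \<in> V" using smul_in_tuples[OF vT] TV by blast
    have "diffop (smul a v) g u = 0"
    proof (rule vanishes_of_interpolation[OF U BU gen _ _ z(1)])
      show "degle U r (diffop (smul a v) g)"
      proof (rule degleI_fold_eq_0[OF UD(2)])
        fix hs x assume hs: "set hs \<subseteq> U" "length hs = Suc r" "x \<in> U"
        have x: "x \<in> V" using hs(3) UV by blast
        show "fold diffop hs (diffop (smul a v) g) x = 0"
          unfolding fold_diffop_commute diffop_apply const[OF hs(1,2) VD(6)[OF x avV]] const[OF hs(1,2) x] by simp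
      qed
      fix xs assume xs: "set xs \<subseteq> insert 0 B" "length xs = r"
      have "F2 (xs, a) v = 0" by (rule vF2) (use xs in blast)
      then show "diffop (smul a v) g (sum_list xs) = 0"
        unfolding diffop_apply gU[OF L[OF xs(1)]] F2_def by simp
    qed
    then show ?thesis unfolding z(2) diffop_apply using gU[OF z(1)] by simp
  qed

  let ?P' = "P - {i}"
  have cB': "finite ?B'" "card ?B' \<le> Suc j"
    using fB cB card_insert_le_m1[of "Suc j" B v] by simp_all
  have U's: "smul a z \<in> U'" if zU: "z \<in> U'" for a z
  proof -
    obtain u b where z: "u \<in> U" "z = u + smul b v" using U'E[OF zU] by blast
    show ?thesis unfolding z(2) smul_simps by (rule U'I[OF Us[OF z(1)]])
  qed
  have cP': "?P' \<subseteq> {..<N}" "card ?P' + Suc j = N"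
  proof -
    show "?P' \<subseteq> {..<N}" using PN by blast
    have "Suc (card ?P') = card P" by (rule card_Suc_Diff1[OF fP i])
    then show "card ?P' + Suc j = N" using cP by simp
  qed
  have UP': "z = 0" if zU: "z \<in> U'" and zT: "z \<in> tuples UNIV ?P'" for z
  proof -
    obtain u a where z: "u \<in> U" "z = u + smul a v" using U'E[OF zU] by blast
    have zT': "z \<in> ?T" using zT tuples_mono[of UNIV ?P' P] by blast
    have "u = z - smul a v" unfolding z(2) by simp
    then have "u \<in> ?T" using TD(4)[OF zT' smul_in_tuples[OF vT]] by (simp only:)
    then have u0: "u = 0" by (rule UP[OF z(1)])
    then have za: "z = smul a v" unfolding z(2) by simp
    have "z i = 0" by (rule tuplesD(2)[OF zT]) simp
    then have "a * v i = 0" unfolding za smul_def .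
    then have "a = 0" using iP by simp
    then show ?thesis unfolding za by (simp add: smul_simps)
  qed
  have "constant_flag N g \<Q> (Suc j) ?B' U' ?P'"
    unfolding constant_flag_def V_def[symmetric]
  proof (intro conjI)
    show "\<forall>a. \<forall>u\<in>U'. smul a u \<in> U'" using U's by blast
    show "\<forall>u\<in>U'. \<exists>xs. set xs \<subseteq> ?B' \<and> u = sum_list xs" using gen' by blast
    show "U' \<inter> tuples UNIV ?P' \<subseteq> {0}" using UP' by blast
    show "\<forall>q\<in>\<Q>. \<forall>x. (\<forall>i\<in>fst q. x i \<in> U') \<longrightarrow> snd q x = 0" using QU' by blast
    show "\<forall>u\<in>U'. g u = g 0" using gU' by blast
  qed (fact cB' B'U' U'V U' cU' cP')+
  then show ?thesis by blast
qed

text \<open>The flag is extended \<open>k\<close> times, starting from \<open>{0}\<close>. The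
  additional \<open>Suc\<close> in the bound on \<open>N\<close> pays for the \<open>j\<close>
  coordinates already removed from \<open>P\<close>, since \<open>j < k \<le> k ^ r\<close> by
  \<open>0 < r\<close>.\<close>

lemma ex_constant_subspace:
  fixes g :: "(nat \<Rightarrow> 'p::prime_card mod_ring) \<Rightarrow> 'p mod_ring" and N :: nat
    and \<Q> :: "(nat set \<times> ((nat \<Rightarrow> nat \<Rightarrow> 'p mod_ring) \<Rightarrow> 'p mod_ring)) set"
  defines "V \<equiv> tuples (UNIV :: 'p mod_ring set) {..<N}"
  assumes g: "degle V (Suc (Suc r)) g" and r: "0 < r"
    and Q: "forms_on V {..<Suc r} \<Q>" "card \<Q> \<le> C"
    and van: "\<And>x y. x \<in> tuples V {..<Suc r} \<Longrightarrow> \<forall>q\<in>\<Q>. snd q x = 0 \<Longrightarrow> y \<in> V \<Longrightarrow>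
      poly_form (Suc r) (diffop y g) x = 0"
    and N: "Suc ((CARD('p) + C * Suc r) * Suc (Suc r)) * k ^ r \<le> N"
  shows "\<exists>U. U \<subseteq> V \<and> add_subgroup U \<and> (\<forall>a. \<forall>u\<in>U. smul a u \<in> U) \<and> card U = CARD('p) ^ k \<and> (\<forall>u\<in>U. g u = g 0)"
proof -
  have V: "add_subgroup V" unfolding V_def by (rule add_subgroup_tuples[OF add_subgroup_UNIV]) simp
  let ?A = "(CARD('p) + C * Suc r) * Suc (Suc r)"
  have "\<exists>B U P. constant_flag N g \<Q> j B U P" if "j \<le> k" for j
    using that
  proof (induction j)
    case 0
    have "constant_flag N g \<Q> 0 {} {0} {..<N}"
      unfolding constant_flag_def
    proof (intro conjI ballI allI impI)
      show "{0} \<subseteq> tuples (UNIV :: 'p mod_ring set) {..<N}" using add_subgroupD(2)[OF V] unfolding V_def by blast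
      show "add_subgroup {0 :: nat \<Rightarrow> 'p mod_ring}" by (simp add: add_subgroup_def)
      show "smul a u \<in> {0}" if "u \<in> {0}" for a and u :: "nat \<Rightarrow> 'p mod_ring" using that by (simp add: smul_simps)
      show "\<exists>xs. set xs \<subseteq> {} \<and> u = sum_list xs" if "u \<in> {0}" for u :: "nat \<Rightarrow> 'p mod_ring"
        using that by (intro exI[of _ "[]"]) simp
      show "g u = g 0" if "u \<in> {0}" for u using that by simp
      fix q x assume q: "q \<in> \<Q>" and x: "\<forall>i\<in>fst q. x i \<in> {0 :: nat \<Rightarrow> 'p mod_ring}"
      obtain i where i: "i \<in> fst q" and ma: "multadd V (fst q) (snd q)"
        using Q(1) q unfolding forms_on_def by blast
      show "snd q x = 0"
        by (rule multadd_zero[OF V ma _ i]) (use x i add_subgroupD(2)[OF V] in auto)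
    qed auto
    then show ?case by blast
  next
    case (Suc j)
    then obtain B U P where fl: "constant_flag N g \<Q> j B U P" by (meson Suc_leD)
    have cP: "card P + j = N" using fl unfolding constant_flag_def by blast
    have "?A * Suc j ^ r \<le> ?A * k ^ r" using Suc.prems by (intro mult_le_mono2 power_mono) auto
    moreover have "k \<le> k ^ r" using self_le_power[of k r] r Suc.prems by simp
    moreover have "?A * k ^ r + k ^ r \<le> N" using N by simp
    ultimately have "?A * Suc j ^ r < card P" using cP Suc.prems by linarith
    then have "(CARD('p) + C * Suc r) * Suc j ^ r * Suc (Suc r) < card P" by (simp only: mult_ac)
    from extend_constant_flag[OF g[unfolded V_def] Q[unfolded V_def] van[unfolded V_def] fl this] show ?case .
  qed
  from this[OF order_refl] obtain B U P where fl: "constant_flag N g \<Q> k B U P" by blast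
  show ?thesis
    using fl unfolding constant_flag_def V_def[symmetric] by (intro exI[of _ U]) blast
qed

text \<open>\<open>A\<close> is fixed before \<open>N\<close>, \<open>k\<close> and
  \<open>g\<close>. It depends on \<open>\<eta>\<close> only through the number \<open>C\<close> of
  forms that belongs to the density \<open>\<eta> ^ 2 ^ Suc r\<close> guaranteed by the
  bias.\<close>

lemma ex_constant_subspace_of_bias:
  fixes \<eta> :: real
  assumes \<eta>: "0 < \<eta>" and r: "0 < r"
  shows "\<exists>A::nat. 0 < A \<and> (\<forall>(N::nat) (k::nat) (g :: (nat \<Rightarrow> 'p::prime_card mod_ring) \<Rightarrow> 'p mod_ring).
    degle (tuples UNIV {..<N}) (Suc (Suc r)) g \<longrightarrow> \<eta> \<le> bias (tuples UNIV {..<N}) g \<longrightarrow> A * k ^ r \<le> N \<longrightarrow>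
    (\<exists>U \<subseteq> tuples UNIV {..<N}. add_subgroup U \<and> (\<forall>a. \<forall>u\<in>U. smul a u \<in> U) \<and>
       card U = CARD('p) ^ k \<and> (\<forall>u\<in>U. g u = g 0)))"
proof -
  let ?m = "Suc r"
  obtain C where C: "\<forall>(V :: (nat \<Rightarrow> 'p mod_ring) set) (K :: nat set) (\<M> :: ((nat \<Rightarrow> nat \<Rightarrow> 'p mod_ring) \<Rightarrow> 'p mod_ring) set).
    add_subgroup V \<longrightarrow> finite K \<longrightarrow> card K = ?m \<longrightarrow> finite \<M> \<longrightarrow> (\<forall>M\<in>\<M>. multadd V K M) \<longrightarrow>
    \<eta> ^ 2 ^ ?m \<le> prob (tuples V K) (\<lambda>x. \<forall>M\<in>\<M>. M x = 0) \<longrightarrow>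
    (\<exists>\<Q> :: (nat set \<times> ((nat \<Rightarrow> nat \<Rightarrow> 'p mod_ring) \<Rightarrow> 'p mod_ring)) set. forms_on V K \<Q> \<and> card \<Q> \<le> C \<and>
      (\<forall>x\<in>tuples V K. (\<forall>q\<in>\<Q>. snd q x = 0) \<longrightarrow> (\<forall>M\<in>\<M>. M x = 0)))"
    using dense_zero_set_contains_variety[OF zero_less_power[OF \<eta>, of "2 ^ ?m"], of ?m] by (elim exE)
  let ?A = "Suc ((CARD('p) + C * Suc r) * Suc (Suc r))"
  show ?thesis
  proof (intro exI[of _ ?A] conjI allI impI)
    fix N k :: nat and g :: "(nat \<Rightarrow> 'p mod_ring) \<Rightarrow> 'p mod_ring"
    let ?V = "tuples (UNIV :: 'p mod_ring set) {..<N}"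
    assume g: "degle ?V (Suc (Suc r)) g" and b: "\<eta> \<le> bias ?V g" and N: "?A * k ^ r \<le> N"
    have V: "add_subgroup ?V" by (rule add_subgroup_tuples[OF add_subgroup_UNIV]) simp
    let ?M = "(\<lambda>y. poly_form ?m (diffop y g)) ` ?V"
    have "\<eta> ^ 2 ^ ?m \<le> bias ?V g ^ 2 ^ ?m" using \<eta> b by (intro power_mono) auto
    also have "\<dots> \<le> prob (tuples ?V {..<?m}) (\<lambda>x. \<forall>M\<in>?M. M x = 0)"
      by (rule bias_le_prob_forms_vanish[OF V g])
    finally have dense: "\<eta> ^ 2 ^ ?m \<le> prob (tuples ?V {..<?m}) (\<lambda>x. \<forall>M\<in>?M. M x = 0)" .
    have ma: "\<forall>M\<in>?M. multadd ?V {..<?m} M"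
    proof (rule ballI, elim imageE)
      fix M y assume y: "M = poly_form ?m (diffop y g)" "y \<in> ?V"
      have "degle ?V ?m (diffop y g)" using g y(2) unfolding degle.simps(2)[of ?V ?m] by blast
      then show "multadd ?V {..<?m} M" unfolding y(1) by (rule multadd_poly_form[OF V])
    qed
    have fin: "finite ?M" by (rule finite_imageI[OF add_subgroupD(1)[OF V]])
    obtain \<Q> :: "(nat set \<times> ((nat \<Rightarrow> nat \<Rightarrow> 'p mod_ring) \<Rightarrow> 'p mod_ring)) set" where
      Q: "forms_on ?V {..<?m} \<Q>" "card \<Q> \<le> C"
      "\<forall>x\<in>tuples ?V {..<?m}. (\<forall>q\<in>\<Q>. snd q x = 0) \<longrightarrow> (\<forall>M\<in>?M. M x = 0)"
      using C[THEN spec, THEN spec, THEN spec, THEN mp, OF V, THEN mp, OF finite_lessThan, THEN mp, OF card_lessThan,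
          THEN mp, OF fin, THEN mp, OF ma, THEN mp, OF dense] by (elim exE conjE)
    have van: "poly_form ?m (diffop y g) x = 0"
      if "x \<in> tuples ?V {..<?m}" "\<forall>q\<in>\<Q>. snd q x = 0" "y \<in> ?V" for x y
      using Q(3) that by blast
    show "\<exists>U \<subseteq> ?V. add_subgroup U \<and> (\<forall>a. \<forall>u\<in>U. smul a u \<in> U) \<and> card U = CARD('p) ^ k \<and> (\<forall>u\<in>U. g u = g 0)"
      using ex_constant_subspace[OF g r Q(1,2) van N] by blast
  qed simp
qed

section \<open>Coordinates on subspaces\<close>

definition coords :: "nat \<Rightarrow> nat \<Rightarrow> (nat \<Rightarrow> 'a::comm_ring_1 vec) \<Rightarrow> (nat \<Rightarrow> 'a) \<Rightarrow> 'a vec" where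
  "coords n k b c = vec n (\<lambda>l. \<Sum>i<k. c i * b i $ l)"

lemma coords_add: "coords n k b (c + c') = coords n k b c + coords n k b c'"
  by (intro eq_vecI) (simp_all add: coords_def distrib_right sum.distrib)

lemma coords_smul: "coords n k b (smul a c) = a \<cdot>\<^sub>v coords n k b c"
  by (intro eq_vecI) (simp_all add: coords_def smul_def sum_distrib_left mult.assoc)

text \<open>The bridge from vectors to the function spaces of the preceding sections:
  \<open>U\<close> is finite, so it has a finite basis, and \<open>coords\<close> is the linear
  combination map of that basis in some numbering.\<close>

lemma subspace_coordinates:
  fixes U :: "'a::{field,finite} vec set"
  assumes U: "VectorSpace.subspace class_ring U (module_vec TYPE('a) n)"
    and k: "vectorspace.dim class_ring ((module_vec TYPE('a) n)\<lparr>carrier := U\<rparr>) = k"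
  shows "\<exists>b. bij_betw (coords n k b) (tuples UNIV {..<k}) U"
proof -
  interpret vec_space "TYPE('a)" n .
  let ?W = "V\<lparr>carrier := U\<rparr>"
  have sub: "submodule class_ring U V" using U unfolding subspace_def by blast
  interpret w: vectorspace class_ring ?W by (rule subspace_is_vs[OF U])
  have UV: "U \<subseteq> carrier_vec n" using submodule.subset[OF sub] by simp
  have finV: "finite (carrier_vec n :: 'a vec set)"
  proof -
    have "carrier_vec n \<subseteq> (vec_of_list :: 'a list \<Rightarrow> _) ` {xs. set xs \<subseteq> UNIV \<and> length xs = n}"
    proof
      fix x :: "'a vec" assume "x \<in> carrier_vec n"
      then have "list_of_vec x \<in> {xs. set xs \<subseteq> UNIV \<and> length xs = n}" by simp
      then show "x \<in> vec_of_list ` {xs. set xs \<subseteq> UNIV \<and> length xs = n}"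
        by (intro image_eqI[of _ _ "list_of_vec x"]) (simp_all add: vec_list)
    qed
    then show ?thesis by (rule finite_subset) (intro finite_imageI finite_lists_length_eq finite)
  qed
  then have finU: "finite U" using UV finite_subset by blast
  have "w.gen_set U"
    using w.in_own_span[of U] w.span_is_subset2[of U] by auto
  then have "w.fin_dim" unfolding w.fin_dim_def using finU by auto
  then obtain \<beta> where \<beta>: "finite \<beta>" "w.basis \<beta>" using w.finite_basis_exists by blast
  have \<beta>U: "\<beta> \<subseteq> U" using \<beta>(2) unfolding w.basis_def by simp
  have card: "card \<beta> = k" using w.dim_basis[OF \<beta>] k by simp
  have \<beta>V: "\<beta> \<subseteq> carrier_vec n" using \<beta>U UV by blast
  have span: "span \<beta> = U"
    using \<beta>(2) span_li_not_depend(1)[OF \<beta>U sub] unfolding w.basis_def by simp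
  have indep: "\<not> lin_dep \<beta>"
    using \<beta>(2) span_li_not_depend(2)[OF \<beta>U sub] unfolding w.basis_def by simp
  obtain e where e: "bij_betw e {..<k} \<beta>"
    using ex_bij_betw_nat_finite[OF \<beta>(1)] card by (auto simp: atLeast0LessThan)
  have lin: "coords n k e (\<lambda>i. a (e i)) = lincomb a \<beta>" for a
  proof (rule eq_vecI)
    show "dim_vec (coords n k e (\<lambda>i. a (e i))) = dim_vec (lincomb a \<beta>)"
      by (simp add: coords_def lincomb_dim[OF \<beta>(1) \<beta>V])
    fix l assume "l < dim_vec (lincomb a \<beta>)"
    then have l: "l < n" by (simp add: lincomb_dim[OF \<beta>(1) \<beta>V])
    show "coords n k e (\<lambda>i. a (e i)) $ l = lincomb a \<beta> $ l"
      unfolding lincomb_index[OF l \<beta>V]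
      using l sum.reindex_bij_betw[OF e, of "\<lambda>x. a x * x $ l"] by (simp add: coords_def)
  qed
  have res_cong: "coords n k e c = coords n k e c'" if "\<And>i. i < k \<Longrightarrow> c i = c' i" for c c'
  proof -
    have "(\<Sum>i<k. c i * e i $ l) = (\<Sum>i<k. c' i * e i $ l)" for l
      by (intro sum.cong refl) (simp add: that)
    then show ?thesis by (simp only: coords_def)
  qed
  let ?inv = "inv_into {..<k} e"
  have inv: "?inv (e i) = i" if "i < k" for i
    using bij_betw_inv_into_left[OF e] that by simp
  have lin': "coords n k e c = lincomb (\<lambda>x. c (?inv x)) \<beta>" for c
    unfolding lin[symmetric] by (rule res_cong) (simp add: inv)
  have "bij_betw (coords n k e) (tuples UNIV {..<k}) U"
    unfolding bij_betw_def
  proof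
    show "inj_on (coords n k e) (tuples UNIV {..<k})"
    proof (rule inj_onI)
      fix c c' assume c: "c \<in> tuples UNIV {..<k}" "c' \<in> tuples UNIV {..<k}" "coords n k e c = coords n k e c'"
      let ?c = "c + smul (- 1) c'"
      have "coords n k e ?c = 0\<^sub>v n"
        unfolding coords_add coords_smul c(3) by (intro eq_vecI) (simp_all add: coords_def)
      then have "lincomb (\<lambda>x. ?c (?inv x)) \<beta> = 0\<^sub>v n" unfolding lin' .
      then have z: "?c (?inv x) = 0" if "x \<in> \<beta>" for x
        using indep \<beta>(1) that unfolding lin_dep_def by fastforce
      show "c = c'"
      proof
        fix i
        show "c i = c' i"
        proof (cases "i < k")
          case True
          then have "e i \<in> \<beta>" using e by (auto simp: bij_betw_def)
          from z[OF this] show ?thesis using inv[OF True] by (simp add: smul_def)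
        next
          case False
          then show ?thesis using tuplesD(2)[OF c(1), of i] tuplesD(2)[OF c(2), of i] by simp
        qed
      qed
    qed
    show "coords n k e ` tuples UNIV {..<k} = U"
    proof
      show "coords n k e ` tuples UNIV {..<k} \<subseteq> U"
        unfolding span[symmetric] lin' span_def using \<beta>(1) by blast
      show "U \<subseteq> coords n k e ` tuples UNIV {..<k}"
      proof
        fix u assume "u \<in> U"
        then obtain a where a: "u = lincomb a \<beta>"
          unfolding span[symmetric] finite_span[OF \<beta>(1) \<beta>V] by blast
        have "u = coords n k e (res {..<k} (\<lambda>i. a (e i)))"
          unfolding a lin[symmetric] by (rule res_cong) (simp add: res_def)
        moreover have "res {..<k} (\<lambda>i. a (e i)) \<in> tuples UNIV {..<k}"
          by (rule tuplesI) (simp_all add: res_def)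
        ultimately show "u \<in> coords n k e ` tuples UNIV {..<k}" by blast
      qed
    qed
  qed
  then show ?thesis by blast
qed

text \<open>Coordinates determine the number of elements from the dimension, and a power of a number
  above 1 determines its exponent.\<close>

lemma dim_eq_of_card:
  fixes U :: "'a::{field,finite} vec set"
  assumes U: "VectorSpace.subspace class_ring U (module_vec TYPE('a) n)" and card: "card U = CARD('a) ^ k"
  shows "vectorspace.dim class_ring ((module_vec TYPE('a) n)\<lparr>carrier := U\<rparr>) = k"
proof -
  let ?d = "vectorspace.dim class_ring ((module_vec TYPE('a) n)\<lparr>carrier := U\<rparr>)"
  obtain b where "bij_betw (coords n ?d b) (tuples UNIV {..<?d}) U"
    using subspace_coordinates[OF U refl] by blast
  then have "CARD('a) ^ ?d = CARD('a) ^ k"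
    using bij_betw_same_card card card_tuples[of "{..<?d}" "UNIV :: 'a set"] by fastforce
  moreover have "1 < CARD('a)"
    using card_mono[of UNIV "{0, 1 :: 'a}"] by simp
  ultimately show ?thesis by simp
qed

lemma degle_coordinate:
  "finite K \<Longrightarrow> degle (tuples (UNIV :: 'a::{comm_ring_1,finite} set) K) 1 (\<lambda>c. c i)"
  by (intro degle_additive add_subgroup_tuples add_subgroup_UNIV plus_fun_apply)

text \<open>Each entry of \<open>u0 + coords n N b c\<close> is affine in \<open>c\<close>, so a
  monomial has degree at most its \<open>monom_degree\<close>.\<close>

lemma degle_of_poly_degree:
  fixes f :: "'p::prime_card mod_ring vec \<Rightarrow> 'p mod_ring"
  assumes f: "has_poly_degree n f d" and u0: "u0 \<in> carrier_vec n"
  shows "degle (tuples UNIV {..<N}) d (\<lambda>c. f (u0 + coords n N b c))"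
proof -
  let ?V = "tuples (UNIV :: 'p mod_ring set) {..<N}"
  let ?x = "\<lambda>c. u0 + coords n N b c"
  have V: "add_subgroup ?V" by (rule add_subgroup_tuples[OF add_subgroup_UNIV]) simp
  obtain P :: "'p mod_ring mpoly" where P: "P \<in> reduced_mpolys n" "\<forall>x\<in>carrier_vec n. f x = mpoly_eval P x" "total_degree P = d"
    using f unfolding has_poly_degree_def by blast
  have x: "?x c \<in> carrier_vec n" for c using u0 by (simp add: coords_def)
  have deg1: "degle ?V 1 (\<lambda>c. ?x c $ l)" if "l < n" for l
  proof -
    have eq: "?x c $ l = u0 $ l + (\<Sum>i<N. b i $ l * c i)" for c
      using that u0 by (simp add: coords_def mult.commute)
    show ?thesis unfolding eq
      by (intro degle_add degle_const degle_sum degle_cmult[OF V] degle_coordinate finite_lessThan)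
  qed
  have "degle ?V d (\<lambda>c. mpoly_eval P (?x c))"
    unfolding mpoly_eval_def
  proof (intro degle_sum degle_cmult[OF V])
    fix m assume m: "m \<in> Poly_Mapping.keys P"
    have vars: "Poly_Mapping.keys m \<subseteq> {..<n}" using P(1) m unfolding reduced_mpolys_def by blast
    have "monom_degree m \<le> total_degree P"
      unfolding total_degree_def using m by (intro Max_ge) auto
    then have le: "(\<Sum>i\<in>Poly_Mapping.keys m. Poly_Mapping.lookup m i * 1) \<le> d"
      using P(3) by (simp add: monom_degree_def)
    have "degle ?V (\<Sum>i\<in>Poly_Mapping.keys m. Poly_Mapping.lookup m i * 1)
        (\<lambda>c. \<Prod>i\<in>Poly_Mapping.keys m. (?x c $ i) ^ Poly_Mapping.lookup m i)"
      by (intro degle_prod[OF V] degle_power[OF V] deg1) (use vars in auto)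
    then show "degle ?V d (\<lambda>c. \<Prod>i\<in>Poly_Mapping.keys m. (?x c $ i) ^ Poly_Mapping.lookup m i)"
      by (rule degle_mono[OF V le])
  qed
  then show ?thesis using P(2) x by simp
qed

text \<open>Cauchy--Schwarz between the sum of the deviations and the sum of their squares. The
  factor 4 undoes the halving in \<open>statistical_distance\<close>.\<close>

lemma bias_ge_statistical_distance:
  fixes f :: "'x \<Rightarrow> 'f::finite"
  assumes \<phi>: "bij_betw \<phi> V A" and V: "finite V" "V \<noteq> {}"
  shows "4 * (statistical_distance (map_pmf f (pmf_of_set A)) (pmf_of_set UNIV))\<^sup>2 / CARD('f) \<le> bias V (\<lambda>c. f (\<phi> c))"
proof -
  have A: "finite A" "A \<noteq> {}" using V \<phi> unfolding bij_betw_def by auto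
  let ?D = "\<lambda>y. prob V (\<lambda>c. f (\<phi> c) = y) - 1 / real CARD('f)"
  have pmf: "pmf (map_pmf f (pmf_of_set A)) y = prob V (\<lambda>c. f (\<phi> c) = y)" for y
  proof -
    have "pmf (map_pmf f (pmf_of_set A)) y = real (card (A \<inter> f -` {y})) / card A"
      using A by (simp add: pmf_map measure_pmf_of_set)
    also have "A \<inter> f -` {y} = {x\<in>A. f x = y}" by auto
    also have "card {x\<in>A. f x = y} / card A = prob A (\<lambda>x. f x = y)" by (rule prob_card[OF A(1), symmetric])
    also have "\<dots> = prob V (\<lambda>c. f (\<phi> c) = y)" by (rule prob_bij[OF \<phi>, symmetric])
    finally show ?thesis .
  qed
  have "(2 * statistical_distance (map_pmf f (pmf_of_set A)) (pmf_of_set UNIV))\<^sup>2 = (\<Sum>y\<in>UNIV. \<bar>?D y\<bar>)\<^sup>2"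
    by (simp add: statistical_distance_def pmf)
  also have "\<dots> = (avg (UNIV :: 'f set) (\<lambda>y. \<bar>?D y\<bar>))\<^sup>2 * (real CARD('f))\<^sup>2"
    by (simp add: avg_def power_divide)
  also have "\<dots> \<le> avg (UNIV :: 'f set) (\<lambda>y. \<bar>?D y\<bar>\<^sup>2) * (real CARD('f))\<^sup>2"
    by (intro mult_right_mono avg_square_le) simp
  also have "\<dots> = bias V (\<lambda>c. f (\<phi> c)) * CARD('f)"
    by (simp add: avg_def bias_def power2_eq_square)
  finally show ?thesis by (simp add: field_simps power_mult_distrib)
qed

lemma subspaceI:
  fixes U :: "'a::field vec set"
  assumes "U \<subseteq> carrier_vec n" "0\<^sub>v n \<in> U" "\<And>x y. x \<in> U \<Longrightarrow> y \<in> U \<Longrightarrow> x + y \<in> U"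
    "\<And>a x. x \<in> U \<Longrightarrow> a \<cdot>\<^sub>v x \<in> U"
  shows "VectorSpace.subspace class_ring U (module_vec TYPE('a) n)"
  using assms vec_vs vec_module by (auto simp: subspace_def submodule_def module_vec_simps)

text \<open>By contradiction: an affine subspace of dimension \<open>A * k ^ r\<close> on which
  \<open>f\<close> is too far from uniform would contain one of dimension \<open>k\<close> on which
  \<open>f\<close> is constant.\<close>

theorem theorem7:
  shows "\<forall>d::nat. \<forall>\<delta>::real. 3 \<le> d \<longrightarrow> 0 < \<delta> \<longrightarrow>
    (\<exists>c::real. 0 < c \<and>
      (\<forall>(n::nat) (k::nat) (f :: 'p::prime_card mod_ring vec \<Rightarrow> 'p mod_ring).
        affine_disperser n k f \<longrightarrow> has_poly_degree n f d \<longrightarrow>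
        affine_extractor n (nat \<lceil>c * real k ^ (d - 2)\<rceil>) \<delta> f))"
proof (intro allI impI)
  fix d :: nat and \<delta> :: real
  assume d: "3 \<le> d" and \<delta>: "0 < \<delta>"
  define r where "r = d - 2"
  have dr: "d = Suc (Suc r)" and r: "0 < r" using d unfolding r_def by auto
  \<comment> \<open>The bias that \<open>bias_ge_statistical_distance\<close> yields once the
    distance exceeds \<open>\<delta>\<close>.\<close>
  let ?\<eta> = "4 * \<delta>\<^sup>2 / CARD('p)"
  have \<eta>: "0 < ?\<eta>" using \<delta> by simp
  obtain A :: nat where A: "0 < A" "\<forall>(N::nat) (k::nat) (g :: (nat \<Rightarrow> 'p mod_ring) \<Rightarrow> 'p mod_ring).
    degle (tuples UNIV {..<N}) (Suc (Suc r)) g \<longrightarrow> ?\<eta> \<le> bias (tuples UNIV {..<N}) g \<longrightarrow> A * k ^ r \<le> N \<longrightarrow>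
    (\<exists>U \<subseteq> tuples UNIV {..<N}. add_subgroup U \<and> (\<forall>a. \<forall>u\<in>U. smul a u \<in> U) \<and>
       card U = CARD('p) ^ k \<and> (\<forall>u\<in>U. g u = g 0))"
    using ex_constant_subspace_of_bias[OF \<eta> r] by (elim exE conjE)
  show "\<exists>c::real. 0 < c \<and>
      (\<forall>(n::nat) (k::nat) (f :: 'p mod_ring vec \<Rightarrow> 'p mod_ring).
        affine_disperser n k f \<longrightarrow> has_poly_degree n f d \<longrightarrow>
        affine_extractor n (nat \<lceil>c * real k ^ (d - 2)\<rceil>) \<delta> f)"
  proof (intro exI[of _ "real A"] conjI allI impI)
    show "0 < real A" using A(1) by simp
    fix n k and f :: "'p mod_ring vec \<Rightarrow> 'p mod_ring"
    assume disp: "affine_disperser n k f" and deg: "has_poly_degree n f d"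
    let ?N = "A * k ^ r"
    let ?V = "tuples (UNIV :: 'p mod_ring set) {..<?N}"
    \<comment> \<open>As \<open>A\<close> is a natural number, rounding up has no effect.\<close>
    have N: "nat \<lceil>real A * real k ^ (d - 2)\<rceil> = ?N"
      by (metis r_def ceiling_of_nat nat_int of_nat_mult of_nat_power)
    have V: "add_subgroup ?V" by (rule add_subgroup_tuples[OF add_subgroup_UNIV]) simp
    note VD = add_subgroupD[OF V]
    show "affine_extractor n (nat \<lceil>real A * real k ^ (d - 2)\<rceil>) \<delta> f"
      unfolding affine_extractor_def N
    proof (rule ballI, rule ccontr)
      fix S :: "'p mod_ring vec set" assume "S \<in> affine_subspaces n ?N"
      then obtain u0 :: "'p mod_ring vec" and U where S: "S = {u0 + u | u. u \<in> U}" and u0: "u0 \<in> carrier_vec n"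
        and U: "VectorSpace.subspace class_ring U (module_vec TYPE('p mod_ring) n)"
        and dim: "vectorspace.dim class_ring ((module_vec TYPE('p mod_ring) n)\<lparr>carrier := U\<rparr>) = ?N"
        unfolding affine_subspaces_def by blast
      assume far: "\<not> statistical_distance (map_pmf f (pmf_of_set S)) (pmf_of_set UNIV) \<le> \<delta>"
      obtain b where b: "bij_betw (coords n ?N b) ?V U" using subspace_coordinates[OF U dim] by blast
      have cc: "coords n ?N b c \<in> carrier_vec n" for c by (simp add: coords_def)
      let ?\<phi> = "\<lambda>c. u0 + coords n ?N b c"
      have \<phi>: "bij_betw ?\<phi> ?V S"
        unfolding bij_betw_def
      proof
        show "inj_on ?\<phi> ?V"
        proof (rule inj_onI)
          fix c c' assume c: "c \<in> ?V" "c' \<in> ?V" "?\<phi> c = ?\<phi> c'"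
          have "?\<phi> z - u0 = coords n ?N b z" for z
            using u0 by (intro eq_vecI) (simp_all add: coords_def)
          then have "coords n ?N b c = coords n ?N b c'" using c(3) by metis
          then show "c = c'" using b c(1,2) unfolding bij_betw_def by (blast dest: inj_onD)
        qed
        have "U = coords n ?N b ` ?V" using b unfolding bij_betw_def by blast
        then show "?\<phi> ` ?V = S" unfolding S by blast
      qed
      let ?g = "\<lambda>c. f (?\<phi> c)"
      have "?\<eta> \<le> 4 * (statistical_distance (map_pmf f (pmf_of_set S)) (pmf_of_set UNIV))\<^sup>2 / CARD('p mod_ring)"
        using far \<delta> by (auto intro!: divide_right_mono power_mono)
      also have "\<dots> \<le> bias ?V ?g" by (rule bias_ge_statistical_distance[OF \<phi> VD(1,3)])
      finally have bias: "?\<eta> \<le> bias ?V ?g" .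
      have "degle ?V (Suc (Suc r)) ?g" using degle_of_poly_degree[OF deg u0] unfolding dr .
      from A(2)[rule_format, OF this bias order_refl] obtain U' where U': "U' \<subseteq> ?V" "add_subgroup U'"
        "\<forall>a. \<forall>u\<in>U'. smul a u \<in> U'" "card U' = CARD('p) ^ k" "\<forall>u\<in>U'. ?g u = ?g 0"
        by blast
      note UD = add_subgroupD[OF U'(2)]
      let ?W = "coords n ?N b ` U'"
      have W: "VectorSpace.subspace class_ring ?W (module_vec TYPE('p mod_ring) n)"
      proof (rule subspaceI)
        show "?W \<subseteq> carrier_vec n" using cc by blast
        have "coords n ?N b 0 = 0\<^sub>v n" by (intro eq_vecI) (simp_all add: coords_def)
        then show "0\<^sub>v n \<in> ?W" using UD(2) by (metis image_eqI)
        show "x + y \<in> ?W" if "x \<in> ?W" "y \<in> ?W" for x y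
          using that UD(6) by (auto simp: coords_add[symmetric])
        show "a \<cdot>\<^sub>v x \<in> ?W" if "x \<in> ?W" for a x
          using that U'(3) by (auto simp: coords_smul[symmetric])
      qed
      have "card ?W = card U'"
        by (rule card_image) (use b U'(1) in \<open>auto simp: bij_betw_def intro: inj_on_subset\<close>)
      then have "vectorspace.dim class_ring ((module_vec TYPE('p mod_ring) n)\<lparr>carrier := ?W\<rparr>) = k"
        using U'(4) by (intro dim_eq_of_card[OF W]) simp
      then have "{u0 + u | u. u \<in> ?W} \<in> affine_subspaces n k"
        unfolding affine_subspaces_def using u0 W by blast
      moreover have "f constant_on {u0 + u | u. u \<in> ?W}"
        unfolding constant_on_def using U'(5) by blast
      ultimately show False using disp unfolding affine_disperser_def by blast
    qed
  qed
qed

end
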